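(* Given $A\in\mathbb{R}^{n\times d}$, a rank parameter $k$, and an accuracy parameter $\epsilon$, the algorithm FrobeniusLev described in the context computes a set of numbers $\hat p_1,\ldots,\hat p_n$ that, with probability at least $0.7$, are $1$-approximations (in the Frobenius norm sense) to the normalized leverage scores of $A$ with rank parameter $k$. The algorithm runs in $$O\!\left(ndk\,\epsilon^{-1}+(n+d)k^2\epsilon^{-2}\right)$$ time.
   Context: Approximation notion. Let $A_k$ be the best rank-$k$ approximation to $A$, and let $$\mathcal{S}_\epsilon=\{X\in\mathbb{R}^{n\times d}:\ \mathrm{rank}(X)=k,\ \|A-X\|_F\le(1+\epsilon)\|A-A_k\|_F\},$$ where $\|\cdot\|_F$ is the Frobenius norm. Numbers $\hat p_1,\dots,\hat p_n$ are called $\beta$-approximations (in the Frobenius norm sense) to the normalized leverage scores of $A$ with rank parameter $k$ if, for some $X\in\mathcal{S}_\epsilon$, $$\hat p_i\ge\frac{\beta\,\|(U_X)_{(i)}\|_2^2}{k}\ \text{ for all } i\in\{1,\dots,n\},\qquad\text{and}\qquad \sum_{i=1}^n\hat p_i=1,$$ where $U_X\in\mathbb{R}^{n\times k}$ is the matrix of the left singular vectors of $X$ and $(U_X)_{(i)}$ is its $i$-th row. Algorithm FrobeniusLev. Input: $A\in\mathbb{R}^{n\times d}$ with $\mathrm{rank}(A)=\rho$, a rank parameter $k\ll\rho$, and $\epsilon$. 1. Let $r$ be an integer with $r\ge k+\left\lceil\frac{10k}{\epsilon}+1\right\rceil$ (the running time refers to $r$ equal to this lower bound) and construct $\Pi\in\mathbb{R}^{d\times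 r}$ with i.i.d. $\mathcal N(0,1)$ entries. 2. Compute $B=A\Pi\in\mathbb{R}^{n\times r}$. 3. Compute a matrix $Q\in\mathbb{R}^{n\times r}$ whose columns form an orthonormal basis for the column space of $B$. 4. Compute $Q^TA\in\mathbb{R}^{r\times d}$ and its left singular vectors. 5. Let $U_{Q^TA,k}\in\mathbb{R}^{r\times k}$ be the matrix of the top $k$ left singular vectors of $Q^TA$, and compute $\hat\ell_i=\|(QU_{Q^TA,k})_{(i)}\|_2^2$ for all $i\in\{1,\dots,n\}$, where $(\cdot)_{(i)}$ denotes the $i$-th row. 6. Return $\hat p_i=\hat\ell_i/k$ for all $i\in\{1,\dots,n\}$.
   Formalization: The running time is proved for ε bounded by any fixed ε₀ (constant depends on ε₀; it fails as ε→∞ since r≥k+2), counting real operations, with an exact SVD of an m×n matrix charged O(mn·min(m,n)) and an orthonormal basis O(nr²) by assumption, as exact SVD is not finitely computable. *)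

theory Defs
  imports
    "HOL-Probability.Probability"
    "HOL-Library.Monad_Syntax"
    "Jordan_Normal_Form.DL_Rank"
begin

unbundle no vec_syntax and no inner_syntax
hide_type (open) Finite_Cartesian_Product.vec
hide_const (open) Finite_Cartesian_Product.vec Finite_Cartesian_Product.mat
  Finite_Cartesian_Product.row Determinants.det

section \<open>Singular value decomposition and low-rank approximation\<close>

definition frob_norm :: "real mat \<Rightarrow> real" where
  "frob_norm A = sqrt (\<Sum>i<dim_row A. \<Sum>j<dim_col A. (A $$ (i, j))\<^sup>2)"

abbreviation mat_rank :: "real mat \<Rightarrow> nat" where
  "mat_rank A \<equiv> vec_space.rank (dim_row A) A"

abbreviation mat_col_space :: "real mat \<Rightarrow> real vec set" where
  "mat_col_space A \<equiv> vec_space.col_space (dim_row A) A"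

text \<open>
  The thin decomposition \<open>A = U diag(s) V\<^sup>T\<close> with \<open>min n d\<close> singular values, zeros included, in
  nonincreasing order. It is a predicate because the decomposition is not unique.
\<close>
definition is_svd :: "real mat \<Rightarrow> real mat \<Rightarrow> real vec \<Rightarrow> real mat \<Rightarrow> bool" where
  "is_svd A U s V \<longleftrightarrow> (let l = min (dim_row A) (dim_col A) in
     U \<in> carrier_mat (dim_row A) l \<and> s \<in> carrier_vec l \<and> V \<in> carrier_mat (dim_col A) l \<and>
     U\<^sup>T * U = 1\<^sub>m l \<and> V\<^sup>T * V = 1\<^sub>m l \<and>
     (\<forall>i<l. 0 \<le> s $ i) \<and> (\<forall>i j. i \<le> j \<longrightarrow> j < l \<longrightarrow> s $ j \<le> s $ i) \<and>
     A = U * mat_diag l (\<lambda>i. s $ i) * V\<^sup>T)"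

definition first_cols :: "nat \<Rightarrow> real mat \<Rightarrow> real mat" where
  "first_cols k U = Matrix.mat (dim_row U) k (\<lambda>(i, j). U $$ (i, j))"

definition top_left_singular_vectors :: "nat \<Rightarrow> real mat \<Rightarrow> real mat \<Rightarrow> bool" where
  "top_left_singular_vectors k A W \<longleftrightarrow>
     (\<exists>U s V. is_svd A U s V \<and> k \<le> dim_col U \<and> W = first_cols k U)"

definition best_rank_approx :: "nat \<Rightarrow> real mat \<Rightarrow> real mat \<Rightarrow> bool" where
  "best_rank_approx k A Y \<longleftrightarrow>
     Y \<in> carrier_mat (dim_row A) (dim_col A) \<and> mat_rank Y \<le> k \<and>
     (\<forall>Z \<in> carrier_mat (dim_row A) (dim_col A).
        mat_rank Z \<le> k \<longrightarrow> frob_norm (A - Y) \<le> frob_norm (A - Z))"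

text \<open>
  A best approximation \<open>Y\<close> need not be unique, but \<open>frob_norm (A - Y)\<close> does not depend on the
  choice.
\<close>
definition near_optimal :: "real \<Rightarrow> nat \<Rightarrow> real mat \<Rightarrow> real mat set" where
  "near_optimal \<epsilon> k A = {X \<in> carrier_mat (dim_row A) (dim_col A). mat_rank X = k \<and>
     (\<exists>Y. best_rank_approx k A Y \<and> frob_norm (A - X) \<le> (1 + \<epsilon>) * frob_norm (A - Y))}"

text \<open>
  Since \<open>X\<close> has rank \<open>k\<close>, its top \<open>k\<close> left singular vectors \<open>U\<close> are those with nonzero singular
  values. They are determined up to an orthogonal factor on the right, which leaves row norms
  unchanged.
\<close>
definition leverage_approx :: "real \<Rightarrow> real \<Rightarrow> nat \<Rightarrow> real mat \<Rightarrow> real vec \<Rightarrow> bool" where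
  "leverage_approx \<beta> \<epsilon> k A p \<longleftrightarrow>
     p \<in> carrier_vec (dim_row A) \<and>
     (\<exists>X \<in> near_optimal \<epsilon> k A. \<exists>U. top_left_singular_vectors k X U \<and>
        (\<forall>i<dim_row A. p $ i \<ge> \<beta> * (\<Sum>j<k. (U $$ (i, j))\<^sup>2) / real k)) \<and>
     (\<Sum>i<dim_row A. p $ i) = 1"


section \<open>Real random access machine costs\<close>

text \<open>
  A timed value is a result together with the number of unit-cost steps spent on it: arithmetic
  operations, square roots and comparisons of reals, draws of one standard Gaussian number, and
  writes to memory.
\<close>
type_synonym 'a timed = "'a \<times> nat"

definition result :: "'a timed \<Rightarrow> 'a" where "result = fst"
definition steps :: "'a timed \<Rightarrow> nat" where "steps = snd"

definition ret :: "'a \<Rightarrow> 'a timed" where "ret x = (x, 0)"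
definition unit_step :: "'a \<Rightarrow> 'a timed" where "unit_step x = (x, 1)"
definition bind_timed :: "'a timed \<Rightarrow> ('a \<Rightarrow> 'b timed) \<Rightarrow> 'b timed" where
  "bind_timed m f = (result (f (result m)), steps m + steps (f (result m)))"

adhoc_overloading Monad_Syntax.bind \<rightleftharpoons> bind_timed

fun fold_timed :: "('s \<Rightarrow> 'i \<Rightarrow> 's timed) \<Rightarrow> 's \<Rightarrow> 'i list \<Rightarrow> 's timed" where
  "fold_timed f s [] = ret s"
| "fold_timed f s (x # xs) = do { s' \<leftarrow> f s x; fold_timed f s' xs }"

text \<open>Filling an array costs the computation of each entry plus one write per entry.\<close>
definition vec_timed :: "nat \<Rightarrow> (nat \<Rightarrow> real timed) \<Rightarrow> real vec timed" where
  "vec_timed n f = (Matrix.vec n (\<lambda>i. result (f i)), \<Sum>i<n. steps (f i) + 1)"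

definition mat_timed :: "nat \<Rightarrow> nat \<Rightarrow> (nat \<Rightarrow> nat \<Rightarrow> real timed) \<Rightarrow> real mat timed" where
  "mat_timed m n f =
     (Matrix.mat m n (\<lambda>(i, j). result (f i j)), \<Sum>i<m. \<Sum>j<n. steps (f i j) + 1)"

definition dot_timed :: "nat \<Rightarrow> (nat \<Rightarrow> real) \<Rightarrow> (nat \<Rightarrow> real) \<Rightarrow> real timed" where
  "dot_timed n f g =
     fold_timed (\<lambda>s j. do { p \<leftarrow> unit_step (f j * g j); unit_step (s + p) }) 0 [0..<n]"

definition mult_timed :: "real mat \<Rightarrow> real mat \<Rightarrow> real mat timed" where
  "mult_timed A B = mat_timed (dim_row A) (dim_col B)
     (\<lambda>i j. dot_timed (dim_col A) (\<lambda>l. A $$ (i, l)) (\<lambda>l. B $$ (l, j)))"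

text \<open>
  The algorithm leaves open how orthonormal bases and singular vectors are computed, so it is
  parametrised by two routines. They may return any valid output and have the usual running
  times: \<open>O(n r\<^sup>2)\<close> for an orthonormal basis of the columns of an \<open>n \<times> r\<close> matrix, and
  \<open>O(m n min(m,n))\<close> for a singular value decomposition. An exact decomposition is not computable
  by finitely many arithmetic operations and roots, so its cost has to be stipulated; an explicit
  program for the orthonormal basis is given below.
\<close>
definition orthonormal_basis_routine :: "(real mat \<Rightarrow> real mat timed) \<Rightarrow> bool" where
  "orthonormal_basis_routine orth \<longleftrightarrow> (\<exists>c. \<forall>n r. \<forall>B \<in> carrier_mat n r. 0 < n \<longrightarrow>
     (let Q = result (orth B) in
        dim_row Q = n \<and> Q\<^sup>T * Q = 1\<^sub>m (dim_col Q) \<and> mat_col_space Q = mat_col_space B) \<and>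
     real (steps (orth B)) \<le> c * (real n * real r ^ 2 + 1))"

definition left_svd_routine :: "(real mat \<Rightarrow> real mat timed) \<Rightarrow> bool" where
  "left_svd_routine lsv \<longleftrightarrow> (\<exists>c. \<forall>m n. \<forall>B \<in> carrier_mat m n.
     (\<exists>s V. is_svd B (result (lsv B)) s V) \<and>
     real (steps (lsv B)) \<le> c * (real m * real n * real (min m n) + 1))"


subsection \<open>An orthonormal basis routine: modified Gram-Schmidt\<close>

definition orthogonalize_timed :: "nat \<Rightarrow> real vec list \<Rightarrow> real vec \<Rightarrow> real vec timed" where
  "orthogonalize_timed n qs b = fold_timed (\<lambda>w q. do {
     a \<leftarrow> dot_timed n (\<lambda>i. q $ i) (\<lambda>i. w $ i);
     vec_timed n (\<lambda>i. do { p \<leftarrow> unit_step (a * q $ i); unit_step (w $ i - p) })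
   }) b qs"

definition gram_schmidt_step :: "nat \<Rightarrow> real vec list \<Rightarrow> real vec \<Rightarrow> real vec list timed" where
  "gram_schmidt_step n qs b = do {
     w \<leftarrow> orthogonalize_timed n qs b;
     s \<leftarrow> dot_timed n (\<lambda>i. w $ i) (\<lambda>i. w $ i);
     z \<leftarrow> unit_step (s = 0);
     if z then ret qs else do {
       t \<leftarrow> unit_step (sqrt s);
       u \<leftarrow> vec_timed n (\<lambda>i. unit_step (w $ i / t));
       unit_step (qs @ [u])
     }
   }"

definition gram_schmidt_timed :: "real mat \<Rightarrow> real mat timed" where
  "gram_schmidt_timed B = do {
     qs \<leftarrow> fold_timed (gram_schmidt_step (dim_row B)) [] (cols B);
     mat_timed (dim_row B) (length qs) (\<lambda>i j. ret (qs ! j $ i))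
   }"

lemma timed_simps [simp]:
  "result (ret x) = x" "steps (ret x) = 0"
  "result (unit_step x) = x" "steps (unit_step x) = 1"
  "result (bind_timed m f) = result (f (result m))"
  "steps (bind_timed m f) = steps m + steps (f (result m))"
  "result (vec_timed n h) = Matrix.vec n (\<lambda>i. result (h i))"
  "steps (vec_timed n h) = (\<Sum>i<n. steps (h i) + 1)"
  "result (mat_timed k n e) = Matrix.mat k n (\<lambda>(i, j). result (e i j))"
  "steps (mat_timed k n e) = (\<Sum>i<k. \<Sum>j<n. steps (e i j) + 1)"
  by (simp_all add: ret_def unit_step_def bind_timed_def vec_timed_def mat_timed_def
      result_def steps_def)

lemma result_fold_timed: "result (fold_timed f s xs) = foldl (\<lambda>s x. result (f s x)) s xs"
  by (induction xs arbitrary: s) auto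

lemma steps_dot_timed [simp]: "steps (dot_timed n f g) = 2 * n"
proof -
  have "steps (fold_timed (\<lambda>s j. do { p \<leftarrow> unit_step (f j * g j); unit_step (s + p) }) s xs)
      = 2 * length xs" for s xs
    by (induction xs arbitrary: s) auto
  then show ?thesis by (simp add: dot_timed_def)
qed

lemma result_dot_timed [simp]: "result (dot_timed n f g) = (\<Sum>j<n. f j * g j)"
proof -
  have "foldl (\<lambda>s j. s + f j * g j) s xs = s + (\<Sum>j\<leftarrow>xs. f j * g j)" for s xs
    by (induction xs arbitrary: s) auto
  then show ?thesis
    by (simp add: dot_timed_def result_fold_timed interv_sum_list_conv_sum_set_nat atLeast0LessThan)
qed

lemma steps_orthogonalize_timed: "steps (orthogonalize_timed n qs b) = 5 * n * length qs"
  unfolding orthogonalize_timed_def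
  by (induction qs arbitrary: b) (auto simp: algebra_simps)

lemma steps_gram_schmidt_step: "steps (gram_schmidt_step n qs b) \<le> 5 * n * length qs + 4 * n + 3"
  by (simp add: gram_schmidt_step_def steps_orthogonalize_timed)

lemma length_gram_schmidt_step: "length (result (gram_schmidt_step n qs b)) \<le> length qs + 1"
  by (simp add: gram_schmidt_step_def)

lemma gram_schmidt_fold_bounds:
  "length (result (fold_timed (gram_schmidt_step n) qs bs)) \<le> length qs + length bs \<and>
   steps (fold_timed (gram_schmidt_step n) qs bs)
     \<le> length bs * (5 * n * (length qs + length bs) + 4 * n + 3)"
proof (induction bs arbitrary: qs)
  case (Cons b bs)
  let ?qs' = "result (gram_schmidt_step n qs b)"
  have l: "length ?qs' + length bs \<le> length qs + length (b # bs)"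
    using length_gram_schmidt_step[of n qs b] by simp
  have "steps (fold_timed (gram_schmidt_step n) ?qs' bs)
      \<le> length bs * (5 * n * (length ?qs' + length bs) + 4 * n + 3)"
    using Cons.IH by blast
  also have "\<dots> \<le> length bs * (5 * n * (length qs + length (b # bs)) + 4 * n + 3)"
    using l by (meson add_le_mono1 mult_le_mono2)
  finally have 1: "steps (fold_timed (gram_schmidt_step n) ?qs' bs)
      \<le> length bs * (5 * n * (length qs + length (b # bs)) + 4 * n + 3)" .
  have "steps (gram_schmidt_step n qs b) \<le> 5 * n * (length qs + length (b # bs)) + 4 * n + 3"
    using steps_gram_schmidt_step[of n qs b] by (simp add: algebra_simps)
  with 1 have "steps (fold_timed (gram_schmidt_step n) qs (b # bs))
      \<le> length (b # bs) * (5 * n * (length qs + length (b # bs)) + 4 * n + 3)"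
    by simp
  moreover have "length (result (fold_timed (gram_schmidt_step n) qs (b # bs)))
      \<le> length qs + length (b # bs)"
    using Cons.IH[of ?qs'] l by simp
  ultimately show ?case by blast
qed simp

definition linear_closed :: "nat \<Rightarrow> real vec set \<Rightarrow> bool" where
  "linear_closed n T \<longleftrightarrow>
     0\<^sub>v n \<in> T \<and> (\<forall>x\<in>T. \<forall>y\<in>T. \<forall>a. x + a \<cdot>\<^sub>v y \<in> T)"

definition orthonormal_list :: "nat \<Rightarrow> real vec list \<Rightarrow> bool" where
  "orthonormal_list n qs \<longleftrightarrow> set qs \<subseteq> carrier_vec n \<and>
     (\<forall>i<length qs. \<forall>j<length qs. qs ! i \<bullet> qs ! j = (if i = j then 1 else 0))"

lemma orthonormal_list_snoc:
  "orthonormal_list n (qs @ [q]) \<longleftrightarrow>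
     orthonormal_list n qs \<and> q \<in> carrier_vec n \<and> q \<bullet> q = 1 \<and> (\<forall>p\<in>set qs. p \<bullet> q = 0)"
    (is "?L \<longleftrightarrow> ?R")
proof
  assume L: ?L
  then have c: "set qs \<subseteq> carrier_vec n" "q \<in> carrier_vec n"
    and o: "\<And>i j. i < Suc (length qs) \<Longrightarrow> j < Suc (length qs) \<Longrightarrow>
      (qs @ [q]) ! i \<bullet> (qs @ [q]) ! j = (if i = j then 1 else 0)"
    by (auto simp: orthonormal_list_def)
  have "qs ! i \<bullet> qs ! j = (if i = j then 1 else 0)" if "i < length qs" "j < length qs" for i j
    using o[of i j] that by (simp add: nth_append)
  moreover have "q \<bullet> q = 1" using o[of "length qs" "length qs"] by simp
  moreover have "p \<bullet> q = 0" if "p \<in> set qs" for p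
  proof -
    from that obtain i where "i < length qs" "p = qs ! i" by (auto simp: in_set_conv_nth)
    then show ?thesis using o[of i "length qs"] by (simp add: nth_append)
  qed
  ultimately show ?R using c by (simp add: orthonormal_list_def)
next
  assume R: ?R
  have "(qs @ [q]) ! i \<bullet> (qs @ [q]) ! j = (if i = j then 1 else 0)"
    if ij: "i < Suc (length qs)" "j < Suc (length qs)" for i j
  proof -
    have c: "qs ! l \<in> carrier_vec n" "qs ! l \<bullet> q = 0" "q \<bullet> qs ! l = 0" if "l < length qs" for l
    proof -
      show 1: "qs ! l \<in> carrier_vec n" "qs ! l \<bullet> q = 0"
        using R that by (auto simp: orthonormal_list_def)
      then show "q \<bullet> qs ! l = 0" using R by (metis comm_scalar_prod)
    qed
    show ?thesis
      using R ij c by (auto simp: nth_append less_Suc_eq orthonormal_list_def)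
  qed
  then show ?L using R by (auto simp: orthonormal_list_def)
qed

lemma orthogonalize_step:
  fixes q w :: "real vec"
  assumes "q \<in> carrier_vec n" "w \<in> carrier_vec n"
  shows "Matrix.vec n (\<lambda>i. w $ i - (\<Sum>j<n. q $ j * w $ j) * q $ i) = w + (- (q \<bullet> w)) \<cdot>\<^sub>v q"
proof -
  have "(\<Sum>j<n. q $ j * w $ j) = q \<bullet> w"
    using assms by (simp add: scalar_prod_def atLeast0LessThan)
  then show ?thesis using assms by (intro eq_vecI) simp_all
qed

lemma orthogonalize_correct:
  assumes "orthonormal_list n qs" and b: "b \<in> carrier_vec n"
  defines "w \<equiv> result (orthogonalize_timed n qs b)"
  shows "w \<in> carrier_vec n" and "\<forall>p\<in>set qs. p \<bullet> w = 0"
    and "linear_closed n T \<Longrightarrow> set qs \<subseteq> T \<Longrightarrow> w \<in> T \<longleftrightarrow> b \<in> T"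
proof -
  have "w \<in> carrier_vec n \<and> (\<forall>p\<in>set qs. p \<bullet> w = 0) \<and>
      (linear_closed n T \<longrightarrow> set qs \<subseteq> T \<longrightarrow> (w \<in> T \<longleftrightarrow> b \<in> T))"
    using assms(1) unfolding w_def
  proof (induction qs rule: rev_induct)
    case Nil
    then show ?case using b by (simp add: orthogonalize_timed_def)
  next
    case (snoc q qs)
    define v where "v = result (orthogonalize_timed n qs b)"
    have on: "orthonormal_list n qs" and q: "q \<in> carrier_vec n" "q \<bullet> q = 1"
      and pq: "\<And>p. p \<in> set qs \<Longrightarrow> p \<bullet> q = 0"
      using snoc.prems by (auto simp: orthonormal_list_snoc)
    have v: "v \<in> carrier_vec n" and pv: "\<And>p. p \<in> set qs \<Longrightarrow> p \<bullet> v = 0"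
      and T: "linear_closed n T \<Longrightarrow> set qs \<subseteq> T \<Longrightarrow> v \<in> T \<longleftrightarrow> b \<in> T"
      using snoc.IH[OF on] by (auto simp: v_def)
    have pc: "\<And>p. p \<in> set qs \<Longrightarrow> p \<in> carrier_vec n"
      using on by (auto simp: orthonormal_list_def)
    have eq: "result (orthogonalize_timed n (qs @ [q]) b) = v + (- (q \<bullet> v)) \<cdot>\<^sub>v q"
      using orthogonalize_step[OF q(1) v]
      by (simp add: orthogonalize_timed_def result_fold_timed v_def)
    have "p \<bullet> (v + (- (q \<bullet> v)) \<cdot>\<^sub>v q) = p \<bullet> v - (q \<bullet> v) * (p \<bullet> q)"
      if "p \<in> carrier_vec n" for p
      using that v q by (simp add: scalar_prod_add_distrib[of _ n])
    then have o: "\<forall>p\<in>set (qs @ [q]). p \<bullet> (v + (- (q \<bullet> v)) \<cdot>\<^sub>v q) = 0"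
      using pc pv pq q by auto
    have restore: "v + (- (q \<bullet> v)) \<cdot>\<^sub>v q + (q \<bullet> v) \<cdot>\<^sub>v q = v"
      using v q by (intro eq_vecI) auto
    have "v + (- (q \<bullet> v)) \<cdot>\<^sub>v q \<in> T \<longleftrightarrow> b \<in> T"
      if "linear_closed n T" "set (qs @ [q]) \<subseteq> T"
    proof -
      have cl: "x + a \<cdot>\<^sub>v q \<in> T" if "x \<in> T" for x a
        using that \<open>linear_closed n T\<close> \<open>set (qs @ [q]) \<subseteq> T\<close> by (auto simp: linear_closed_def)
      have "v \<in> T" if "v + (- (q \<bullet> v)) \<cdot>\<^sub>v q \<in> T"
        using cl[OF that, of "q \<bullet> v"] restore by simp
      with cl T that show ?thesis by auto
    qed
    then show ?case using eq o v q by auto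
  qed
  then show "w \<in> carrier_vec n" "\<forall>p\<in>set qs. p \<bullet> w = 0"
    "linear_closed n T \<Longrightarrow> set qs \<subseteq> T \<Longrightarrow> w \<in> T \<longleftrightarrow> b \<in> T"
    by auto
qed

lemma gram_schmidt_step_correct:
  assumes on: "orthonormal_list n qs" and b: "b \<in> carrier_vec n"
  defines "qs' \<equiv> result (gram_schmidt_step n qs b)"
  shows "orthonormal_list n qs'"
    and "linear_closed n T \<Longrightarrow> set qs' \<subseteq> T \<longleftrightarrow> set qs \<subseteq> T \<and> b \<in> T"
proof -
  define w where "w = result (orthogonalize_timed n qs b)"
  define t where "t = sqrt (w \<bullet> w)"
  note w = orthogonalize_correct[OF on b, folded w_def]
  have dot: "(\<Sum>j<n. w $ j * w $ j) = w \<bullet> w"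
    using w(1) by (auto simp: scalar_prod_def atLeast0LessThan)
  have nn: "w \<bullet> w \<ge> 0" unfolding dot[symmetric] by (intro sum_nonneg) auto
  have div: "Matrix.vec n (\<lambda>i. w $ i / t) = (1 / t) \<cdot>\<^sub>v w"
    using w(1) by (intro eq_vecI) auto
  have qs': "qs' = (if w \<bullet> w = 0 then qs else qs @ [(1 / t) \<cdot>\<^sub>v w])"
    unfolding qs'_def gram_schmidt_step_def using dot div
    by (auto simp: w_def[symmetric] t_def)
  have "orthonormal_list n qs' \<and>
      (linear_closed n T \<longrightarrow> (set qs' \<subseteq> T \<longleftrightarrow> set qs \<subseteq> T \<and> b \<in> T))"
  proof (cases "w \<bullet> w = 0")
    case True
    have "w $ i = 0" if "i < n" for i
    proof -
      have "(\<Sum>j<n. w $ j * w $ j) = 0" using dot True by simp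
      then have "\<forall>j\<in>{..<n}. w $ j * w $ j = 0"
        by (subst (asm) sum_nonneg_eq_0_iff) auto
      with that show ?thesis by auto
    qed
    then have "w = 0\<^sub>v n" using w(1) by (intro eq_vecI) auto
    then show ?thesis using True qs' on w(3)[of T] by (auto simp: linear_closed_def)
  next
    case False
    then have t: "t > 0" "t * t = w \<bullet> w" using nn by (auto simp: t_def)
    define u where "u = (1 / t) \<cdot>\<^sub>v w"
    have u: "u \<in> carrier_vec n" using w(1) by (simp add: u_def)
    have "u \<bullet> u = 1" using w(1) t by (simp add: u_def t(2)[symmetric] field_simps)
    moreover have "\<forall>p\<in>set qs. p \<bullet> u = 0"
    proof
      fix p assume p: "p \<in> set qs"
      then have "p \<in> carrier_vec n" using on by (auto simp: orthonormal_list_def)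
      then show "p \<bullet> u = 0" using w p by (simp add: u_def)
    qed
    ultimately have on': "orthonormal_list n (qs @ [u])"
      using on u by (simp add: orthonormal_list_snoc)
    have "u \<in> T \<longleftrightarrow> w \<in> T" if T: "linear_closed n T"
    proof -
      have cl: "a \<cdot>\<^sub>v x \<in> T" if "x \<in> T" "x \<in> carrier_vec n" for x a
      proof -
        have "0\<^sub>v n + a \<cdot>\<^sub>v x \<in> T" using T that unfolding linear_closed_def by blast
        moreover have "0\<^sub>v n + a \<cdot>\<^sub>v x = a \<cdot>\<^sub>v x" using that by simp
        ultimately show ?thesis by simp
      qed
      have "t \<cdot>\<^sub>v u = w" using t w(1) by (simp add: u_def smult_smult_assoc)
      then show ?thesis using cl[of u t] cl[of w "1 / t"] u w(1) by (auto simp: u_def)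
    qed
    then show ?thesis using False qs' on' w(3)[of T] by (auto simp: u_def)
  qed
  then show "orthonormal_list n qs'"
    "linear_closed n T \<Longrightarrow> set qs' \<subseteq> T \<longleftrightarrow> set qs \<subseteq> T \<and> b \<in> T"
    by auto
qed

lemma gram_schmidt_fold_correct:
  assumes "orthonormal_list n qs" and "set bs \<subseteq> carrier_vec n"
  defines "qs' \<equiv> result (fold_timed (gram_schmidt_step n) qs bs)"
  shows "orthonormal_list n qs' \<and>
    (\<forall>T. linear_closed n T \<longrightarrow> (set qs' \<subseteq> T \<longleftrightarrow> set qs \<subseteq> T \<and> set bs \<subseteq> T))"
  using assms(1,2) unfolding qs'_def
proof (induction bs arbitrary: qs)
  case (Cons b bs)
  then show ?case using gram_schmidt_step_correct[of n qs b] by auto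
qed auto

lemma gram_schmidt_timed_correct:
  assumes B: "B \<in> carrier_mat n r"
  defines "Q \<equiv> result (gram_schmidt_timed B)"
  shows "dim_row Q = n" "Q\<^sup>T * Q = 1\<^sub>m (dim_col Q)" "mat_col_space Q = mat_col_space B"
proof -
  interpret vec_space "TYPE(real)" n .
  define qs where "qs = result (fold_timed (gram_schmidt_step n) [] (cols B))"
  have Bc: "set (cols B) \<subseteq> carrier_vec n" using B cols_dim[of B] by auto
  have on: "orthonormal_list n qs"
    and T: "\<And>T. linear_closed n T \<Longrightarrow> set qs \<subseteq> T \<longleftrightarrow> set (cols B) \<subseteq> T"
    using gram_schmidt_fold_correct[of n "[]" "cols B"] Bc
    by (auto simp: qs_def orthonormal_list_def)
  have qc: "set qs \<subseteq> carrier_vec n" using on by (simp add: orthonormal_list_def)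
  have Q: "Q = mat_of_cols n qs"
    using B by (auto simp: Q_def gram_schmidt_timed_def qs_def mat_of_cols_def)
  show dr: "dim_row Q = n" by (simp add: Q)
  have cQ: "cols Q = qs" using qc by (simp add: Q)
  show "Q\<^sup>T * Q = 1\<^sub>m (dim_col Q)"
  proof (rule eq_matI)
    fix i j assume "i < dim_row (1\<^sub>m (dim_col Q) :: real mat)"
      and "j < dim_col (1\<^sub>m (dim_col Q) :: real mat)"
    then have ij: "i < length qs" "j < length qs" by (simp_all add: Q)
    then have "col Q i = qs ! i" "col Q j = qs ! j"
      using qc by (auto simp: Q subset_iff)
    then show "(Q\<^sup>T * Q) $$ (i, j) = 1\<^sub>m (dim_col Q) $$ (i, j)"
      using ij on by (simp add: Q orthonormal_list_def)
  qed (simp_all add: Q)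
  have cl: "linear_closed n (span S)" if "S \<subseteq> carrier_vec n" for S
    unfolding linear_closed_def
    using that vectorspace.span_zero[OF vec_vs, of n S] smult_in_span[OF that] span_add1[of S] by auto
  have "span (set qs) = span (set (cols B))"
  proof
    have "set qs \<subseteq> span (set (cols B))"
      using T[OF cl[OF Bc]] in_own_span[OF Bc] by blast
    then show "span (set qs) \<subseteq> span (set (cols B))"
      using span_is_subset[OF _ span_is_submodule] Bc by (metis span_is_monotone span_span)
    have "set (cols B) \<subseteq> span (set qs)"
      using T[OF cl[OF qc]] in_own_span[OF qc] by blast
    then show "span (set (cols B)) \<subseteq> span (set qs)"
      using qc by (metis span_is_monotone span_span)
  qed
  then show "mat_col_space Q = mat_col_space B"
    using dr B cQ by (auto simp: col_space_def)
qed

lemma gram_schmidt_timed_routine: "orthonormal_basis_routine gram_schmidt_timed"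
  unfolding orthonormal_basis_routine_def
proof (intro exI allI ballI impI conjI)
  fix n r :: nat and B :: "real mat"
  assume B: "B \<in> carrier_mat n r" and n: "0 < n"
  show "let Q = result (gram_schmidt_timed B) in
    dim_row Q = n \<and> Q\<^sup>T * Q = 1\<^sub>m (dim_col Q) \<and> mat_col_space Q = mat_col_space B"
    using gram_schmidt_timed_correct[OF B] by (simp add: Let_def)
  let ?fold = "fold_timed (gram_schmidt_step n) [] (cols B)"
  have f: "length (result ?fold) \<le> r" "steps ?fold \<le> r * (5 * n * r + 4 * n + 3)"
    using gram_schmidt_fold_bounds[of n "[]" "cols B"] B by auto
  have "steps (gram_schmidt_timed B) = steps ?fold + n * length (result ?fold)"
    using B by (simp add: gram_schmidt_timed_def)
  also have "\<dots> \<le> r * (5 * n * r + 4 * n + 3) + n * r"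
    using f by (intro add_le_mono mult_le_mono) auto
  also have "\<dots> \<le> 13 * (n * r ^ 2)"
  proof -
    have "n * r \<le> n * r ^ 2" by (simp add: power2_eq_square)
    moreover have "r \<le> n * r" using n by simp
    moreover have "r * (5 * n * r + 4 * n + 3) + n * r = 5 * (n * r ^ 2) + 5 * (n * r) + 3 * r"
      by (simp add: power2_eq_square algebra_simps)
    ultimately show ?thesis by linarith
  qed
  finally have "real (steps (gram_schmidt_timed B)) \<le> real (13 * (n * r ^ 2))"
    by (simp only: of_nat_le_iff)
  then show "real (steps (gram_schmidt_timed B)) \<le> 13 * (real n * real r ^ 2 + 1)"
    by simp
qed


section \<open>The algorithm\<close>

definition sketch_size :: "nat \<Rightarrow> real \<Rightarrow> nat" where
  "sketch_size k \<epsilon> = k + nat \<lceil>10 * real k / \<epsilon> + 1\<rceil>"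

text \<open>
  \<open>g\<close> is the source of Gaussian numbers. The number of columns of \<open>Q\<close> is the rank of \<open>B\<close>, which is
  almost surely \<open>r\<close> if \<open>r\<close> is at most the rank of \<open>A\<close>. Transposing and selecting columns only
  change how entries are addressed and are not charged.
\<close>
definition frobenius_lev ::
  "(real mat \<Rightarrow> real mat timed) \<Rightarrow> (real mat \<Rightarrow> real mat timed) \<Rightarrow>
   real mat \<Rightarrow> nat \<Rightarrow> nat \<Rightarrow> (nat \<Rightarrow> nat \<Rightarrow> real) \<Rightarrow> real vec timed" where
  "frobenius_lev orth lsv A k r g = do {
     P \<leftarrow> mat_timed (dim_col A) r (\<lambda>i j. unit_step (g i j));
     B \<leftarrow> mult_timed A P;
     Q \<leftarrow> orth B;
     C \<leftarrow> mult_timed (Q\<^sup>T) A;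
     U \<leftarrow> lsv C;
     W \<leftarrow> mult_timed Q (first_cols k U);
     l \<leftarrow> vec_timed (dim_row A) (\<lambda>i. dot_timed k (\<lambda>j. W $$ (i, j)) (\<lambda>j. W $$ (i, j)));
     vec_timed (dim_row A) (\<lambda>i. unit_step (l $ i / real k))
   }"

definition iid_std_gaussian ::
  "'w measure \<Rightarrow> nat \<Rightarrow> nat \<Rightarrow> (nat \<Rightarrow> nat \<Rightarrow> 'w \<Rightarrow> real) \<Rightarrow> bool" where
  "iid_std_gaussian M d r G \<longleftrightarrow>
     prob_space.indep_vars M (\<lambda>_. borel) (\<lambda>(i, j). G i j) ({..<d} \<times> {..<r}) \<and>
     (\<forall>i<d. \<forall>j<r. distributed M lborel (G i j) (\<lambda>x. ennreal (std_normal_density x)))"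

end

theory Submission
  imports Defs "HOL-Real_Asymp.Real_Asymp"
begin

text \<open>
  Let \<open>A = U D V\<^sup>T + E\<close>, where \<open>U D V\<^sup>T\<close> is the truncated singular value decomposition of rank \<open>k\<close>, let
  \<open>\<Pi>\<close> be the Gaussian sketch and \<open>G = V\<^sup>T \<Pi>\<close>. If \<open>Z\<close> has rank at most \<open>k\<close> and columns in the
  range of \<open>Q\<close>, then by Eckart-Young applied to \<open>Q\<^sup>T A\<close> the truncation of \<open>Q Q\<^sup>T A\<close> to rank \<open>k\<close> is at least
  as close to \<open>A\<close> as \<open>Z\<close>. Take \<open>Z = A \<Pi> F V\<^sup>T\<close> with the regularised pseudoinverse
  \<open>F = G\<^sup>T (G G\<^sup>T + \<delta>)\<^sup>-\<^sup>1\<close>; its squared error is at most \<open>\<parallel>E\<parallel>\<^sup>2 + \<parallel>E \<Pi> F\<parallel>\<^sup>2\<close> up to a term that vanishes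
  with \<open>\<delta>\<close>.

  Gaussian integration by parts in the entries of \<open>\<Pi>\<close> gives
  \<open>(r - k - 1) \<bbbE> tr (G G\<^sup>T + \<delta>)\<^sup>-\<^sup>1 \<le> k\<close> and, since \<open>E V = 0\<close>,
  \<open>\<bbbE> \<parallel>E \<Pi> F\<parallel>\<^sup>2 = \<parallel>E\<parallel>\<^sup>2 \<bbbE> \<parallel>F\<parallel>\<^sup>2\<close>; this needs neither rotation invariance of the Gaussian measure
  nor the law of inverse Wishart matrices. Regularising keeps all integrands of polynomial growth.
  Markov's inequality for both quantities yields the error bound, and a bounded trace also shows that
  \<open>G G\<^sup>T\<close> is invertible, so that \<open>Q\<^sup>T A\<close> has rank at least \<open>k\<close>.
\<close>

section \<open>The Frobenius inner product and the rank\<close>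

text \<open>The target allows a squared error of \<open>(1 + \<epsilon>)\<^sup>2\<close> times the
  optimum. As this factor is at least \<open>1 + 2 * \<epsilon>\<close>, the sketched residual and
  the bias caused by \<open>\<delta>\<close> may each spend one \<open>\<epsilon>\<close>. The
  parameter \<open>\<delta>\<close> is fixed from the singular values of \<open>A\<close> and from
  \<open>\<epsilon>\<close> before any random number is drawn. That is possible only for a nonzero
  optimal residual; if it vanishes, no bias is affordable, and an exact right inverse of
  \<open>G\<close> takes the place of \<open>F\<close>. The sketch size makes the expected trace at
  most \<open>\<epsilon> / 10\<close>, so each use of Markov's inequality fails with probability at
  most 1/10. The deterministic part is phrased through Frobenius inner products and matrices with
  orthonormal columns; the bounds on the regularised inverse come from norm identities instead of
  eigenvalues. Singular value decompositions are not constructed: their existence is read off from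
  the correctness of the given routine.\<close>

lemma index_mult_sum:
  fixes A B :: "real mat"
  assumes "A \<in> carrier_mat n m" "B \<in> carrier_mat m p" "i < n" "j < p"
  shows "(A * B) $$ (i, j) = (\<Sum>l<m. A $$ (i, l) * B $$ (l, j))"
  using assms by (auto simp: scalar_prod_def atLeast0LessThan)

text \<open>The trace of \<open>A\<^sup>T * B\<close>. Only the shape of \<open>A\<close> is
  consulted, so symmetry needs a carrier hypothesis.\<close>

definition fip :: "real mat \<Rightarrow> real mat \<Rightarrow> real" where
  "fip A B = (\<Sum>i<dim_row A. \<Sum>j<dim_col A. A $$ (i, j) * B $$ (i, j))"

lemma frob_norm_sq: "(frob_norm A)\<^sup>2 = fip A A"
  unfolding frob_norm_def fip_def
  by (subst real_sqrt_pow2) (auto intro!: sum_nonneg simp: power2_eq_square)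

lemma fip_carrier:
  "A \<in> carrier_mat n m \<Longrightarrow> fip A B = (\<Sum>i<n. \<Sum>j<m. A $$ (i, j) * B $$ (i, j))"
  by (auto simp: fip_def)

lemma fip_nonneg: "0 \<le> fip A A"
  by (simp add: fip_def sum_nonneg)

lemma fip_sym:
  assumes "A \<in> carrier_mat n m" "B \<in> carrier_mat n m"
  shows "fip A B = fip B A"
  using assms by (simp add: fip_carrier mult.commute)

lemma fip_add_left:
  assumes "A \<in> carrier_mat n m" "B \<in> carrier_mat n m"
  shows "fip (A + B) C = fip A C + fip B C"
  using assms by (simp add: fip_def sum.distrib distrib_right)

lemma fip_smult_left: "fip (c \<cdot>\<^sub>m A) C = c * fip A C"
  unfolding fip_def sum_distrib_left by (auto simp: mult.assoc intro!: sum.cong)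

lemma fip_transpose:
  assumes "A \<in> carrier_mat n m" "B \<in> carrier_mat n m"
  shows "fip A\<^sup>T B\<^sup>T = fip A B"
proof -
  have "fip A\<^sup>T B\<^sup>T = (\<Sum>j<m. \<Sum>i<n. A $$ (i, j) * B $$ (i, j))"
    using assms by (auto simp: fip_def intro!: sum.cong)
  also have "\<dots> = (\<Sum>i<n. \<Sum>j<m. A $$ (i, j) * B $$ (i, j))" by (rule sum.swap)
  finally show ?thesis using fip_carrier[OF assms(1)] by simp
qed

text \<open>Adjointness, by interchanging the sums. Together with \<open>fip_mult_right\<close> it
  reduces norm and orthogonality claims to matrix products.\<close>

lemma fip_mult_left:
  assumes A: "A \<in> carrier_mat n m" and B: "B \<in> carrier_mat m p" and C: "C \<in> carrier_mat n p"
  shows "fip (A * B) C = fip B (A\<^sup>T * C)"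
proof -
  have "fip (A * B) C = (\<Sum>i<n. \<Sum>j<p. \<Sum>l<m. A $$ (i, l) * B $$ (l, j) * C $$ (i, j))"
    using fip_carrier[OF mult_carrier_mat[OF A B], of C] index_mult_sum[OF A B]
    by (simp add: sum_distrib_right)
  also have "\<dots> = (\<Sum>i<n. \<Sum>l<m. \<Sum>j<p. A $$ (i, l) * B $$ (l, j) * C $$ (i, j))"
    by (intro sum.cong refl sum.swap)
  also have "\<dots> = (\<Sum>l<m. \<Sum>i<n. \<Sum>j<p. A $$ (i, l) * B $$ (l, j) * C $$ (i, j))"
    by (rule sum.swap)
  also have "\<dots> = (\<Sum>l<m. \<Sum>j<p. \<Sum>i<n. A $$ (i, l) * B $$ (l, j) * C $$ (i, j))"
    by (intro sum.cong refl sum.swap)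
  also have "\<dots> = (\<Sum>l<m. \<Sum>j<p. B $$ (l, j) * (\<Sum>i<n. A\<^sup>T $$ (l, i) * C $$ (i, j)))"
    using A by (simp add: sum_distrib_left mult_ac)
  also have "\<dots> = fip B (A\<^sup>T * C)"
    using fip_carrier[OF B, of "A\<^sup>T * C"] A index_mult_sum[of "A\<^sup>T" m n C p] C by simp
  finally show ?thesis .
qed

lemma fip_mult_right:
  assumes A: "A \<in> carrier_mat n m" and B: "B \<in> carrier_mat m p" and C: "C \<in> carrier_mat n p"
  shows "fip (A * B) C = fip A (C * B\<^sup>T)"
proof -
  have "fip (A * B) C = fip (B\<^sup>T * A\<^sup>T) C\<^sup>T"
    using fip_transpose[of "A * B" n p C] A B C by (simp add: transpose_mult)
  also have "\<dots> = fip A\<^sup>T (B * C\<^sup>T)"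
    using fip_mult_left[of "B\<^sup>T" p m "A\<^sup>T" n "C\<^sup>T"] A B C by simp
  also have "\<dots> = fip A\<^sup>T (C * B\<^sup>T)\<^sup>T"
    using transpose_mult[of C n p "B\<^sup>T" m] A B C by simp
  also have "\<dots> = fip A (C * B\<^sup>T)"
    using fip_transpose[of A n m "C * B\<^sup>T"] A B C by simp
  finally show ?thesis .
qed

lemma fip_isometry:
  assumes Q: "Q \<in> carrier_mat n q" "Q\<^sup>T * Q = 1\<^sub>m q"
    and M: "M \<in> carrier_mat q d" and N: "N \<in> carrier_mat q d"
  shows "fip (Q * M) (Q * N) = fip M N"
proof -
  have "Q\<^sup>T * (Q * N) = N"
    using assoc_mult_mat[of "Q\<^sup>T" q n Q q N d] Q N by simp
  then show ?thesis using fip_mult_left[of Q n q M d "Q * N"] Q M N by simp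
qed

lemma fip_isometry_right:
  assumes Q: "Q \<in> carrier_mat d q" "Q\<^sup>T * Q = 1\<^sub>m q"
    and M: "M \<in> carrier_mat n q" and N: "N \<in> carrier_mat n q"
  shows "fip (M * Q\<^sup>T) (N * Q\<^sup>T) = fip M N"
proof -
  have "fip (M * Q\<^sup>T) (N * Q\<^sup>T) = fip (Q * M\<^sup>T) (Q * N\<^sup>T)"
    using fip_transpose[of "M * Q\<^sup>T" n d "N * Q\<^sup>T"] Q M N by (simp add: transpose_mult[of _ n q _ d])
  also have "\<dots> = fip M N"
    using fip_isometry[OF Q, of "M\<^sup>T" n "N\<^sup>T"] fip_transpose M N by simp
  finally show ?thesis .
qed

lemma fip_add_self:
  assumes "A \<in> carrier_mat n m" "B \<in> carrier_mat n m" "fip A B = 0"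
  shows "fip (A + B) (A + B) = fip A A + fip B B"
proof -
  have "fip (A + B) (A + B) = fip A (A + B) + fip B (A + B)"
    using assms by (simp add: fip_add_left)
  also have "fip A (A + B) = fip A A + fip B A"
    using assms fip_sym[of A n m "A + B"] by (simp add: fip_add_left)
  also have "fip B (A + B) = fip A B + fip B B"
    using assms fip_sym[of B n m "A + B"] by (simp add: fip_add_left)
  also have "fip B A = 0" using assms fip_sym by metis
  finally show ?thesis using assms by simp
qed

text \<open>Pythagoras for the orthogonal projector \<open>Q * Q\<^sup>T\<close>: the remainder is
  killed by \<open>Q\<^sup>T\<close>, hence orthogonal to the range of \<open>Q\<close>.\<close>

lemma fip_projection:
  assumes Q: "Q \<in> carrier_mat n q" "Q\<^sup>T * Q = 1\<^sub>m q" and D: "D \<in> carrier_mat n d"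
  shows "fip D D = fip (D - Q * (Q\<^sup>T * D)) (D - Q * (Q\<^sup>T * D)) + fip (Q\<^sup>T * D) (Q\<^sup>T * D)"
proof -
  let ?P = "Q * (Q\<^sup>T * D)"
  have P: "?P \<in> carrier_mat n d" using Q D by auto
  have "D - X + X = D" if "X \<in> carrier_mat n d" for X
    using D that by (intro eq_matI) auto
  note canc = this[OF P]
  have QtP: "Q\<^sup>T * ?P = Q\<^sup>T * D"
    using assoc_mult_mat[of "Q\<^sup>T" q n Q q "Q\<^sup>T * D" d] Q D by simp
  have "Q\<^sup>T * (D - ?P) = Q\<^sup>T * D - Q\<^sup>T * ?P"
    using Q D P by (intro mult_minus_distrib_mat) auto
  also have "\<dots> = 0\<^sub>m q d" unfolding QtP using Q D by auto
  finally have z: "Q\<^sup>T * (D - ?P) = 0\<^sub>m q d" .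
  have "fip ?P (D - ?P) = fip (Q\<^sup>T * D) (Q\<^sup>T * (D - ?P))"
    using Q D P by (intro fip_mult_left) auto
  also have "\<dots> = 0" unfolding z using Q D by (simp add: fip_def)
  finally have "fip (D - ?P) ?P = 0"
    using fip_sym[OF P minus_carrier_mat[OF P]] by simp
  then have "fip (D - ?P + ?P) (D - ?P + ?P) = fip (D - ?P) (D - ?P) + fip ?P ?P"
    by (rule fip_add_self[OF minus_carrier_mat[OF P] P])
  moreover note canc
  moreover have "fip ?P ?P = fip (Q\<^sup>T * D) (Q\<^sup>T * D)"
    using fip_isometry[OF Q mult_carrier_mat[OF _ D] mult_carrier_mat[OF _ D]] Q(1) by simp
  ultimately show ?thesis by simp
qed

lemma fip_projection_le:
  assumes "Q \<in> carrier_mat n q" "Q\<^sup>T * Q = 1\<^sub>m q" "D \<in> carrier_mat n d"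
  shows "fip (Q\<^sup>T * D) (Q\<^sup>T * D) \<le> fip D D"
  using fip_projection[OF assms] fip_nonneg[of "D - Q * (Q\<^sup>T * D)"] by simp

lemma fip_orthonormal:
  assumes "Q \<in> carrier_mat n q" "Q\<^sup>T * Q = 1\<^sub>m q"
  shows "fip Q Q = real q"
proof -
  have "fip (Q * 1\<^sub>m q) (Q * 1\<^sub>m q) = fip (1\<^sub>m q) (1\<^sub>m q)"
    using assms by (intro fip_isometry) auto
  also have "\<dots> = (\<Sum>i<q. \<Sum>j<q. if i = j then 1 else 0)"
    by (auto simp: fip_def if_distrib[of "\<lambda>x. x * _"] cong: if_cong intro!: sum.cong)
  also have "\<dots> = real q" by simp
  finally show ?thesis using assms by simp
qed

section \<open>Column spaces and rank through orthonormal bases\<close>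

text \<open>\<open>Y\<close> inherits orthonormal columns from \<open>W\<close>. Projecting the
  identity of size \<open>q\<close> onto them cannot increase its squared norm, so dimensions are
  compared as squared Frobenius norms.\<close>

lemma orthonormal_range_le:
  fixes Q :: "real mat"
  assumes Q: "Q \<in> carrier_mat n q" "Q\<^sup>T * Q = 1\<^sub>m q"
    and W: "W \<in> carrier_mat n k" "W\<^sup>T * W = 1\<^sub>m k"
    and Y: "W = Q * Y" "Y \<in> carrier_mat q k"
  shows "k \<le> q"
proof -
  have YtY: "Y\<^sup>T * Y = 1\<^sub>m k"
  proof -
    have "W\<^sup>T * W = Y\<^sup>T * (Q\<^sup>T * (Q * Y))"
      unfolding Y(1) using Q Y(2)
      by (simp add: transpose_mult[of Q n q Y k] assoc_mult_mat[of "Y\<^sup>T" k q "Q\<^sup>T" n _ k])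
    also have "Q\<^sup>T * (Q * Y) = Y"
      using assoc_mult_mat[of "Q\<^sup>T" q n Q q Y k] Q Y(2) by simp
    finally show ?thesis using W by simp
  qed
  have "fip (Y\<^sup>T * 1\<^sub>m q) (Y\<^sup>T * 1\<^sub>m q) \<le> fip (1\<^sub>m q) (1\<^sub>m q)"
    using Y YtY by (intro fip_projection_le) auto
  then have "fip Y Y \<le> fip (1\<^sub>m q) (1\<^sub>m q)" using fip_transpose[of Y q k Y] Y by simp
  then show ?thesis
    using fip_orthonormal[OF Y(2) YtY] fip_orthonormal[of "1\<^sub>m q" q q] by simp
qed

text \<open>A preimage is chosen for each column, and the choices are assembled into
  \<open>Y\<close>. Range arguments thereby become matrix identities.\<close>

lemma col_space_factor:
  fixes Q B :: "real mat"
  assumes Q: "Q \<in> carrier_mat n q" and B: "B \<in> carrier_mat n r"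
    and sub: "mat_col_space B \<subseteq> mat_col_space Q"
  obtains Y where "Y \<in> carrier_mat q r" "B = Q * Y"
proof -
  interpret vec_space "TYPE(real)" n .
  have "\<exists>y. y \<in> carrier_vec q \<and> Q *\<^sub>v y = col B j" if j: "j < r" for j
  proof -
    have "set (cols B) \<subseteq> carrier_vec n" using B cols_dim[of B] by auto
    then have "set (cols B) \<subseteq> col_space B" unfolding col_space_def by (rule in_own_span)
    moreover have "col B j \<in> set (cols B)" using B j by (simp add: cols_def)
    ultimately have "col B j \<in> col_space Q" using sub B Q by auto
    then show ?thesis using col_space_eq[OF Q] Q by auto
  qed
  then obtain y where y: "\<And>j. j < r \<Longrightarrow> y j \<in> carrier_vec q \<and> Q *\<^sub>v y j = col B j" by metis
  define Y where "Y = mat_of_cols q (map y [0..<r])"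
  have Y: "Y \<in> carrier_mat q r" using mat_of_cols_carrier(1)[of q "map y [0..<r]"] by (simp add: Y_def)
  have "B = Q * Y"
  proof (rule eq_matI)
    fix i j assume "i < dim_row (Q * Y)" "j < dim_col (Q * Y)"
    then have ij: "i < n" "j < r" using Q Y by auto
    have "col Y j = y j" using ij y[of j] by (simp add: Y_def)
    then have "(Q * Y) $$ (i, j) = (Q *\<^sub>v y j) $ i" using ij Q Y by simp
    then show "B $$ (i, j) = (Q * Y) $$ (i, j)" using y[of j] ij B by simp
  qed (use Q Y B in auto)
  with Y that show thesis by blast
qed

lemma orthonormal_fix_range:
  fixes Q B :: "real mat"
  assumes Q: "Q \<in> carrier_mat n q" "Q\<^sup>T * Q = 1\<^sub>m q"
    and Y: "Y \<in> carrier_mat q r" "B = Q * Y"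
  shows "Q * (Q\<^sup>T * B) = B"
  unfolding Y(2) using assoc_mult_mat[of "Q\<^sup>T" q n Q q Y r] Q Y(1) by simp

lemma rank_orthonormal:
  fixes Q :: "real mat"
  assumes Q: "Q \<in> carrier_mat n q" "Q\<^sup>T * Q = 1\<^sub>m q"
  shows "vec_space.rank n Q = q"
proof -
  interpret vec_space "TYPE(real)" n .
  have inner: "col Q i \<bullet> col Q j = (if i = j then 1 else 0)" if "i < q" "j < q" for i j
  proof -
    have "(Q\<^sup>T * Q) $$ (i, j) = col Q i \<bullet> col Q j" using Q(1) that by simp
    then show ?thesis using Q(2) that by simp
  qed
  \<comment> \<open>Independence concerns the set of columns, so repeated columns have to be
    excluded separately; inner product 0 against 1 does this.\<close>
  have dist: "distinct (cols Q)"
    unfolding distinct_conv_nth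
  proof (intro allI impI)
    fix i j assume "i < length (cols Q)" "j < length (cols Q)" "i \<noteq> j"
    then show "cols Q ! i \<noteq> cols Q ! j"
      using inner[of i j] inner[of i i] Q by auto
  qed
  have "lin_indpt (set (cols Q))"
  proof
    assume "lin_dep (set (cols Q))"
    from lin_depE[OF Q(1) this dist] obtain v where v: "v \<in> carrier_vec q" "v \<noteq> 0\<^sub>v q" "Q *\<^sub>v v = 0\<^sub>v n"
      by metis
    have "v = (Q\<^sup>T * Q) *\<^sub>v v" using Q v by simp
    also have "\<dots> = Q\<^sup>T *\<^sub>v (Q *\<^sub>v v)"
      using Q v by (intro assoc_mult_mat_vec) auto
    also have "\<dots> = 0\<^sub>v q" unfolding v(3) using Q by (intro eq_vecI) auto
    finally show False using v by simp
  qed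
  then show ?thesis using lin_indpt_full_rank[OF Q(1) dist] by simp
qed

lemma rank_eq_of_col_space_eq:
  fixes A B :: "real mat"
  assumes "mat_col_space A = mat_col_space B" "dim_row A = dim_row B"
  shows "mat_rank A = mat_rank B"
  using assms unfolding vec_space.rank_def vec_space.col_space_def by simp

text \<open>The Gram-Schmidt program doubles as the existence proof for an orthonormal basis, and
  the rank becomes its number of columns.\<close>

lemma orthonormal_range_basis:
  fixes B :: "real mat"
  assumes B: "B \<in> carrier_mat n r"
  obtains q Q Y where "Q \<in> carrier_mat n q" "Q\<^sup>T * Q = 1\<^sub>m q" "q \<le> r" "q = mat_rank B"
    "Q * (Q\<^sup>T * B) = B" "Y \<in> carrier_mat r q" "Q = B * Y"
proof -
  define Q where "Q = result (gram_schmidt_timed B)"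
  define q where "q = dim_col Q"
  note c = gram_schmidt_timed_correct[OF B, folded Q_def]
  have Q: "Q \<in> carrier_mat n q" "Q\<^sup>T * Q = 1\<^sub>m q" using c by (auto simp: q_def)
  obtain Y where Y: "Y \<in> carrier_mat r q" "Q = B * Y"
    using col_space_factor[OF B Q(1)] c(3) by auto
  obtain Z where Z: "Z \<in> carrier_mat q r" "B = Q * Z"
    using col_space_factor[OF Q(1) B] c(3) by auto
  have rk: "mat_rank B = q"
    using rank_eq_of_col_space_eq[OF c(3)] rank_orthonormal[OF Q] Q(1) B by simp
  have "q \<le> r" using vec_space.rank_le_nc[of B n r] B rk by simp
  then show thesis
    by (rule that[OF Q _ rk[symmetric] orthonormal_fix_range[OF Q Z] Y])
qed

lemma rank_ge_orthonormal:
  fixes X :: "real mat"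
  assumes X: "X \<in> carrier_mat n m" and W: "W \<in> carrier_mat n k" "W\<^sup>T * W = 1\<^sub>m k"
    and Y: "Y \<in> carrier_mat m k" "W = X * Y"
  shows "k \<le> mat_rank X"
proof -
  obtain q Q Y' where Q: "Q \<in> carrier_mat n q" "Q\<^sup>T * Q = 1\<^sub>m q" "q = mat_rank X" "Q * (Q\<^sup>T * X) = X"
    using orthonormal_range_basis[OF X] by metis
  have "W = Q * (Q\<^sup>T * X * Y)"
    unfolding Y(2) using Q X Y(1) assoc_mult_mat[of Q n q "Q\<^sup>T * X" m Y k] by simp
  moreover have "Q\<^sup>T * X * Y \<in> carrier_mat q k" using Q(1) X Y(1) by auto
  ultimately show ?thesis using orthonormal_range_le[OF Q(1,2) W] Q(3) by simp
qed

text \<open>An orthonormal basis of the range of \<open>P * N\<close> lies in the range of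
  \<open>P\<close>, whose rank is at most its number of columns.\<close>

lemma rank_mult_le:
  fixes P N :: "real mat"
  assumes P: "P \<in> carrier_mat n m" and N: "N \<in> carrier_mat m d"
  shows "mat_rank (P * N) \<le> m"
proof -
  have PN: "P * N \<in> carrier_mat n d" using assms by simp
  obtain q Q Y where Q: "Q \<in> carrier_mat n q" "Q\<^sup>T * Q = 1\<^sub>m q" "q = mat_rank (P * N)"
    and Y: "Y \<in> carrier_mat d q" "Q = P * N * Y"
    using orthonormal_range_basis[OF PN] by metis
  have "Q = P * (N * Y)" using Y P N by (simp add: assoc_mult_mat[of P n m N d Y q])
  then have "q \<le> mat_rank P"
    using rank_ge_orthonormal[OF P Q(1,2), of "N * Y"] N Y by simp
  also have "\<dots> \<le> m" using vec_space.rank_le_nc[of P n m] P by simp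
  finally show ?thesis using Q(3) by simp
qed

section \<open>Truncated singular value decompositions\<close>

text \<open>Matrix products are total and their shape depends on the outer dimensions only; hence an
  equivalence, suited to the simplifier.\<close>

lemma mult_carrier_mat_iff [simp]:
  fixes A B :: "real mat"
  shows "A * B \<in> carrier_mat n m \<longleftrightarrow> dim_row A = n \<and> dim_col B = m"
  unfolding carrier_mat_def mem_Collect_eq index_mult_mat(2,3) ..

lemma mat_diag_dims [simp]: "dim_row (mat_diag n f) = n" "dim_col (mat_diag n f) = n"
  by (simp_all add: mat_diag_def)

lemma fip_self_eq_0:
  assumes "A \<in> carrier_mat n m" "fip A A = 0"
  shows "A = 0\<^sub>m n m"
proof (rule eq_matI)
  fix i j assume "i < dim_row (0\<^sub>m n m :: real mat)" "j < dim_col (0\<^sub>m n m :: real mat)"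
  then have ij: "i < n" "j < m" by auto
  have "(\<Sum>i<n. \<Sum>j<m. A $$ (i, j) * A $$ (i, j)) = 0"
    using assms(2) fip_carrier[OF assms(1), of A] by simp
  then have "\<forall>i\<in>{..<n}. (\<Sum>j<m. A $$ (i, j) * A $$ (i, j)) = 0"
    by (subst (asm) sum_nonneg_eq_0_iff) (auto intro!: sum_nonneg)
  then have "(\<Sum>j<m. A $$ (i, j) * A $$ (i, j)) = 0" using ij by auto
  then have "\<forall>j\<in>{..<m}. A $$ (i, j) * A $$ (i, j) = 0"
    by (subst (asm) sum_nonneg_eq_0_iff) auto
  then show "A $$ (i, j) = 0\<^sub>m n m $$ (i, j)" using ij by auto
qed (use assms in auto)

lemma fip_mult_mat_diag:
  assumes N: "N \<in> carrier_mat q l"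
  shows "fip (N * mat_diag l f) (N * mat_diag l f) = (\<Sum>i<l. (f i)\<^sup>2 * (\<Sum>j<q. (N $$ (j, i))\<^sup>2))"
proof -
  have "fip (N * mat_diag l f) (N * mat_diag l f) = (\<Sum>j<q. \<Sum>i<l. (N $$ (j, i) * f i) * (N $$ (j, i) * f i))"
    unfolding mat_diag_mult_right[OF N] by (simp add: fip_def)
  also have "\<dots> = (\<Sum>i<l. \<Sum>j<q. (N $$ (j, i) * f i) * (N $$ (j, i) * f i))" by (rule sum.swap)
  finally show ?thesis by (simp add: sum_distrib_left power2_eq_square mult_ac)
qed

lemma fip_mat_diag: "fip (mat_diag l f) (mat_diag l f) = (\<Sum>i<l. (f i)\<^sup>2)"
proof -
  have "(\<Sum>j<l. (1\<^sub>m l $$ (j, i) :: real)\<^sup>2) = 1" if "i < l" for i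
  proof -
    have "(\<Sum>j<l. (1\<^sub>m l $$ (j, i) :: real)\<^sup>2) = (\<Sum>j<l. if j = i then 1 else 0)"
      using that by (intro sum.cong) auto
    then show ?thesis using that by simp
  qed
  then have "fip (1\<^sub>m l * mat_diag l f) (1\<^sub>m l * mat_diag l f) = (\<Sum>i<l. (f i)\<^sup>2)"
    by (subst fip_mult_mat_diag[of _ l]) auto
  then show ?thesis unfolding left_mult_one_mat[OF mat_diag_dim] .
qed

lemma mat_diag_cong: "(\<And>i. i < n \<Longrightarrow> f i = g i) \<Longrightarrow> mat_diag n f = mat_diag n g"
  unfolding mat_diag_def by (intro cong_mat) auto

lemma mat_diag_transpose [simp]: "(mat_diag n f)\<^sup>T = mat_diag n f"
  unfolding mat_diag_def by (intro eq_matI) auto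

lemma fip_sandwich:
  assumes U: "U \<in> carrier_mat n l" "U\<^sup>T * U = 1\<^sub>m l" and V: "V \<in> carrier_mat d l" "V\<^sup>T * V = 1\<^sub>m l"
    and D: "D \<in> carrier_mat l l"
  shows "fip (U * D * V\<^sup>T) (U * D * V\<^sup>T) = fip D D"
  using fip_isometry_right[OF V, of "U * D" n "U * D"] fip_isometry[OF U D D] U D by simp

lemma is_svdD:
  assumes "is_svd A U s V" "A \<in> carrier_mat n d"
  defines "l \<equiv> min n d"
  shows "U \<in> carrier_mat n l" "s \<in> carrier_vec l" "V \<in> carrier_mat d l"
    "U\<^sup>T * U = 1\<^sub>m l" "V\<^sup>T * V = 1\<^sub>m l" "\<And>i. i < l \<Longrightarrow> 0 \<le> s $ i"
    "\<And>i j. i \<le> j \<Longrightarrow> j < l \<Longrightarrow> s $ j \<le> s $ i" "A = U * mat_diag l (\<lambda>i. s $ i) * V\<^sup>T"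
  using assms unfolding is_svd_def Let_def by auto

lemma first_cols_carrier: "U \<in> carrier_mat n l \<Longrightarrow> first_cols k U \<in> carrier_mat n k"
  by (auto simp: first_cols_def)

text \<open>Right multiplication by this matrix selects the leading columns, so that truncating a
  decomposition becomes matrix algebra.\<close>

definition embed_mat :: "nat \<Rightarrow> nat \<Rightarrow> real mat" where
  "embed_mat l k = Matrix.mat l k (\<lambda>(i, j). if i = j then 1 else 0)"

lemma embed_mat_carrier [simp]: "embed_mat l k \<in> carrier_mat l k"
  by (simp add: embed_mat_def)

lemma embed_mat_dims [simp]: "dim_row (embed_mat l k) = l" "dim_col (embed_mat l k) = k"
  by (simp_all add: embed_mat_def)

lemma first_cols_eq:
  assumes U: "U \<in> carrier_mat n l" and k: "k \<le> l"
  shows "first_cols k U = U * embed_mat l k"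
proof (rule eq_matI)
  fix i j assume "i < dim_row (U * embed_mat l k)" "j < dim_col (U * embed_mat l k)"
  then have ij: "i < n" "j < k" using U by (auto simp: embed_mat_def)
  have "(U * embed_mat l k) $$ (i, j) = (\<Sum>m<l. U $$ (i, m) * embed_mat l k $$ (m, j))"
    using index_mult_sum[OF U embed_mat_carrier ij] .
  also have "\<dots> = (\<Sum>m<l. if m = j then U $$ (i, m) else 0)"
    using ij by (intro sum.cong) (auto simp: embed_mat_def)
  also have "\<dots> = U $$ (i, j)" using ij k by simp
  finally show "first_cols k U $$ (i, j) = (U * embed_mat l k) $$ (i, j)"
    using ij U by (simp add: first_cols_def)
qed (use U in \<open>auto simp: first_cols_def embed_mat_def\<close>)

lemma embed_mat_orthonormal:
  assumes "k \<le> l"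
  shows "(embed_mat l k)\<^sup>T * embed_mat l k = 1\<^sub>m k"
proof (rule eq_matI)
  fix i j assume "i < dim_row (1\<^sub>m k :: real mat)" "j < dim_col (1\<^sub>m k :: real mat)"
  then have ij: "i < k" "j < k" by auto
  have "((embed_mat l k)\<^sup>T * embed_mat l k) $$ (i, j) = (\<Sum>m<l. (embed_mat l k)\<^sup>T $$ (i, m) * embed_mat l k $$ (m, j))"
    using index_mult_sum[of "(embed_mat l k)\<^sup>T" k l "embed_mat l k" k] ij by simp
  also have "\<dots> = (\<Sum>m<l. if m = i then (if i = j then 1 else 0) else 0)"
    using ij by (intro sum.cong) (auto simp: embed_mat_def)
  also have "\<dots> = (if i = j then 1 else 0)" using ij assms by simp
  finally show "((embed_mat l k)\<^sup>T * embed_mat l k) $$ (i, j) = 1\<^sub>m k $$ (i, j)" using ij by simp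
qed (auto simp: embed_mat_def)

lemma embed_mat_diag:
  assumes "k \<le> l"
  shows "mat_diag l f * embed_mat l k = embed_mat l k * mat_diag k f"
  unfolding mat_diag_mult_left[OF embed_mat_carrier] mat_diag_mult_right[OF embed_mat_carrier]
  by (intro cong_mat) (auto simp: embed_mat_def)

lemma first_cols_orthonormal:
  assumes U: "U \<in> carrier_mat n l" "U\<^sup>T * U = 1\<^sub>m l" and k: "k \<le> l"
  shows "(first_cols k U)\<^sup>T * first_cols k U = 1\<^sub>m k"
proof -
  let ?J = "embed_mat l k"
  have "(first_cols k U)\<^sup>T * first_cols k U = ?J\<^sup>T * (U\<^sup>T * (U * ?J))"
    unfolding first_cols_eq[OF U(1) k] using U
    by (simp add: transpose_mult[of U n l ?J k] assoc_mult_mat[of "?J\<^sup>T" k l "U\<^sup>T" n _ k])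
  also have "U\<^sup>T * (U * ?J) = ?J"
    using assoc_mult_mat[of "U\<^sup>T" l n U l ?J k] U left_mult_one_mat[OF embed_mat_carrier] by simp
  finally show ?thesis using embed_mat_orthonormal[OF k] by simp
qed

text \<open>The diagonal is cut at position \<open>k\<close> into \<open>D1 + D2\<close>, and
  \<open>E\<close> is the part carried by \<open>D2\<close>. Both orthogonality relations hold
  because \<open>D2\<close> vanishes on the embedded first \<open>k\<close> coordinates; invariance
  of the norm under \<open>U\<close> and \<open>V\<close> leaves the tail of the squared singular
  values.\<close>

lemma svd_split:
  assumes svd: "is_svd A U s V" and A: "A \<in> carrier_mat n d" and k: "k \<le> min n d"
  defines "Uk \<equiv> first_cols k U" and "Vk \<equiv> first_cols k V" and "D \<equiv> mat_diag k (\<lambda>i. s $ i)"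
  obtains E where "E \<in> carrier_mat n d" "A = Uk * D * Vk\<^sup>T + E"
    "Uk \<in> carrier_mat n k" "Uk\<^sup>T * Uk = 1\<^sub>m k" "Vk \<in> carrier_mat d k" "Vk\<^sup>T * Vk = 1\<^sub>m k"
    "E * Vk = 0\<^sub>m n k" "Uk\<^sup>T * E = 0\<^sub>m k d" "fip E E = (\<Sum>i=k..<min n d. (s $ i)\<^sup>2)"
proof -
  define l where "l = min n d"
  note S = is_svdD[OF svd A, folded l_def]
  have kl: "k \<le> l" using k by (simp add: l_def)
  let ?J = "embed_mat l k"
  define D1 where "D1 = mat_diag l (\<lambda>i. if i < k then s $ i else 0)"
  define D2 where "D2 = mat_diag l (\<lambda>i. if i < k then 0 else s $ i)"
  have Dc: "D1 \<in> carrier_mat l l" "D2 \<in> carrier_mat l l" by (simp_all add: D1_def D2_def)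
  have sum: "mat_diag l (\<lambda>i. s $ i) = D1 + D2"
    unfolding D1_def D2_def mat_diag_def by (intro eq_matI) auto
  have Uk: "Uk = U * ?J" and Vk: "Vk = V * ?J"
    unfolding Uk_def Vk_def using first_cols_eq S kl by auto
  have Ukc: "Uk \<in> carrier_mat n k" and Vkc: "Vk \<in> carrier_mat d k"
    unfolding Uk_def Vk_def using first_cols_carrier S by auto
  have JDJ: "?J * D * ?J\<^sup>T = D1"
  proof -
    \<comment> \<open>\<open>?J * ?J\<^sup>T\<close> is the diagonal projector onto the first
      \<open>k\<close> coordinates, which leaves \<open>D1\<close> unchanged.\<close>
    have "D1 = D1 * (?J * ?J\<^sup>T)"
    proof (rule eq_matI)
      fix i j assume "i < dim_row (D1 * (?J * ?J\<^sup>T))" "j < dim_col (D1 * (?J * ?J\<^sup>T))"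
      then have ij: "i < l" "j < l" by (auto simp: D1_def embed_mat_def mat_diag_def)
      have "(?J * ?J\<^sup>T) $$ (i, j) = (\<Sum>m<k. ?J $$ (i, m) * ?J\<^sup>T $$ (m, j))"
        using index_mult_sum[of ?J l k "?J\<^sup>T" l] ij by simp
      also have "\<dots> = (\<Sum>m<k. if m = i then (if i = j then 1 else 0) else 0)"
        using ij by (intro sum.cong) (auto simp: embed_mat_def)
      also have "\<dots> = (if i < k \<and> i = j then 1 else 0)" by simp
      finally have JJ: "(?J * ?J\<^sup>T) $$ (i, j) = (if i < k \<and> i = j then 1 else 0)" .
      have "D1 * (?J * ?J\<^sup>T) = Matrix.mat l l (\<lambda>(i, j). (if i < k then s $ i else 0) * (?J * ?J\<^sup>T) $$ (i, j))"
        unfolding D1_def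
        by (rule mat_diag_mult_left[OF mult_carrier_mat[OF embed_mat_carrier]]) simp
      then show "D1 $$ (i, j) = (D1 * (?J * ?J\<^sup>T)) $$ (i, j)"
        using ij JJ by (simp add: D1_def mat_diag_def)
    qed (auto simp: D1_def embed_mat_def mat_diag_def)
    also have "\<dots> = D1 * ?J * ?J\<^sup>T" using Dc by (simp add: assoc_mult_mat[of D1 l l ?J k _ l])
    also have "D1 * ?J = ?J * D"
      unfolding D1_def D_def embed_mat_diag[OF kl] by (intro arg_cong[where f = "(*) ?J"] mat_diag_cong) auto
    finally show ?thesis by simp
  qed
  have D2J: "D2 * ?J = 0\<^sub>m l k"
    unfolding D2_def mat_diag_mult_left[OF embed_mat_carrier] by (intro eq_matI) (auto simp: embed_mat_def)
  define E where "E = U * D2 * V\<^sup>T"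
  have E: "E \<in> carrier_mat n d" using S Dc by (auto simp: E_def)
  have "A = U * (D1 + D2) * V\<^sup>T" using S(8) sum by simp
  also have "\<dots> = U * D1 * V\<^sup>T + E"
    using S(1,3) Dc by (simp add: E_def mult_add_distrib_mat[of U n l D1 l] add_mult_distrib_mat[of _ n l _ _ d])
  also have "U * D1 * V\<^sup>T = Uk * D * Vk\<^sup>T"
  proof -
    have "U * (?J * X * ?J\<^sup>T) * V\<^sup>T = U * ?J * X * (V * ?J)\<^sup>T" if X: "X \<in> carrier_mat k k" for X
    proof -
      have "U * (?J * X * ?J\<^sup>T) = U * (?J * X) * ?J\<^sup>T"
        using assoc_mult_mat[of U n l "?J * X" k "?J\<^sup>T" l] S(1) X by simp
      also have "U * (?J * X) = U * ?J * X"
        using assoc_mult_mat[of U n l ?J k X k] S(1) X by simp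
      finally have "U * (?J * X * ?J\<^sup>T) * V\<^sup>T = U * ?J * X * (?J\<^sup>T * V\<^sup>T)"
        using assoc_mult_mat[of "U * ?J * X" n k "?J\<^sup>T" l "V\<^sup>T" d] S(1,3) X by simp
      then show ?thesis using transpose_mult[OF S(3) embed_mat_carrier, of k] by simp
    qed
    from this[of D] show ?thesis unfolding JDJ Uk Vk by (simp add: D_def)
  qed
  finally have A': "A = Uk * D * Vk\<^sup>T + E" .
  have EV: "E * Vk = 0\<^sub>m n k"
  proof -
    have "E * Vk = U * (D2 * (V\<^sup>T * V * ?J))"
      unfolding E_def Vk using S(1,3) Dc by (simp add: assoc_mult_mat[of _ n l _ d _ k]
          assoc_mult_mat[of U n l D2 l _ k] assoc_mult_mat[of "V\<^sup>T" l d V l _ k])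
    also have "\<dots> = U * 0\<^sub>m l k" using S(5) D2J by simp
    finally show ?thesis using S(1) by simp
  qed
  have UE: "Uk\<^sup>T * E = 0\<^sub>m k d"
  proof -
    have "Uk\<^sup>T * E = ?J\<^sup>T * (U\<^sup>T * (U * (D2 * V\<^sup>T)))"
      unfolding E_def Uk using S(1,3) Dc by (simp add: transpose_mult[of U n l ?J k]
          assoc_mult_mat[of U n l D2 l _ d] assoc_mult_mat[of "?J\<^sup>T" k l "U\<^sup>T" n _ d])
    also have "U\<^sup>T * (U * (D2 * V\<^sup>T)) = D2 * V\<^sup>T"
      using S(1,3,4) Dc assoc_mult_mat[of "U\<^sup>T" l n U l "D2 * V\<^sup>T" d] by simp
    also have "?J\<^sup>T * (D2 * V\<^sup>T) = ?J\<^sup>T * D2 * V\<^sup>T"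
      using S(3) Dc by (simp add: assoc_mult_mat[of "?J\<^sup>T" k l D2 l _ d])
    also have "?J\<^sup>T * D2 = (D2 * ?J)\<^sup>T"
      using Dc transpose_mult[of D2 l l ?J k] by (simp add: D2_def)
    finally show ?thesis using S(3) by (simp add: D2J)
  qed
  have "fip E E = fip D2 D2"
    unfolding E_def using fip_sandwich[OF S(1,4,3,5) Dc(2)] .
  also have "\<dots> = (\<Sum>i<l. (if i < k then 0 else s $ i)\<^sup>2)" by (simp add: D2_def fip_mat_diag)
  also have "\<dots> = (\<Sum>i=k..<l. (s $ i)\<^sup>2)"
    by (rule sum.mono_neutral_cong_right) auto
  finally show thesis
    using that[OF E A' Ukc _ Vkc _ EV UE] first_cols_orthonormal[OF S(1,4) kl]
      first_cols_orthonormal[OF S(3,5) kl] unfolding Uk_def[symmetric] Vk_def[symmetric] l_def by blast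
qed

text \<open>Pythagoras separates a part of the error that does not depend on \<open>Z\<close>.
  Minimising over \<open>Z\<close> in the range of \<open>Q\<close> thus amounts to approximating
  the smaller matrix \<open>Q\<^sup>T * A\<close>.\<close>

lemma fip_dist_range:
  assumes Q: "Q \<in> carrier_mat n q" "Q\<^sup>T * Q = 1\<^sub>m q" and A: "A \<in> carrier_mat n d"
    and Z: "Z \<in> carrier_mat n d" "Q * (Q\<^sup>T * Z) = Z"
  shows "fip (A - Z) (A - Z)
    = fip (A - Q * (Q\<^sup>T * A)) (A - Q * (Q\<^sup>T * A)) + fip (Q\<^sup>T * A - Q\<^sup>T * Z) (Q\<^sup>T * A - Q\<^sup>T * Z)"
proof -
  have 1: "Q\<^sup>T * (A - Z) = Q\<^sup>T * A - Q\<^sup>T * Z"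
    using Q A Z by (intro mult_minus_distrib_mat) auto
  have 2: "Q * (Q\<^sup>T * A - Q\<^sup>T * Z) = Q * (Q\<^sup>T * A) - Z"
    using mult_minus_distrib_mat[of Q n q "Q\<^sup>T * A" d "Q\<^sup>T * Z"] Q A Z by simp
  have 3: "A - Z - (P - Z) = A - P" if "P \<in> carrier_mat n d" for P
    using that A Z by (intro eq_matI) auto
  have P: "Q * (Q\<^sup>T * A) \<in> carrier_mat n d" using Q A by simp
  show ?thesis
    using fip_projection[OF Q minus_carrier_mat[OF Z(1)], of A] unfolding 1 2 3[OF P] .
qed

section \<open>The Eckart-Young lower bound\<close>

text \<open>A total mass \<open>k\<close> with at most one unit per position does best on the
  \<open>k\<close> largest weights. The threshold \<open>w k\<close> is controlled only for
  \<open>k < l\<close>, whence the separate case.\<close>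

lemma weighted_sum_le:
  fixes w c :: "nat \<Rightarrow> real"
  assumes w: "\<And>i j. i \<le> j \<Longrightarrow> j < l \<Longrightarrow> w j \<le> w i" "\<And>i. i < l \<Longrightarrow> 0 \<le> w i"
    and c: "\<And>i. i < l \<Longrightarrow> 0 \<le> c i" "\<And>i. i < l \<Longrightarrow> c i \<le> 1"
    and ck: "(\<Sum>i<l. c i) \<le> real k" and k: "k \<le> l"
  shows "(\<Sum>i<l. w i * c i) \<le> (\<Sum>i<k. w i)"
proof (cases "k = l")
  case True
  then show ?thesis using w c by (auto intro!: sum_mono mult_left_le)
next
  case False
  then have kl: "k < l" using k by simp
  let ?t = "w k"
  \<comment> \<open>Below \<open>k\<close> the excess of \<open>w i\<close> over the threshold is
    multiplied by \<open>c i \<le> 1\<close>; from \<open>k\<close> on, \<open>w i\<close> does not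
    exceed the threshold.\<close>
  have "w i * c i \<le> (if i < k then w i - ?t else 0) + ?t * c i" if "i < l" for i
  proof (cases "i < k")
    case True
    have "0 \<le> (w i - ?t) * (1 - c i)" using True kl w(1)[of i k] c that by (intro mult_nonneg_nonneg) auto
    then show ?thesis using True by (simp add: algebra_simps)
  next
    case False
    then show ?thesis using w(1)[of k i] c that by (auto intro: mult_right_mono)
  qed
  then have "(\<Sum>i<l. w i * c i) \<le> (\<Sum>i<l. (if i < k then w i - ?t else 0) + ?t * c i)"
    by (intro sum_mono) auto
  also have "\<dots> = (\<Sum>i<l. if i < k then w i - ?t else 0) + ?t * (\<Sum>i<l. c i)"
    by (simp add: sum.distrib sum_distrib_left)
  also have "(\<Sum>i<l. if i < k then w i - ?t else 0) = (\<Sum>i<k. w i - ?t)"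
    by (rule sum.mono_neutral_cong_right) (use kl in auto)
  also have "\<dots> = (\<Sum>i<k. w i) - ?t * real k" by (simp add: sum_subtractf mult.commute)
  finally show ?thesis using mult_left_mono[OF ck, of ?t] w(2)[OF kl] by linarith
qed

text \<open>The distance from \<open>A\<close> to \<open>Z\<close> is at least that to the range of
  \<open>Z\<close>. For a basis \<open>Q\<close> of this range, \<open>c i\<close> is the squared
  length of the projected \<open>i\<close>-th left singular vector; these numbers are at most 1 and
  sum to at most the rank, so the captured mass is at most that of the \<open>k\<close> leading
  singular values.\<close>

lemma eckart_young:
  assumes svd: "is_svd A U s V" and A: "A \<in> carrier_mat n d" and k: "k \<le> min n d"
    and Z: "Z \<in> carrier_mat n d" "mat_rank Z \<le> k"
  shows "(\<Sum>i=k..<min n d. (s $ i)\<^sup>2) \<le> fip (A - Z) (A - Z)"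
proof -
  define l where "l = min n d"
  note S = is_svdD[OF svd A, folded l_def]
  obtain q Q where Q: "Q \<in> carrier_mat n q" "Q\<^sup>T * Q = 1\<^sub>m q" "q = mat_rank Z" "Q * (Q\<^sup>T * Z) = Z"
    using orthonormal_range_basis[OF Z(1)] by metis
  define N where "N = Q\<^sup>T * U"
  have N: "N \<in> carrier_mat q l" using Q(1) S(1) by (simp add: N_def)
  define c where "c i = (\<Sum>j<q. (N $$ (j, i))\<^sup>2)" for i
  have QtA: "Q\<^sup>T * A = N * mat_diag l (\<lambda>i. s $ i) * V\<^sup>T"
  proof -
    let ?D = "mat_diag l (\<lambda>i. s $ i)"
    have UD: "U * ?D \<in> carrier_mat n l" using S(1) by simp
    have "Q\<^sup>T * (U * ?D * V\<^sup>T) = Q\<^sup>T * (U * ?D) * V\<^sup>T"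
      using assoc_mult_mat[of "Q\<^sup>T" q n "U * ?D" l "V\<^sup>T" d] Q(1) UD S(3) by simp
    also have "Q\<^sup>T * (U * ?D) = N * ?D"
      using assoc_mult_mat[of "Q\<^sup>T" q n U l ?D l] Q(1) S(1) by (simp add: N_def)
    finally show ?thesis using S(8) by simp
  qed
  have "fip (Q\<^sup>T * A) (Q\<^sup>T * A) = fip (N * mat_diag l (\<lambda>i. s $ i)) (N * mat_diag l (\<lambda>i. s $ i))"
    unfolding QtA using fip_isometry_right[OF S(3,5)] mult_carrier_mat[OF N mat_diag_dim] by blast
  also have "\<dots> = (\<Sum>i<l. (s $ i)\<^sup>2 * c i)" unfolding c_def by (rule fip_mult_mat_diag[OF N])
  also have "\<dots> \<le> (\<Sum>i<k. (s $ i)\<^sup>2)"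
  proof (rule weighted_sum_le)
    show "(s $ j)\<^sup>2 \<le> (s $ i)\<^sup>2" if "i \<le> j" "j < l" for i j
      using S(6,7) that by (intro power_mono) auto
    show "0 \<le> c i" for i by (simp add: c_def sum_nonneg)
    show "c i \<le> 1" if i: "i < l" for i
    proof -
      \<comment> \<open>A diagonal unit isolates column \<open>i\<close>, so the bound for one
        column is an instance of the projection inequality.\<close>
      let ?e = "mat_diag l (\<lambda>j. if j = i then 1 else 0 :: real)"
      have "fip (Q\<^sup>T * (U * ?e)) (Q\<^sup>T * (U * ?e)) \<le> fip (U * ?e) (U * ?e)"
        using Q S by (intro fip_projection_le[of _ n q _ l]) auto
      also have "\<dots> = fip ?e ?e" by (rule fip_isometry[OF S(1,4) mat_diag_dim mat_diag_dim])
      also have "\<dots> = (\<Sum>j<l. if j = i then 1 else 0)" unfolding fip_mat_diag by (intro sum.cong) auto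
      also have "\<dots> = 1" using i by simp
      also have "Q\<^sup>T * (U * ?e) = N * ?e" unfolding N_def using Q(1) S(1) by (simp add: assoc_mult_mat[of _ q n _ l _ l])
      also have "fip (N * ?e) (N * ?e) = (\<Sum>j<l. if j = i then c i else 0)"
        unfolding fip_mult_mat_diag[OF N] c_def by (intro sum.cong) auto
      also have "\<dots> = c i" using i by simp
      finally show ?thesis .
    qed
    have "(\<Sum>i<l. c i) = (\<Sum>j<q. \<Sum>i<l. (N $$ (j, i))\<^sup>2)" unfolding c_def by (rule sum.swap)
    also have "\<dots> = fip N N" using fip_carrier[OF N, of N] by (simp add: power2_eq_square)
    also have "\<dots> = fip N\<^sup>T N\<^sup>T" using fip_transpose[OF N N] by simp
    also have "\<dots> = fip (U\<^sup>T * Q) (U\<^sup>T * Q)" using Q(1) S(1) by (simp add: N_def transpose_mult[of _ q n _ l])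
    also have "\<dots> \<le> fip Q Q" by (rule fip_projection_le[OF S(1,4) Q(1)])
    also have "\<dots> = real q" by (rule fip_orthonormal[OF Q(1,2)])
    finally show "(\<Sum>i<l. c i) \<le> real k" using Z(2) Q(3) by simp
  qed (use k in \<open>auto simp: l_def\<close>)
  finally have le: "fip (Q\<^sup>T * A) (Q\<^sup>T * A) \<le> (\<Sum>i<k. (s $ i)\<^sup>2)" .
  have "fip A A = (\<Sum>i<l. (s $ i)\<^sup>2)"
    using fip_sandwich[OF S(1,4,3,5) mat_diag_dim] fip_mat_diag[of l "\<lambda>i. s $ i"] S(8) by simp
  also have "\<dots> = (\<Sum>i<k. (s $ i)\<^sup>2) + (\<Sum>i=k..<l. (s $ i)\<^sup>2)"
    using sum.atLeastLessThan_concat[of 0 k l "\<lambda>i. (s $ i)\<^sup>2"] k by (simp add: l_def atLeast0LessThan)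
  finally have "(\<Sum>i=k..<l. (s $ i)\<^sup>2) \<le> fip A A - fip (Q\<^sup>T * A) (Q\<^sup>T * A)" using le by simp
  also have "\<dots> = fip (A - Q * (Q\<^sup>T * A)) (A - Q * (Q\<^sup>T * A))"
    using fip_projection[OF Q(1,2) A] by simp
  also have "\<dots> \<le> fip (A - Z) (A - Z)"
    using fip_dist_range[OF Q(1,2) A Z(1) Q(4)] fip_nonneg by simp
  finally show ?thesis by (simp add: l_def)
qed

section \<open>Leverage scores of a projected matrix\<close>

lemma mat_diag_inverse:
  fixes f :: "nat \<Rightarrow> real"
  assumes "\<And>i. i < k \<Longrightarrow> f i \<noteq> 0"
  shows "mat_diag k f * mat_diag k (\<lambda>i. 1 / f i) = 1\<^sub>m k"
proof -
  have "mat_diag k f * mat_diag k (\<lambda>i. 1 / f i) = mat_diag k (\<lambda>i. 1)"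
    unfolding mat_diag_diag using assms by (intro mat_diag_cong) simp
  then show ?thesis by simp
qed

text \<open>The identity of size \<open>k\<close> factors through the \<open>q\<close> columns of a
  basis of the range of \<open>C\<close>, so \<open>q\<close> cannot be smaller than
  \<open>k\<close>.\<close>

lemma rank_ge_of_one_factor:
  assumes P: "P \<in> carrier_mat k n" and C: "C \<in> carrier_mat n d" and N: "N \<in> carrier_mat d k"
    and one: "P * (C * N) = 1\<^sub>m k"
  shows "k \<le> mat_rank C"
proof -
  obtain q Q where Q: "Q \<in> carrier_mat n q" "Q\<^sup>T * Q = 1\<^sub>m q" "q = mat_rank C" "Q * (Q\<^sup>T * C) = C"
    using orthonormal_range_basis[OF C] by metis
  have "C * N = Q * (Q\<^sup>T * C * N)"
    using assoc_mult_mat[of Q n q "Q\<^sup>T * C" d N k] Q C N by simp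
  then have "(1\<^sub>m k :: real mat) = P * Q * (Q\<^sup>T * C * N)"
    using assoc_mult_mat[of P k n Q q "Q\<^sup>T * C * N" k] P Q(1) C N one by simp
  then have "mat_rank (1\<^sub>m k :: real mat) \<le> q"
    using rank_mult_le[of "P * Q" k q "Q\<^sup>T * C * N" k] P Q(1) C N by simp
  then show ?thesis using rank_orthonormal[of "1\<^sub>m k" k k] Q(3) by simp
qed

lemma rank_mult_left_le:
  fixes M X :: "real mat"
  assumes M: "M \<in> carrier_mat m n" and X: "X \<in> carrier_mat n d"
  shows "mat_rank (M * X) \<le> mat_rank X"
proof -
  obtain q Q where Q: "Q \<in> carrier_mat n q" "q = mat_rank X" "Q * (Q\<^sup>T * X) = X"
    using orthonormal_range_basis[OF X] by metis
  have "M * X = M * Q * (Q\<^sup>T * X)"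
    using assoc_mult_mat[of M m n Q q "Q\<^sup>T * X" d] M Q X by simp
  then show ?thesis using rank_mult_le[of "M * Q" m q "Q\<^sup>T * X" d] M Q(1,2) X by simp
qed

lemma svd_rank_le:
  assumes svd: "is_svd A U s V" and A: "A \<in> carrier_mat n d" and m: "m \<le> min n d"
    and z: "\<And>i. m \<le> i \<Longrightarrow> i < min n d \<Longrightarrow> s $ i = 0"
  shows "mat_rank A \<le> m"
proof -
  obtain E where E: "E \<in> carrier_mat n d"
      "A = first_cols m U * mat_diag m (\<lambda>i. s $ i) * (first_cols m V)\<^sup>T + E"
      "first_cols m U \<in> carrier_mat n m" "first_cols m V \<in> carrier_mat d m"
      "fip E E = (\<Sum>i=m..<min n d. (s $ i)\<^sup>2)"
    using svd_split[OF svd A m] by metis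
  have "fip E E = 0" using E(5) z by simp
  then have "E = 0\<^sub>m n d" using fip_self_eq_0 E(1) by blast
  then have "A = first_cols m U * (mat_diag m (\<lambda>i. s $ i) * (first_cols m V)\<^sup>T)"
    using E(2,3,4) by (simp add: assoc_mult_mat[of _ n m _ m _ d])
  then show ?thesis
    using rank_mult_le[OF E(3), of "mat_diag m (\<lambda>i. s $ i) * (first_cols m V)\<^sup>T" d] E(4) by simp
qed

text \<open>A vanishing singular value makes all later ones vanish by monotonicity, and its index
  then bounds the rank. Positivity permits division by the leading singular values.\<close>

lemma svd_rank_ge:
  assumes svd: "is_svd A U s V" and A: "A \<in> carrier_mat n d" and k: "k \<le> mat_rank A"
  shows "k \<le> min n d" "\<And>i. i < k \<Longrightarrow> 0 < s $ i"
proof -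
  note S = is_svdD[OF svd A]
  show k': "k \<le> min n d" using svd_rank_le[OF svd A, of "min n d"] k by simp
  fix i assume i: "i < k"
  show "0 < s $ i"
  proof (rule ccontr)
    assume "\<not> 0 < s $ i"
    then have "s $ j = 0" if "i \<le> j" "j < min n d" for j
      using S(6)[of j] S(7)[of i j] that by auto
    then have "mat_rank A \<le> i" using svd_rank_le[OF svd A, of i] i k' by simp
    then show False using i k by simp
  qed
qed

text \<open>\<open>near_optimal\<close> asks for some best approximation, so the truncation is
  exhibited as one; it attains the bound of \<open>eckart_young\<close>.\<close>

lemma svd_best_rank_approx:
  assumes svd: "is_svd A U s V" and A: "A \<in> carrier_mat n d" and k: "k \<le> min n d"
  obtains Y where "best_rank_approx k A Y" "fip (A - Y) (A - Y) = (\<Sum>i=k..<min n d. (s $ i)\<^sup>2)"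
proof -
  let ?D = "mat_diag k (\<lambda>i. s $ i)"
  define Uk Vk where "Uk = first_cols k U" and "Vk = first_cols k V"
  obtain E where E: "E \<in> carrier_mat n d" "A = Uk * ?D * Vk\<^sup>T + E"
      "Uk \<in> carrier_mat n k" "Vk \<in> carrier_mat d k"
      "fip E E = (\<Sum>i=k..<min n d. (s $ i)\<^sup>2)"
    using svd_split[OF svd A k] unfolding Uk_def Vk_def by metis
  define Y where "Y = Uk * ?D * Vk\<^sup>T"
  have Y: "Y \<in> carrier_mat n d" using E(3,4) by (simp add: Y_def)
  have AY: "A - Y = E" unfolding E(2) Y_def[symmetric] using Y E(1) by (intro eq_matI) auto
  have "Y = Uk * (?D * Vk\<^sup>T)" using E(3,4) by (simp add: Y_def assoc_mult_mat[of _ n k _ k _ d])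
  then have "mat_rank Y \<le> k" using rank_mult_le[OF E(3), of "?D * Vk\<^sup>T" d] E(4) by simp
  moreover have "frob_norm (A - Y) \<le> frob_norm (A - Z)"
    if "Z \<in> carrier_mat n d" "mat_rank Z \<le> k" for Z
  proof (rule power2_le_imp_le)
    show "(frob_norm (A - Y))\<^sup>2 \<le> (frob_norm (A - Z))\<^sup>2"
      unfolding frob_norm_sq AY E(5) by (rule eckart_young[OF svd A k that])
  qed (auto simp: frob_norm_def intro!: sum_nonneg)
  ultimately have "best_rank_approx k A Y" using A Y by (auto simp: best_rank_approx_def)
  then show thesis using that AY E(5) by simp
qed

text \<open>A squared row norm is a diagonal entry of \<open>W * W\<^sup>T\<close>, which absorbs an
  orthogonal factor; as \<open>Z\<close> is square, its transpose is also a right inverse.\<close>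

lemma mult_orthogonal_row_norm:
  fixes W Z :: "real mat"
  assumes W: "W \<in> carrier_mat n k" and Z: "Z \<in> carrier_mat k k" "Z\<^sup>T * Z = 1\<^sub>m k" and i: "i < n"
  shows "(\<Sum>j<k. ((W * Z) $$ (i, j))\<^sup>2) = (\<Sum>j<k. (W $$ (i, j))\<^sup>2)"
proof -
  have row: "(\<Sum>j<k. (X $$ (i, j))\<^sup>2) = (X * X\<^sup>T) $$ (i, i)" if X: "X \<in> carrier_mat n k" for X :: "real mat"
    using index_mult_sum[of X n k "X\<^sup>T" n i i] X i by (simp add: power2_eq_square)
  have "Z * Z\<^sup>T = 1\<^sub>m k" using mat_mult_left_right_inverse[of "Z\<^sup>T" k Z] Z by simp
  then have "Z * (Z\<^sup>T * W\<^sup>T) = W\<^sup>T"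
    using assoc_mult_mat[of Z k k "Z\<^sup>T" k "W\<^sup>T" n] W Z by simp
  then have "W * Z * (W * Z)\<^sup>T = W * W\<^sup>T"
    using assoc_mult_mat[of W n k Z k "Z\<^sup>T * W\<^sup>T" n] transpose_mult[of W n k Z k] W Z by simp
  then show ?thesis using row[of W] row[of "W * Z"] W Z by simp
qed

text \<open>
  \<open>X\<close> and \<open>W\<close> have the same range, so the leading singular vectors of \<open>X\<close> and the columns of \<open>W\<close>
  are orthonormal bases of one space and differ by an orthogonal factor.
\<close>
lemma singular_vectors_row_norms:
  assumes svd: "is_svd X U s V" and X: "X \<in> carrier_mat n d" and rank: "mat_rank X = k"
    and W: "W \<in> carrier_mat n k" "W\<^sup>T * W = 1\<^sub>m k" and T: "T \<in> carrier_mat k d" "X = W * T"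
    and i: "i < n"
  shows "(\<Sum>j<k. (first_cols k U $$ (i, j))\<^sup>2) = (\<Sum>j<k. (W $$ (i, j))\<^sup>2)"
proof -
  have k: "k \<le> min n d" and pos: "\<And>i. i < k \<Longrightarrow> 0 < s $ i"
    using svd_rank_ge[OF svd X] rank by auto
  let ?D = "mat_diag k (\<lambda>i. s $ i)" and ?D' = "mat_diag k (\<lambda>i. 1 / s $ i)"
  define Uk Vk where "Uk = first_cols k U" and "Vk = first_cols k V"
  obtain E where E: "E \<in> carrier_mat n d" "X = Uk * ?D * Vk\<^sup>T + E"
      "Uk \<in> carrier_mat n k" "Uk\<^sup>T * Uk = 1\<^sub>m k" "Vk \<in> carrier_mat d k" "Vk\<^sup>T * Vk = 1\<^sub>m k"
      "E * Vk = 0\<^sub>m n k"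
    using svd_split[OF svd X k] unfolding Uk_def Vk_def by metis
  have DD: "?D * ?D' = 1\<^sub>m k" using pos by (intro mat_diag_inverse) (metis less_irrefl)
  have "X * Vk = Uk * ?D * Vk\<^sup>T * Vk + E * Vk"
    unfolding E(2) using E by (intro add_mult_distrib_mat) auto
  also have "Uk * ?D * Vk\<^sup>T * Vk = Uk * ?D * (Vk\<^sup>T * Vk)"
    using E by (intro assoc_mult_mat) auto
  finally have XV: "X * Vk = Uk * ?D" using E by simp
  \<comment> \<open>Dividing by the positive singular values expresses \<open>Uk\<close> through
    \<open>X\<close>, which places its columns in the range of \<open>W\<close>.\<close>
  have "Uk = Uk * (?D * ?D')" unfolding DD using E(3) by simp
  also have "\<dots> = X * Vk * ?D'" unfolding XV using E(3) by (intro assoc_mult_mat[symmetric]) auto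
  also have "\<dots> = W * (T * Vk * ?D')"
    unfolding T(2) using W(1) T(1) E(5)
    by (simp add: assoc_mult_mat[of W n k T d Vk k] assoc_mult_mat[of W n k "T * Vk" k ?D' k])
  finally have "W * (W\<^sup>T * Uk) = Uk"
    using orthonormal_fix_range[OF W, of "T * Vk * ?D'" k Uk] T(1) E(5) by simp
  then have UkZ: "Uk = W * (W\<^sup>T * Uk)" ..
  define Z where "Z = W\<^sup>T * Uk"
  have Z: "Z \<in> carrier_mat k k" using W(1) E(3) by (simp add: Z_def)
  have "Z\<^sup>T * Z = Uk\<^sup>T * (W * (W\<^sup>T * Uk))"
    unfolding Z_def using W(1) E(3)
    by (simp add: transpose_mult[of "W\<^sup>T" k n Uk k] assoc_mult_mat[of "Uk\<^sup>T" k n W k "W\<^sup>T * Uk" k])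
  then have "Z\<^sup>T * Z = 1\<^sub>m k" using UkZ E(4) by simp
  from mult_orthogonal_row_norm[OF W(1) Z this i] show ?thesis
    using UkZ unfolding Z_def Uk_def by simp
qed

text \<open>The approximation witnessing the claim is \<open>X = Q * Ck\<close>, with
  \<open>Ck\<close> the truncation of \<open>Q\<^sup>T * A\<close>; \<open>Z\<close> is a competitor
  that bounds its error. The returned scores are row norms of \<open>W = Q * Uk\<close>, an
  orthonormal basis of the range of \<open>X\<close>, so they match those of any decomposition of
  \<open>X\<close>.\<close>

lemma projected_svd_leverage:
  assumes svd_ex: "\<And>m n B. B \<in> carrier_mat m n \<Longrightarrow> \<exists>U s V. is_svd B U s V"
    and A: "A \<in> carrier_mat n d" and k1: "1 \<le> k" and svdA: "is_svd A UA sA VA" and kA: "k \<le> min n d"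
    and \<epsilon>: "0 < \<epsilon>"
    and Q: "Q \<in> carrier_mat n q" "Q\<^sup>T * Q = 1\<^sub>m q" and svdC: "is_svd (Q\<^sup>T * A) U s V"
    and rkC: "k \<le> mat_rank (Q\<^sup>T * A)"
    and Z: "Z \<in> carrier_mat n d" "Q * (Q\<^sup>T * Z) = Z" "mat_rank Z \<le> k"
    and close: "fip (A - Z) (A - Z) \<le> (1 + \<epsilon>)\<^sup>2 * (\<Sum>i=k..<min n d. (sA $ i)\<^sup>2)"
    and p: "p = Matrix.vec n (\<lambda>i. (\<Sum>j<k. ((Q * first_cols k U) $$ (i, j))\<^sup>2) / real k)"
  shows "leverage_approx 1 \<epsilon> k A p"
proof -
  define C where "C = Q\<^sup>T * A"
  have C: "C \<in> carrier_mat q d" using Q A by (simp add: C_def)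
  note svdC = svdC[folded C_def]
  have k: "k \<le> min q d" and pos: "\<And>i. i < k \<Longrightarrow> 0 < s $ i"
    using svd_rank_ge[OF svdC C] rkC by (auto simp: C_def)
  let ?D = "mat_diag k (\<lambda>i. s $ i)" and ?D' = "mat_diag k (\<lambda>i. 1 / s $ i)"
  define Uk Vk where "Uk = first_cols k U" and "Vk = first_cols k V"
  obtain E where E: "E \<in> carrier_mat q d" "C = Uk * ?D * Vk\<^sup>T + E"
      "Uk \<in> carrier_mat q k" "Uk\<^sup>T * Uk = 1\<^sub>m k" "Vk \<in> carrier_mat d k" "Vk\<^sup>T * Vk = 1\<^sub>m k"
      "fip E E = (\<Sum>i=k..<min q d. (s $ i)\<^sup>2)"
    using svd_split[OF svdC C k] unfolding Uk_def Vk_def by metis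
  define Ck where "Ck = Uk * ?D * Vk\<^sup>T"
  have Ck: "Ck \<in> carrier_mat q d" using E by (simp add: Ck_def)
  define W where "W = Q * Uk"
  have W: "W \<in> carrier_mat n k" using Q E by (simp add: W_def)
  have QtW: "Q\<^sup>T * W = Uk"
    using assoc_mult_mat[of "Q\<^sup>T" q n Q q Uk k] Q E(3) by (simp add: W_def)
  have WW: "W\<^sup>T * W = 1\<^sub>m k"
  proof -
    have "W\<^sup>T * W = Uk\<^sup>T * (Q\<^sup>T * W)"
      using assoc_mult_mat[of "Uk\<^sup>T" k q "Q\<^sup>T" n W k] Q E(3) W
      by (simp add: W_def transpose_mult[of Q n q Uk k])
    then show ?thesis using QtW E(4) by simp
  qed
  define X where "X = Q * Ck"
  have X: "X \<in> carrier_mat n d" using Q Ck by (simp add: X_def)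
  define T where "T = ?D * Vk\<^sup>T"
  have T: "T \<in> carrier_mat k d" using E by (simp add: T_def)
  have XWT: "X = W * T"
  proof -
    have "Ck = Uk * T" unfolding Ck_def T_def using E(3,5) by (intro assoc_mult_mat) auto
    then show ?thesis unfolding X_def W_def using Q(1) E(3) T by (simp add: assoc_mult_mat[of Q n q Uk k T d])
  qed
  have DD: "?D * ?D' = 1\<^sub>m k" using pos by (intro mat_diag_inverse) (metis less_irrefl)
  \<comment> \<open>A right inverse of \<open>T\<close> recovers \<open>W\<close> from
    \<open>X\<close>; it is needed because the rank of \<open>X\<close> must equal \<open>k\<close>
    and not merely be bounded by it.\<close>
  have "T * (Vk * ?D') = 1\<^sub>m k"
  proof -
    have "T * (Vk * ?D') = ?D * (Vk\<^sup>T * (Vk * ?D'))"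
      unfolding T_def using E(5) by (intro assoc_mult_mat[of _ k k _ d]) auto
    also have "Vk\<^sup>T * (Vk * ?D') = Vk\<^sup>T * Vk * ?D'"
      using E(5) by (intro assoc_mult_mat[symmetric]) auto
    also have "\<dots> = ?D'" using E(6) left_mult_one_mat[OF mat_diag_dim] by simp
    finally show ?thesis using DD by simp
  qed
  then have "X * (Vk * ?D') = W"
    using assoc_mult_mat[of W n k T d "Vk * ?D'" k] W T E(5) by (simp add: XWT)
  then have "k \<le> mat_rank X"
    using rank_ge_orthonormal[OF X W WW, of "Vk * ?D'"] E(5) by simp
  moreover have "mat_rank X \<le> k" using rank_mult_le[OF W T] by (simp add: XWT)
  ultimately have rankX: "mat_rank X = k" by simp
  have QtX: "Q\<^sup>T * X = Ck"
    using assoc_mult_mat[of "Q\<^sup>T" q n Q q Ck d] Q Ck by (simp add: X_def)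
  have CE: "C - Ck = E" unfolding E(2) Ck_def[symmetric] using Ck E(1) by (intro eq_matI) auto
  \<comment> \<open>Multiplying by \<open>Q\<^sup>T\<close> does not raise the rank, so
    \<open>Q\<^sup>T * Z\<close> competes against \<open>Ck\<close>.\<close>
  have "fip (C - Ck) (C - Ck) \<le> fip (C - Q\<^sup>T * Z) (C - Q\<^sup>T * Z)"
    unfolding CE E(7)
    using rank_mult_left_le[of "Q\<^sup>T" q n Z d] Q Z
    by (intro eckart_young[OF svdC C k]) auto
  then have "fip (A - X) (A - X) \<le> fip (A - Z) (A - Z)"
    using fip_dist_range[OF Q A X] fip_dist_range[OF Q A Z(1,2)] QtX
    by (simp add: X_def C_def)
  then have XZ: "fip (A - X) (A - X) \<le> (1 + \<epsilon>)\<^sup>2 * (\<Sum>i=k..<min n d. (sA $ i)\<^sup>2)"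
    using close by simp
  obtain Y where Y: "best_rank_approx k A Y" "fip (A - Y) (A - Y) = (\<Sum>i=k..<min n d. (sA $ i)\<^sup>2)"
    using svd_best_rank_approx[OF svdA A kA] by metis
  have "frob_norm (A - X) \<le> (1 + \<epsilon>) * frob_norm (A - Y)"
  proof (rule power2_le_imp_le)
    show "(frob_norm (A - X))\<^sup>2 \<le> ((1 + \<epsilon>) * frob_norm (A - Y))\<^sup>2"
      unfolding power_mult_distrib frob_norm_sq Y(2) using XZ .
    show "0 \<le> (1 + \<epsilon>) * frob_norm (A - Y)"
      using \<epsilon> by (auto simp: frob_norm_def intro!: mult_nonneg_nonneg sum_nonneg)
  qed
  then have near: "X \<in> near_optimal \<epsilon> k A"
    using X A rankX Y(1) by (auto simp: near_optimal_def)
  obtain UX sX VX where svdX: "is_svd X UX sX VX" using svd_ex[OF X] by metis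
  have kX: "k \<le> min n d" using svd_rank_ge(1)[OF svdX X] rankX by simp
  have top: "top_left_singular_vectors k X (first_cols k UX)"
    unfolding top_left_singular_vectors_def 
    using svdX kX is_svdD(1)[OF svdX X] by (intro exI[of _ UX] conjI exI[of _ sX] exI[of _ VX]) auto
  have rows: "(\<Sum>j<k. (first_cols k UX $$ (i, j))\<^sup>2) = (\<Sum>j<k. (W $$ (i, j))\<^sup>2)" if "i < n" for i
    using singular_vectors_row_norms[OF svdX X rankX W WW T XWT that] .
  have pW: "p = Matrix.vec n (\<lambda>i. (\<Sum>j<k. (W $$ (i, j))\<^sup>2) / real k)"
    unfolding p W_def Uk_def ..
  have "(\<Sum>i<n. p $ i) = fip W W / real k"
    unfolding fip_carrier[OF W] by (simp add: pW sum_divide_distrib power2_eq_square)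
  then have "(\<Sum>i<n. p $ i) = 1" using fip_orthonormal[OF W WW] k1 by simp
  then show ?thesis
    unfolding leverage_approx_def using near top rows A
    by (intro conjI bexI[of _ X] exI[of _ "first_cols k UX"]) (auto simp: pW)
qed

section \<open>Integration by parts for Gaussian vectors\<close>

lemma integrable_std_normal_weight:
  "integrable std_normal_distribution (\<lambda>t. (1 + t\<^sup>2) ^ m)"
proof -
  have "(1 + t\<^sup>2) ^ m = (\<Sum>j\<le>m. real (m choose j) * t ^ (2 * j))" for t :: real
    by (simp add: binomial_ring[of "t\<^sup>2" 1 m, unfolded add.commute[of "t\<^sup>2"]] power_mult)
  then show ?thesis
    by (auto intro!: Bochner_Integration.integrable_sum integrable_std_normal_distribution_moment
        integrable_mult_right)
qed

text \<open>Stein's identity. The difference of the integrands, weighted by the density, is the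
  derivative of the density times \<open>f\<close>, which tends to 0 at both ends. The exponent 2
  suits the later use, where a derivative of the regularised pseudoinverse meets a linear form, each
  costing one power.\<close>

lemma stein_std_normal:
  fixes f f' :: "real \<Rightarrow> real"
  assumes deriv: "\<And>t. (f has_real_derivative f' t) (at t)" and cont: "\<And>t. isCont f' t"
    and bound: "\<And>t. \<bar>f t\<bar> \<le> C * (1 + t\<^sup>2)\<^sup>2" "\<And>t. \<bar>f' t\<bar> \<le> C * (1 + t\<^sup>2)\<^sup>2"
  shows "(\<integral>t. t * f t \<partial>std_normal_distribution) = (\<integral>t. f' t \<partial>std_normal_distribution)"
proof -
  let ?\<phi> = "std_normal_density"
  let ?N = "std_normal_distribution"
  have mf: "f \<in> borel_measurable borel"
    using deriv by (intro borel_measurable_continuous_onI continuous_at_imp_continuous_on)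
      (auto intro: DERIV_isCont)
  have mf': "f' \<in> borel_measurable borel"
    using cont by (intro borel_measurable_continuous_onI continuous_at_imp_continuous_on) auto
  have w1: "1 \<le> (1 + t\<^sup>2)" "\<bar>t\<bar> \<le> 1 + t\<^sup>2" for t :: real
  proof -
    show "1 \<le> (1 + t\<^sup>2)" by simp
    have "0 \<le> (\<bar>t\<bar> - 1)\<^sup>2" by simp
    then have "2 * \<bar>t\<bar> \<le> 1 + t\<^sup>2" by (simp add: power2_diff)
    then show "\<bar>t\<bar> \<le> 1 + t\<^sup>2" by simp
  qed
  have C0: "0 \<le> C" using bound(1)[of 0] by simp
  have i': "integrable ?N f'"
  proof (rule Bochner_Integration.integrable_bound)
    show "integrable ?N (\<lambda>t. C * (1 + t\<^sup>2)\<^sup>2)"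
      using integrable_std_normal_weight[of 2] by simp
    show "AE t in ?N. norm (f' t) \<le> norm (C * (1 + t\<^sup>2)\<^sup>2)"
      using bound(2) C0 by simp
  qed (use mf' in simp)
  have i: "integrable ?N (\<lambda>t. t * f t)"
  proof (rule Bochner_Integration.integrable_bound)
    show "integrable ?N (\<lambda>t. C * (1 + t\<^sup>2) ^ 3)"
      using integrable_std_normal_weight[of 3] by simp
    have "\<bar>t * f t\<bar> \<le> C * (1 + t\<^sup>2) ^ 3" for t
    proof -
      have "\<bar>t * f t\<bar> \<le> (1 + t\<^sup>2) * (C * (1 + t\<^sup>2)\<^sup>2)"
        unfolding abs_mult using w1[of t] bound(1)[of t] by (intro mult_mono) auto
      then show ?thesis by (simp add: power3_eq_cube power2_eq_square mult_ac)
    qed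
    then show "AE t in ?N. norm (t * f t) \<le> norm (C * (1 + t\<^sup>2) ^ 3)"
      using C0 by simp
  qed (use mf in simp)
  define F where "F t = ?\<phi> t * f t" for t
  define F' where "F' t = ?\<phi> t * f' t - ?\<phi> t * (t * f t)" for t
  have d\<phi>: "(?\<phi> has_real_derivative - t * ?\<phi> t) (at t)" for t
    unfolding std_normal_density_def by (auto intro!: derivative_eq_intros simp: field_simps)
  have dF: "(F has_real_derivative F' t) (at t)" for t
    unfolding F_def F'_def by (auto intro!: derivative_eq_intros d\<phi> deriv)
  have iF1: "integrable lborel (\<lambda>t. ?\<phi> t * f' t)"
    using i' mf' by (subst (asm) integrable_real_density) auto
  have iF2: "integrable lborel (\<lambda>t. ?\<phi> t * (t * f t))"
    using i mf by (subst (asm) integrable_real_density) auto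
  have iF: "integrable lborel F'"
    unfolding F'_def by (intro Bochner_Integration.integrable_diff iF1 iF2)
  have contF: "isCont F' t" for t
    unfolding F'_def using cont DERIV_isCont[OF deriv] DERIV_isCont[OF d\<phi>]
    by (intro continuous_intros) auto
  have lim: "(F \<longlongrightarrow> 0) L" if L: "((\<lambda>t. C * (?\<phi> t * (1 + t\<^sup>2)\<^sup>2)) \<longlongrightarrow> 0) L" for L
  proof (rule Lim_null_comparison[OF _ L], rule always_eventually, rule allI)
    fix t
    have "\<bar>F t\<bar> \<le> ?\<phi> t * (C * (1 + t\<^sup>2)\<^sup>2)"
      unfolding F_def abs_mult using bound(1)[of t] by (simp add: mult_left_mono)
    then show "norm (F t) \<le> C * (?\<phi> t * (1 + t\<^sup>2)\<^sup>2)" by (simp add: mult_ac)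
  qed
  have top: "(F \<longlongrightarrow> 0) at_top"
    by (rule lim) (unfold std_normal_density_def, rule tendsto_mult_right_zero, real_asymp)
  have bot: "(F \<longlongrightarrow> 0) at_bot"
    by (rule lim) (unfold std_normal_density_def, rule tendsto_mult_right_zero, real_asymp)
  have "(LBINT t=-\<infinity>..\<infinity>. F' t) = 0 - 0"
  proof (rule interval_integral_FTC_integrable)
    show "(F has_vector_derivative F' t) (at t)" for t
      using dF by (simp add: has_real_derivative_iff_has_vector_derivative)
    show "set_integrable lborel (einterval (-\<infinity>) \<infinity>) F'"
      using iF by (simp add: set_integrable_def)
    show "((F \<circ> real_of_ereal) \<longlongrightarrow> 0) (at_right (-\<infinity>))"
      using bot by (simp add: ereal_tendsto_simps)
    show "((F \<circ> real_of_ereal) \<longlongrightarrow> 0) (at_left \<infinity>)"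
      using top by (simp add: ereal_tendsto_simps)
  qed (use contF in auto)
  then have "(\<integral>t. F' t \<partial>lborel) = 0"
    by (simp add: interval_lebesgue_integral_def set_lebesgue_integral_def)
  then have "(\<integral>t. ?\<phi> t * f' t \<partial>lborel) = (\<integral>t. ?\<phi> t * (t * f t) \<partial>lborel)"
    unfolding F'_def using iF1 iF2 by simp
  then show ?thesis
    using mf mf' by (simp add: integral_real_density)
qed

section \<open>Product Gaussian measures and polynomial growth\<close>

definition gaussian :: "'i set \<Rightarrow> ('i \<Rightarrow> real) measure" where
  "gaussian I = Pi\<^sub>M I (\<lambda>_. std_normal_distribution)"

lemma prob_space_std_normal: "prob_space std_normal_distribution"
  using prob_space_normal_density[of 1 0] by simp

lemma prob_space_gaussian: "prob_space (gaussian I)"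
  unfolding gaussian_def by (rule prob_space_PiM) (rule prob_space_std_normal)

lemma coordinate_measurable [measurable]:
  "p \<in> I \<Longrightarrow> (\<lambda>x. x p) \<in> borel_measurable (gaussian I)"
  unfolding gaussian_def
  using measurable_component_singleton[of p I "\<lambda>_. std_normal_distribution"] by simp

text \<open>A product instead of a norm: one coordinate splits off as a factor, and integrability
  over the product measure reduces to one dimension.\<close>

definition weight :: "'i set \<Rightarrow> ('i \<Rightarrow> real) \<Rightarrow> real" where
  "weight I x = (\<Prod>i\<in>I. 1 + (x i)\<^sup>2)"

lemma weight_ge_1: "1 \<le> weight I x"
  unfolding weight_def by (rule prod_ge_1) simp

lemma weight_insert:
  assumes "finite J" "p \<notin> J"
  shows "weight (insert p J) (x(p := t)) = (1 + t\<^sup>2) * weight J x"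
proof -
  have "(\<Prod>i\<in>J. 1 + ((x(p := t)) i)\<^sup>2) = (\<Prod>i\<in>J. 1 + (x i)\<^sup>2)"
    using assms by (intro prod.cong) auto
  then show ?thesis using assms by (simp add: weight_def)
qed

lemma integrable_weight:
  assumes "finite I"
  shows "integrable (gaussian I) (\<lambda>x. weight I x ^ m)"
proof -
  interpret product_sigma_finite "\<lambda>_ :: 'a. std_normal_distribution"
    by (simp add: product_sigma_finite_def prob_space_std_normal prob_space_imp_sigma_finite)
  have "integrable (gaussian I) (\<lambda>x. \<Prod>i\<in>I. (1 + (x i)\<^sup>2) ^ m)"
    unfolding gaussian_def
    by (rule product_integrable_prod[OF assms]) (rule integrable_std_normal_weight)
  then show ?thesis by (simp add: weight_def prod_power_distrib)
qed

text \<open>The bound is imposed at every function \<open>x\<close>, also outside the product space,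
  so that it applies to updated points \<open>x(p := t)\<close> without membership
  conditions.\<close>

definition growth :: "'i set \<Rightarrow> nat \<Rightarrow> (('i \<Rightarrow> real) \<Rightarrow> real) \<Rightarrow> bool" where
  "growth I m f \<longleftrightarrow> (\<exists>C. \<forall>x. \<bar>f x\<bar> \<le> C * weight I x ^ m)"

lemma growthI: "(\<And>x. \<bar>f x\<bar> \<le> C * weight I x ^ m) \<Longrightarrow> growth I m f"
  by (auto simp: growth_def)

lemma growthE:
  assumes "growth I m f"
  obtains C where "0 \<le> C" "\<And>x. \<bar>f x\<bar> \<le> C * weight I x ^ m"
proof -
  obtain C where C: "\<And>x. \<bar>f x\<bar> \<le> C * weight I x ^ m" using assms by (auto simp: growth_def)
  have "0 < weight I undefined ^ m" using weight_ge_1[of I undefined] by simp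
  moreover have "0 \<le> C * weight I undefined ^ m" using C[of undefined] by linarith
  ultimately have "0 \<le> C" by (simp add: zero_le_mult_iff)
  then show thesis using C that by blast
qed

lemma growth_bounded: "(\<And>x. \<bar>f x\<bar> \<le> C) \<Longrightarrow> growth I 0 f"
  by (rule growthI[of _ C]) simp

lemma growth_const: "growth I 0 (\<lambda>_. c)"
  by (rule growth_bounded[of _ "\<bar>c\<bar>"]) simp

lemma growth_mono:
  assumes "growth I m f" "m \<le> m'"
  shows "growth I m' f"
proof -
  obtain C where C: "0 \<le> C" "\<And>x. \<bar>f x\<bar> \<le> C * weight I x ^ m" using growthE[OF assms(1)] by blast
  show ?thesis
  proof (rule growthI)
    show "\<bar>f x\<bar> \<le> C * weight I x ^ m'" for x
      using C(2)[of x] mult_left_mono[OF power_increasing[OF assms(2) weight_ge_1] C(1), of I x] by linarith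
  qed
qed

lemma growth_add:
  assumes "growth I m f" "growth I m g"
  shows "growth I m (\<lambda>x. f x + g x)"
proof -
  obtain C where C: "\<And>x. \<bar>f x\<bar> \<le> C * weight I x ^ m" using growthE[OF assms(1)] by blast
  obtain D where D: "\<And>x. \<bar>g x\<bar> \<le> D * weight I x ^ m" using growthE[OF assms(2)] by metis
  show ?thesis
  proof (rule growthI)
    show "\<bar>f x + g x\<bar> \<le> (C + D) * weight I x ^ m" for x
      using C[of x] D[of x] unfolding distrib_right by linarith
  qed
qed

lemma growth_mult:
  assumes "growth I m f" "growth I m' g"
  shows "growth I (m + m') (\<lambda>x. f x * g x)"
proof -
  obtain C where C: "0 \<le> C" "\<And>x. \<bar>f x\<bar> \<le> C * weight I x ^ m" using growthE[OF assms(1)] by blast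
  obtain D where D: "0 \<le> D" "\<And>x. \<bar>g x\<bar> \<le> D * weight I x ^ m'" using growthE[OF assms(2)] by blast
  show ?thesis
  proof (rule growthI)
    fix x
    have "\<bar>f x * g x\<bar> \<le> (C * weight I x ^ m) * (D * weight I x ^ m')"
      unfolding abs_mult using C D weight_ge_1[of I x] by (intro mult_mono) auto
    then show "\<bar>f x * g x\<bar> \<le> (C * D) * weight I x ^ (m + m')" by (simp add: power_add mult_ac)
  qed
qed

lemma growth_cmult: "growth I m f \<Longrightarrow> growth I m (\<lambda>x. c * f x)"
  using growth_mult[OF growth_const] by fastforce

lemma growth_diff: "growth I m f \<Longrightarrow> growth I m g \<Longrightarrow> growth I m (\<lambda>x. f x - g x)"
  using growth_add[of I m f "\<lambda>x. - 1 * g x"] growth_cmult[of I m g "-1"] by simp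

lemma growth_sum: "(\<And>j. j \<in> J \<Longrightarrow> growth I m (f j)) \<Longrightarrow> growth I m (\<lambda>x. \<Sum>j\<in>J. f j x)"
proof (induction J rule: infinite_finite_induct)
  case (insert j J)
  then show ?case by (simp add: growth_add)
qed (auto intro: growth_mono[OF growth_const])

lemma growth_coordinate:
  assumes "finite I" "p \<in> I"
  shows "growth I 1 (\<lambda>x. x p)"
proof (rule growthI)
  fix x :: "'a \<Rightarrow> real"
  have "0 \<le> (\<bar>x p\<bar> - 1)\<^sup>2" by simp
  then have "2 * \<bar>x p\<bar> \<le> 1 + (x p)\<^sup>2" by (simp add: power2_diff)
  then have "\<bar>x p\<bar> \<le> (1 + (x p)\<^sup>2) * 1" by simp
  also have "\<dots> \<le> (1 + (x p)\<^sup>2) * weight (I - {p}) x"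
    using weight_ge_1[of "I - {p}" x] by (intro mult_left_mono) auto
  also have "\<dots> = 1 * weight I x ^ 1"
    using assms by (simp add: weight_def prod.remove[of I p])
  finally show "\<bar>x p\<bar> \<le> 1 * weight I x ^ 1" .
qed

lemma growth_integrable:
  assumes "finite I" "f \<in> borel_measurable (gaussian I)" "growth I m f"
  shows "integrable (gaussian I) f"
proof -
  obtain C where C: "0 \<le> C" "\<And>x. \<bar>f x\<bar> \<le> C * weight I x ^ m" using growthE[OF assms(3)] by blast
  have "integrable (gaussian I) (\<lambda>x. C * weight I x ^ m)"
    using integrable_weight[OF assms(1)] by simp
  then show ?thesis
  proof (rule Bochner_Integration.integrable_bound)
    have "\<bar>f x\<bar> \<le> \<bar>C * weight I x ^ m\<bar>" for x using C(2)[of x] by linarith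
    then show "AE x in gaussian I. norm (f x) \<le> norm (C * weight I x ^ m)" by simp
  qed (rule assms(2))
qed

text \<open>Integrating over coordinate \<open>p\<close> first, with the others frozen, leaves the
  one-dimensional identity pointwise; the growth bounds give the integrability that Fubini
  requires.\<close>

lemma stein_gaussian:
  fixes f f' :: "('i \<Rightarrow> real) \<Rightarrow> real"
  assumes I: "finite I" "p \<in> I"
    and mf: "f \<in> borel_measurable (gaussian I)" and mf': "f' \<in> borel_measurable (gaussian I)"
    and deriv: "\<And>x t. ((\<lambda>t. f (x(p := t))) has_real_derivative f' (x(p := t))) (at t)"
    and cont: "\<And>x t. isCont (\<lambda>t. f' (x(p := t))) t"
    and gf: "growth I 2 f" and gf': "growth I 2 f'"
  shows "(\<integral>x. x p * f x \<partial>gaussian I) = (\<integral>x. f' x \<partial>gaussian I)"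
proof -
  interpret product_sigma_finite "\<lambda>_ :: 'i. std_normal_distribution"
    by (simp add: product_sigma_finite_def prob_space_std_normal prob_space_imp_sigma_finite)
  define J where "J = I - {p}"
  have J: "finite J" "p \<notin> J" "I = insert p J" using I by (auto simp: J_def)
  have "integrable (gaussian I) (\<lambda>x. x p * f x)"
    using I mf growth_mult[OF growth_coordinate[OF I] gf] by (intro growth_integrable) auto
  then have 1: "(\<integral>x. x p * f x \<partial>gaussian I)
      = (\<integral>x. (\<integral>t. t * f (x(p := t)) \<partial>std_normal_distribution) \<partial>gaussian J)"
    unfolding gaussian_def J(3) by (subst product_integral_insert[OF J(1,2)]) auto
  have "integrable (gaussian I) f'" by (rule growth_integrable[OF I(1) mf' gf'])
  then have 2: "(\<integral>x. f' x \<partial>gaussian I)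
      = (\<integral>x. (\<integral>t. f' (x(p := t)) \<partial>std_normal_distribution) \<partial>gaussian J)"
    unfolding gaussian_def J(3) by (rule product_integral_insert[OF J(1,2)])
  obtain C where C: "0 \<le> C" "\<And>x. \<bar>f x\<bar> \<le> C * weight I x ^ 2" using growthE[OF gf] by blast
  obtain D where D: "0 \<le> D" "\<And>x. \<bar>f' x\<bar> \<le> D * weight I x ^ 2" using growthE[OF gf'] by blast
  have "(\<integral>t. t * f (x(p := t)) \<partial>std_normal_distribution)
      = (\<integral>t. f' (x(p := t)) \<partial>std_normal_distribution)" for x
  proof (rule stein_std_normal[OF deriv cont])
    define E where "E = (C + D) * (weight J x)\<^sup>2"
    have w: "weight I (x(p := t)) ^ 2 = (1 + t\<^sup>2)\<^sup>2 * (weight J x)\<^sup>2" for t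
      unfolding J(3) weight_insert[OF J(1,2)] power_mult_distrib ..
    have b: "(C + D) * ((1 + t\<^sup>2)\<^sup>2 * (weight J x)\<^sup>2) = E * (1 + t\<^sup>2)\<^sup>2" for t
      by (simp add: E_def)
    have nn: "0 \<le> (1 + t\<^sup>2)\<^sup>2 * (weight J x)\<^sup>2" for t :: real by simp
    show "\<bar>f (x(p := t))\<bar> \<le> E * (1 + t\<^sup>2)\<^sup>2" for t
      using C(2)[of "x(p := t)"] mult_nonneg_nonneg[OF D(1) nn[of t]] b[of t]
      unfolding w distrib_right by linarith
    show "\<bar>f' (x(p := t))\<bar> \<le> E * (1 + t\<^sup>2)\<^sup>2" for t
      using D(2)[of "x(p := t)"] mult_nonneg_nonneg[OF C(1) nn[of t]] b[of t]
      unfolding w distrib_right by linarith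
  qed
  then show ?thesis unfolding 1 2 by simp
qed

text \<open>Linearity extends integration by parts to the pairing of a fixed vector \<open>u\<close>
  with column \<open>b\<close> of the sketch. Taking \<open>u\<close> as a column of
  \<open>V\<close>, or orthogonal to \<open>V\<close>, yields the two expectations needed.\<close>

lemma stein_gaussian_direction:
  fixes f :: "(nat \<times> nat \<Rightarrow> real) \<Rightarrow> real" and f' :: "nat \<Rightarrow> (nat \<times> nat \<Rightarrow> real) \<Rightarrow> real"
    and d r :: nat
  defines "I \<equiv> {..<d} \<times> {..<r}"
  assumes b: "b < r"
    and mf: "f \<in> borel_measurable (gaussian I)"
    and mf': "\<And>a. a < d \<Longrightarrow> f' a \<in> borel_measurable (gaussian I)"
    and deriv: "\<And>a x t. a < d \<Longrightarrow>
      ((\<lambda>t. f (x((a, b) := t))) has_real_derivative f' a (x((a, b) := t))) (at t)"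
    and cont: "\<And>a x t. a < d \<Longrightarrow> isCont (\<lambda>t. f' a (x((a, b) := t))) t"
    and gf: "growth I 2 f" and gf': "\<And>a. a < d \<Longrightarrow> growth I 2 (f' a)"
  shows "(\<integral>x. (\<Sum>a<d. u a * x (a, b)) * f x \<partial>gaussian I)
    = (\<integral>x. (\<Sum>a<d. u a * f' a x) \<partial>gaussian I)"
proof -
  have I: "finite I" "\<And>a. a < d \<Longrightarrow> (a, b) \<in> I" using b by (auto simp: I_def)
  have i: "integrable (gaussian I) (\<lambda>x. x (a, b) * f x)" if "a < d" for a
    by (rule growth_integrable[OF I(1) borel_measurable_times[OF coordinate_measurable[OF I(2)[OF that]] mf]
          growth_mult[OF growth_coordinate[OF I(1) I(2)[OF that]] gf]])
  have "(\<integral>x. (\<Sum>a<d. u a * x (a, b)) * f x \<partial>gaussian I)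
      = (\<integral>x. (\<Sum>a<d. u a * (x (a, b) * f x)) \<partial>gaussian I)"
    by (simp add: sum_distrib_right mult.assoc)
  also have "\<dots> = (\<Sum>a<d. u a * (\<integral>x. x (a, b) * f x \<partial>gaussian I))"
    using i by (subst Bochner_Integration.integral_sum) auto
  also have "\<dots> = (\<Sum>a<d. u a * (\<integral>x. f' a x \<partial>gaussian I))"
    by (intro sum.cong refl arg_cong2[where f = "(*)"]
        stein_gaussian[OF I(1) I(2) mf mf' deriv cont gf gf']) auto
  also have "\<dots> = (\<integral>x. (\<Sum>a<d. u a * f' a x) \<partial>gaussian I)"
    using growth_integrable[OF I(1) mf' gf'] by (subst Bochner_Integration.integral_sum) auto
  finally show ?thesis .
qed

section \<open>The regularised inverse of a sketch\<close>

lemma entry_sq_le_fip: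
  assumes "A \<in> carrier_mat n m" "i < n" "j < m"
  shows "(A $$ (i, j))\<^sup>2 \<le> fip A A"
proof -
  have "(A $$ (i, j))\<^sup>2 \<le> (\<Sum>j<m. (A $$ (i, j))\<^sup>2)" using assms by (intro member_le_sum) auto
  also have "\<dots> \<le> (\<Sum>i<n. \<Sum>j<m. (A $$ (i, j))\<^sup>2)"
    using assms(2) member_le_sum[of i "{..<n}" "\<lambda>i. \<Sum>j<m. (A $$ (i, j))\<^sup>2"] by (simp add: sum_nonneg)
  also have "\<dots> = fip A A" using fip_carrier[OF assms(1), of A] by (simp add: power2_eq_square)
  finally show ?thesis .
qed

text \<open>By the identity \<open>R t - R s = - R t (H t - H s) R s\<close>.\<close>
lemma DERIV_inverse_mat:
  fixes R H :: "real \<Rightarrow> real mat" and H' :: "nat \<Rightarrow> nat \<Rightarrow> real"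
  assumes H: "\<And>t. H t \<in> carrier_mat k k" and R: "\<And>t. R t \<in> carrier_mat k k"
    and RH: "\<And>t. R t * H t = 1\<^sub>m k" and HR: "\<And>t. H t * R t = 1\<^sub>m k"
    and bd: "\<And>t i j. i < k \<Longrightarrow> j < k \<Longrightarrow> \<bar>R t $$ (i, j)\<bar> \<le> c"
    and dH: "\<And>i j. i < k \<Longrightarrow> j < k \<Longrightarrow> ((\<lambda>t. H t $$ (i, j)) has_real_derivative H' i j) (at s)"
    and ij: "i < k" "j < k"
  shows "((\<lambda>t. R t $$ (i, j)) has_real_derivative
    - (\<Sum>l<k. \<Sum>m<k. R s $$ (i, l) * H' l m * R s $$ (m, j))) (at s)"
proof -
  have triple: "(R t * (H u * R s)) $$ (i, j) = (\<Sum>l<k. \<Sum>m<k. R t $$ (i, l) * H u $$ (l, m) * R s $$ (m, j))"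
    if "i < k" "j < k" for t u i j
    using index_mult_sum[OF R[of t] _ that, of "H u * R s"] index_mult_sum[OF H[of u] R[of s] _ that(2)] R H
      carrier_matD[OF R] carrier_matD[OF H]
    by (simp add: sum_distrib_left mult.assoc)
  have diff: "R t $$ (i, j) - R s $$ (i, j)
      = - (\<Sum>l<k. \<Sum>m<k. R t $$ (i, l) * (H t $$ (l, m) - H s $$ (l, m)) * R s $$ (m, j))"
    if "i < k" "j < k" for t i j
  proof -
    have "R t * (H s * R s) = R t" unfolding HR by (rule right_mult_one_mat[OF R])
    moreover have "R t * (H t * R s) = R s"
      using assoc_mult_mat[OF R[of t] H[of t] R[of s]] RH[of t] left_mult_one_mat[OF R[of s]] by simp
    ultimately show ?thesis
      using triple[OF that, of t s] triple[OF that, of t t]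
      by (simp add: sum_subtractf right_diff_distrib left_diff_distrib)
  qed
  have Hlim: "((\<lambda>t. H t $$ (l, m) - H s $$ (l, m)) \<longlongrightarrow> 0) (at s)" if "l < k" "m < k" for l m
    using DERIV_isCont[OF dH[OF that]] unfolding isCont_def by (rule LIM_zero)
  \<comment> \<open>Continuity of the inverse has to precede differentiability; it follows from the
    identity for differences and the uniform entry bound \<open>c\<close>.\<close>
  have Rlim: "((\<lambda>t. R t $$ (i, j)) \<longlongrightarrow> R s $$ (i, j)) (at s)" if ij: "i < k" "j < k" for i j
  proof (rule LIM_zero_cancel)
    have "((\<lambda>t. R t $$ (i, l) * (H t $$ (l, m) - H s $$ (l, m)) * R s $$ (m, j)) \<longlongrightarrow> 0) (at s)"
      if "l < k" "m < k" for l m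
    proof (rule tendsto_mult_left_zero, rule Lim_null_comparison)
      show "\<forall>\<^sub>F t in at s. norm (R t $$ (i, l) * (H t $$ (l, m) - H s $$ (l, m)))
          \<le> c * \<bar>H t $$ (l, m) - H s $$ (l, m)\<bar>"
        using bd[OF ij(1) that(1)] by (intro always_eventually) (auto simp: abs_mult intro!: mult_right_mono)
      show "((\<lambda>t. c * \<bar>H t $$ (l, m) - H s $$ (l, m)\<bar>) \<longlongrightarrow> 0) (at s)"
        using Hlim[OF that] by (intro tendsto_mult_right_zero tendsto_rabs_zero)
    qed
    then have "((\<lambda>t. - (\<Sum>l<k. \<Sum>m<k. R t $$ (i, l) * (H t $$ (l, m) - H s $$ (l, m)) * R s $$ (m, j)))
        \<longlongrightarrow> - (\<Sum>l<k. \<Sum>m<k. 0)) (at s)"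
      by (intro tendsto_minus tendsto_sum) auto
    then show "((\<lambda>t. R t $$ (i, j) - R s $$ (i, j)) \<longlongrightarrow> 0) (at s)"
      unfolding diff[OF ij] by simp
  qed
  have "((\<lambda>t. - (\<Sum>l<k. \<Sum>m<k. R t $$ (i, l) * ((H t $$ (l, m) - H s $$ (l, m)) / (t - s)) * R s $$ (m, j)))
      \<longlongrightarrow> - (\<Sum>l<k. \<Sum>m<k. R s $$ (i, l) * H' l m * R s $$ (m, j))) (at s)"
    using Rlim[OF ij(1)] dH unfolding has_field_derivative_iff
    by (intro tendsto_minus tendsto_sum tendsto_mult tendsto_const) auto
  then show ?thesis
    unfolding has_field_derivative_iff diff[OF ij]
    by (simp add: sum_divide_distrib)
qed

text \<open>The permutation expansion is a polynomial in the entries. Through cofactors the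
  adjugate, and hence the inverse, becomes measurable too.\<close>

lemma measurable_det:
  assumes "\<And>x. A x \<in> carrier_mat n n"
    and "\<And>i j. i < n \<Longrightarrow> j < n \<Longrightarrow> (\<lambda>x. A x $$ (i, j)) \<in> borel_measurable M"
  shows "(\<lambda>x. det (A x) :: real) \<in> borel_measurable M"
proof -
  have eq: "det (A x) = (\<Sum>p\<in>{p. p permutes {0..<n}}. signof p * (\<Prod>i=0..<n. A x $$ (i, p i)))" for x
    by (rule det_def'[OF assms(1)])
  have m: "(\<lambda>x. A x $$ (i, p i)) \<in> borel_measurable M" if "p permutes {0..<n}" "i \<in> {0..<n}" for p i
    using that permutes_in_image[OF that(1), of i] by (intro assms(2)) auto
  show ?thesis unfolding eq
    by (intro borel_measurable_sum borel_measurable_times borel_measurable_prod borel_measurable_const m) auto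
qed

lemma measurable_adj_mat:
  assumes A: "\<And>x. A x \<in> carrier_mat n n"
    and m: "\<And>i j. i < n \<Longrightarrow> j < n \<Longrightarrow> (\<lambda>x. A x $$ (i, j)) \<in> borel_measurable M"
    and ij: "i < n" "j < n"
  shows "(\<lambda>x. adj_mat (A x) $$ (i, j) :: real) \<in> borel_measurable M"
proof -
  have eq: "adj_mat (A x) $$ (i, j) = (-1) ^ (j + i) * det (mat_delete (A x) j i)" for x
    using A[of x] ij by (simp add: adj_mat_def cofactor_def)
  have "(\<lambda>x. det (mat_delete (A x) j i)) \<in> borel_measurable M"
  proof (rule measurable_det)
    show "mat_delete (A x) j i \<in> carrier_mat (n - 1) (n - 1)" for x
      using A[of x] by (auto simp: mat_delete_def)
    fix i' j' assume ij': "i' < n - 1" "j' < n - 1"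
    have "mat_delete (A x) j i $$ (i', j')
        = A x $$ (if i' < j then i' else Suc i', if j' < i then j' else Suc j')" for x
      using A[of x] ij' by (auto simp: mat_delete_def)
    moreover have "Suc i' < n" "Suc j' < n" using ij' by auto
    then have "(if i' < j then i' else Suc i') < n" "(if j' < i then j' else Suc j') < n" by auto
    ultimately show "(\<lambda>x. mat_delete (A x) j i $$ (i', j')) \<in> borel_measurable M"
      by (simp only: m)
  qed
  then show ?thesis unfolding eq by (intro borel_measurable_times borel_measurable_const)
qed

text \<open>\<open>V\<close> will hold the leading right singular vectors, and \<open>x\<close> is
  any function whose values on \<open>I\<close> are the sketch entries. Positivity of
  \<open>\<delta>\<close> makes the inverse exist at every \<open>x\<close>, not only almost
  surely.\<close>

locale ridge =
  fixes d r k :: nat and V :: "real mat" and \<delta> :: real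
  assumes V: "V \<in> carrier_mat d k" "V\<^sup>T * V = 1\<^sub>m k" and \<delta>: "0 < \<delta>"
begin

abbreviation "I \<equiv> {..<d} \<times> {..<r}"

definition G :: "(nat \<times> nat \<Rightarrow> real) \<Rightarrow> real mat" where "G x = V\<^sup>T * Matrix.mat d r x"
definition H where "H x = G x * (G x)\<^sup>T + \<delta> \<cdot>\<^sub>m 1\<^sub>m k"
text \<open>An explicit formula instead of a chosen inverse, so that the entries are visibly
  measurable functions of \<open>x\<close>.\<close>

definition R where "R x = (1 / det (H x)) \<cdot>\<^sub>m adj_mat (H x)"
definition F where "F x = (G x)\<^sup>T * R x"
definition tr where "tr x = fip (R x) (1\<^sub>m k)"

lemma G_carrier: "G x \<in> carrier_mat k r" using V by (simp add: G_def)
lemma H_carrier: "H x \<in> carrier_mat k k" using G_carrier[of x] by (simp add: H_def)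
lemma R_carrier: "R x \<in> carrier_mat k k" using adj_mat(1)[OF H_carrier] by (simp add: R_def)
lemma F_carrier: "F x \<in> carrier_mat r k"
  using carrier_matD[OF G_carrier[of x]] carrier_matD[OF R_carrier[of x]] by (simp add: F_def)

text \<open>Positive definiteness: pairing \<open>H x * u\<close> with \<open>u\<close> gives the
  squared norm of \<open>(G x)\<^sup>T * u\<close> plus \<open>\<delta>\<close> times that of
  \<open>u\<close>. The kernel vector becomes a one-column matrix to make \<open>fip\<close>
  applicable.\<close>

lemma det_H: "det (H x) \<noteq> 0"
proof
  assume "det (H x) = 0"
  then obtain v where v: "v \<in> carrier_vec k" "v \<noteq> 0\<^sub>v k" "H x *\<^sub>v v = 0\<^sub>v k"
    using det_0_iff_vec_prod_zero[OF H_carrier] by auto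
  define u where "u = mat_of_cols k [v]"
  have u: "u \<in> carrier_mat k 1" using mat_of_cols_carrier(1)[of k "[v]"] by (simp add: u_def)
  have colu: "col u 0 = v" using v by (simp add: u_def)
  have Hu: "H x * u = 0\<^sub>m k 1"
  proof (rule eq_matI)
    fix i j assume "i < dim_row (0\<^sub>m k 1 :: real mat)" "j < dim_col (0\<^sub>m k 1 :: real mat)"
    then have ij: "i < k" "j = 0" by auto
    have "(H x * u) $$ (i, j) = (H x *\<^sub>v v) $ i" using ij u H_carrier[of x] colu by simp
    then show "(H x * u) $$ (i, j) = 0\<^sub>m k 1 $$ (i, j)" using v ij by simp
  qed (use u H_carrier[of x] in auto)
  have GG: "G x * (G x)\<^sup>T \<in> carrier_mat k k" using carrier_matD[OF G_carrier[of x]] by simp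
  have "H x * u = G x * (G x)\<^sup>T * u + (\<delta> \<cdot>\<^sub>m 1\<^sub>m k) * u"
    unfolding H_def using GG u by (intro add_mult_distrib_mat) auto
  also have "(\<delta> \<cdot>\<^sub>m 1\<^sub>m k) * u = \<delta> \<cdot>\<^sub>m u"
    using mult_smult_assoc_mat[OF one_carrier_mat u] left_mult_one_mat[OF u] by simp
  also have "G x * (G x)\<^sup>T * u = G x * ((G x)\<^sup>T * u)"
    using assoc_mult_mat[OF G_carrier[of x] _ u, of "(G x)\<^sup>T"] G_carrier[of x] by simp
  finally have Hu': "H x * u = G x * ((G x)\<^sup>T * u) + \<delta> \<cdot>\<^sub>m u" .
  have Gu: "(G x)\<^sup>T * u \<in> carrier_mat r 1" using carrier_matD[OF G_carrier[of x]] u by simp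
  have GGu: "G x * ((G x)\<^sup>T * u) \<in> carrier_mat k 1" using carrier_matD[OF G_carrier[of x]] u by simp
  have "fip (H x * u) u = fip (G x * ((G x)\<^sup>T * u)) u + \<delta> * fip u u"
    unfolding Hu' using GGu u by (simp add: fip_add_left[of _ k 1] fip_smult_left)
  also have "fip (G x * ((G x)\<^sup>T * u)) u = fip ((G x)\<^sup>T * u) ((G x)\<^sup>T * u)"
    by (rule fip_mult_left[OF G_carrier Gu u])
  finally have "fip ((G x)\<^sup>T * u) ((G x)\<^sup>T * u) + \<delta> * fip u u = 0" unfolding Hu by (simp add: fip_def)
  moreover have "0 \<le> \<delta> * fip u u" using \<delta> fip_nonneg[of u] by simp
  ultimately have "\<delta> * fip u u = 0" using fip_nonneg[of "(G x)\<^sup>T * u"] by linarith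
  then have "u = 0\<^sub>m k 1" using fip_self_eq_0[OF u] \<delta> by simp
  then have "v = 0\<^sub>v k" using colu by auto
  with v(2) show False ..
qed

lemma HR: "H x * R x = 1\<^sub>m k" and RH: "R x * H x = 1\<^sub>m k"
proof -
  have "H x * R x = (1 / det (H x)) \<cdot>\<^sub>m (H x * adj_mat (H x))"
    unfolding R_def by (rule mult_smult_distrib[OF H_carrier adj_mat(1)[OF H_carrier]])
  also have "\<dots> = 1\<^sub>m k" unfolding adj_mat(2)[OF H_carrier] using det_H[of x] by (intro eq_matI) auto
  finally show 1: "H x * R x = 1\<^sub>m k" .
  show "R x * H x = 1\<^sub>m k" by (rule mat_mult_left_right_inverse[OF H_carrier R_carrier 1])
qed

text \<open>Here \<open>G x * (G x)\<^sup>T\<close> is \<open>H x\<close> minus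
  \<open>\<delta>\<close> times the identity. The defect, \<open>\<delta>\<close> times
  \<open>R x\<close>, is the whole bias of the regularisation.\<close>

lemma GF: "G x * F x = 1\<^sub>m k + (- \<delta>) \<cdot>\<^sub>m R x"
proof -
  have GG: "G x * (G x)\<^sup>T \<in> carrier_mat k k" using carrier_matD[OF G_carrier[of x]] by simp
  have "1\<^sub>m k = H x * R x" using HR by simp
  also have "\<dots> = G x * (G x)\<^sup>T * R x + (\<delta> \<cdot>\<^sub>m 1\<^sub>m k) * R x"
    unfolding H_def using GG R_carrier by (intro add_mult_distrib_mat) auto
  also have "(\<delta> \<cdot>\<^sub>m 1\<^sub>m k) * R x = \<delta> \<cdot>\<^sub>m R x"
    using mult_smult_assoc_mat[OF one_carrier_mat R_carrier] left_mult_one_mat[OF R_carrier] by simp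
  also have "G x * (G x)\<^sup>T * R x = G x * F x"
    unfolding F_def using assoc_mult_mat[of "G x" k r "(G x)\<^sup>T" k "R x" k] G_carrier[of x] R_carrier[of x] by simp
  finally have "1\<^sub>m k = G x * F x + \<delta> \<cdot>\<^sub>m R x" .
  moreover have "X + \<delta> \<cdot>\<^sub>m Y + (- \<delta>) \<cdot>\<^sub>m Y = X" if "X \<in> carrier_mat k k" "Y \<in> carrier_mat k k" for X Y :: "real mat"
    using that by (intro eq_matI) auto
  ultimately show ?thesis
    using R_carrier[of x] carrier_matD[OF G_carrier[of x]] carrier_matD[OF F_carrier[of x]] by simp
qed

lemma tr_sum: "tr x = (\<Sum>i<k. R x $$ (i, i))"
proof -
  have "tr x = (\<Sum>i<k. \<Sum>j<k. if j = i then R x $$ (i, i) else 0)"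
    unfolding tr_def fip_carrier[OF R_carrier] by (intro sum.cong refl) auto
  then show ?thesis by simp
qed

text \<open>Moving a factor across the inner product turns the squared norm of \<open>F x\<close>
  into the pairing of \<open>R x\<close> with \<open>G x * F x\<close>. From this one identity
  follow the sign of \<open>tr\<close> and the bounds on \<open>F x\<close> and
  \<open>R x\<close>.\<close>

lemma fip_F: "fip (F x) (F x) + \<delta> * fip (R x) (R x) = tr x"
proof -
  have "fip (F x) (F x) = fip (R x) (G x * F x)"
    using fip_mult_left[of "(G x)\<^sup>T" r k "R x" k "F x"] G_carrier[of x] R_carrier[of x] F_carrier[of x]
    by (simp add: F_def)
  also have "\<dots> = fip (1\<^sub>m k + (- \<delta>) \<cdot>\<^sub>m R x) (R x)"
    unfolding GF using R_carrier[of x] by (intro fip_sym[of _ k k]) auto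
  also have "\<dots> = fip (1\<^sub>m k) (R x) + (- \<delta>) * fip (R x) (R x)"
    using R_carrier[of x] by (simp add: fip_add_left[of _ k k] fip_smult_left)
  also have "fip (1\<^sub>m k) (R x) = tr x"
    unfolding tr_def using R_carrier[of x] by (intro fip_sym[of _ k k]) auto
  finally show ?thesis by simp
qed

lemma tr_nonneg: "0 \<le> tr x"
  using fip_F[of x] fip_nonneg[of "F x"] fip_nonneg[of "R x"] \<delta> by (metis add_nonneg_nonneg mult_nonneg_nonneg less_imp_le)

lemma fip_F_le: "fip (F x) (F x) \<le> tr x"
  using fip_F[of x] mult_nonneg_nonneg[of \<delta> "fip (R x) (R x)"] fip_nonneg[of "R x"] \<delta> by linarith

lemma fip_R_le: "\<delta> * fip (R x) (R x) \<le> tr x"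
  using fip_F[of x] fip_nonneg[of "F x"] by linarith

lemma sum_GF: "(\<Sum>i<k. \<Sum>b<r. G x $$ (i, b) * F x $$ (b, i)) = real k - \<delta> * tr x"
proof -
  have "(\<Sum>b<r. G x $$ (i, b) * F x $$ (b, i)) = 1 - \<delta> * R x $$ (i, i)" if "i < k" for i
  proof -
    have "(\<Sum>b<r. G x $$ (i, b) * F x $$ (b, i)) = (G x * F x) $$ (i, i)"
      using index_mult_sum[OF G_carrier F_carrier that that] by simp
    then show ?thesis unfolding GF using that R_carrier[of x] by simp
  qed
  then show ?thesis by (simp add: sum_subtractf tr_sum sum_distrib_left)
qed

text \<open>Summing \<open>2 * y \<le> y\<^sup>2 + 1\<close> over the diagonal entries
  \<open>y\<close> of \<open>\<delta>\<close> times \<open>R x\<close> and applying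
  \<open>fip_R_le\<close> gives \<open>2 * \<delta> * tr x \<le> \<delta> * tr x + real k\<close>,
  in which the trace bounds itself.\<close>

lemma tr_le: "tr x \<le> real k / \<delta>"
proof -
  have "\<delta> * R x $$ (i, i) \<le> (\<delta>\<^sup>2 * (\<Sum>j<k. (R x $$ (i, j))\<^sup>2) + 1) / 2" if "i < k" for i
  proof -
    have "0 \<le> (\<delta> * R x $$ (i, i) - 1)\<^sup>2" by simp
    then have 1: "2 * (\<delta> * R x $$ (i, i)) \<le> \<delta>\<^sup>2 * (R x $$ (i, i))\<^sup>2 + 1"
      by (simp add: power2_diff power_mult_distrib)
    have "(R x $$ (i, i))\<^sup>2 \<le> (\<Sum>j<k. (R x $$ (i, j))\<^sup>2)" using that by (intro member_le_sum) auto
    then have "\<delta>\<^sup>2 * (R x $$ (i, i))\<^sup>2 \<le> \<delta>\<^sup>2 * (\<Sum>j<k. (R x $$ (i, j))\<^sup>2)" by (intro mult_left_mono) auto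
    then show ?thesis using 1 by simp
  qed
  then have "(\<Sum>i<k. \<delta> * R x $$ (i, i)) \<le> (\<Sum>i<k. (\<delta>\<^sup>2 * (\<Sum>j<k. (R x $$ (i, j))\<^sup>2) + 1) / 2)"
    by (intro sum_mono) auto
  also have "\<dots> = (\<delta> * (\<delta> * fip (R x) (R x)) + real k) / 2"
    unfolding fip_carrier[OF R_carrier]
    by (simp add: sum_divide_distrib[symmetric] sum.distrib sum_distrib_left power2_eq_square mult_ac)
  also have "\<dots> \<le> (\<delta> * tr x + real k) / 2"
    using mult_left_mono[OF fip_R_le[of x], of \<delta>] \<delta> by simp
  finally have "\<delta> * tr x \<le> real k" by (simp add: tr_sum sum_distrib_left)
  then show ?thesis using \<delta> by (simp add: field_simps)
qed

text \<open>The arguments of \<open>max\<close> bound the squared entries of \<open>F x\<close> and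
  \<open>R x\<close>; the added 1 comes from \<open>\<bar>y\<bar> \<le> 1 + y\<^sup>2\<close>, which
  avoids square roots.\<close>

definition "bnd = max (real k / \<delta>) (real k / \<delta> / \<delta>) + 1"

lemma bounds:
  shows "i < k \<Longrightarrow> j < k \<Longrightarrow> \<bar>R x $$ (i, j)\<bar> \<le> bnd"
    and "c < r \<Longrightarrow> j < k \<Longrightarrow> \<bar>F x $$ (c, j)\<bar> \<le> bnd"
proof -
  have le: "\<bar>y\<bar> \<le> bnd" if "y\<^sup>2 \<le> real k / \<delta> \<or> y\<^sup>2 \<le> real k / \<delta> / \<delta>" for y :: real
  proof -
    have "0 \<le> (\<bar>y\<bar> - 1)\<^sup>2" by simp
    then have "2 * \<bar>y\<bar> \<le> 1 + y\<^sup>2" by (simp add: power2_diff)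
    then have "\<bar>y\<bar> \<le> 1 + y\<^sup>2" by simp
    then show ?thesis using that unfolding bnd_def by linarith
  qed
  show "\<bar>R x $$ (i, j)\<bar> \<le> bnd" if "i < k" "j < k"
  proof -
    have "\<delta> * (R x $$ (i, j))\<^sup>2 \<le> \<delta> * fip (R x) (R x)"
      using entry_sq_le_fip[OF R_carrier that] \<delta> by simp
    then have "\<delta> * (R x $$ (i, j))\<^sup>2 \<le> real k / \<delta>" using fip_R_le[of x] tr_le[of x] by linarith
    then have "(R x $$ (i, j))\<^sup>2 \<le> real k / \<delta> / \<delta>" using \<delta> by (simp add: field_simps)
    then show ?thesis by (intro le) simp
  qed
  show "\<bar>F x $$ (c, j)\<bar> \<le> bnd" if "c < r" "j < k"
    using entry_sq_le_fip[OF F_carrier that, of x] fip_F_le[of x] tr_le[of x] by (intro le) linarith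
qed

lemma G_index: "l < k \<Longrightarrow> c < r \<Longrightarrow> G x $$ (l, c) = (\<Sum>a<d. V $$ (a, l) * x (a, c))"
  unfolding G_def using index_mult_sum[of "V\<^sup>T" k d "Matrix.mat d r x" r l c] V by simp

lemma F_index: "c < r \<Longrightarrow> i < k \<Longrightarrow> F x $$ (c, i) = (\<Sum>l<k. G x $$ (l, c) * R x $$ (l, i))"
  unfolding F_def using index_mult_sum[of "(G x)\<^sup>T" r k "R x" k c i] G_carrier[of x] R_carrier[of x] by simp

lemma H_index:
  "l < k \<Longrightarrow> m < k \<Longrightarrow> H x $$ (l, m) = (\<Sum>c<r. G x $$ (l, c) * G x $$ (m, c)) + (if l = m then \<delta> else 0)"
  unfolding H_def using index_mult_sum[of "G x" k r "(G x)\<^sup>T" k l m] G_carrier[of x] by simp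

lemma V_orthonormal: "i < k \<Longrightarrow> m < k \<Longrightarrow> (\<Sum>a<d. V $$ (a, i) * V $$ (a, m)) = (if i = m then 1 else 0)"
  using index_mult_sum[of "V\<^sup>T" k d V k i m] V by simp

section \<open>Derivatives with respect to the sketch entries\<close>

lemma G_DERIV:
  assumes "a < d" "l < k" "c < r"
  shows "((\<lambda>t. G (x((a, b) := t)) $$ (l, c)) has_real_derivative (if c = b then V $$ (a, l) else 0)) (at t)"
proof -
  have "((\<lambda>t. \<Sum>a'<d. V $$ (a', l) * (x((a, b) := t)) (a', c)) has_real_derivative
      (\<Sum>a'<d. V $$ (a', l) * (if a' = a \<and> c = b then 1 else 0))) (at t)"
    by (intro DERIV_sum DERIV_cmult) auto
  moreover have "(\<Sum>a'<d. V $$ (a', l) * (if a' = a \<and> c = b then 1 else 0)) = (if c = b then V $$ (a, l) else 0)"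
    using assms(1) by (auto simp: if_distrib[of "\<lambda>y. _ * y"] cong: if_cong)
  ultimately show ?thesis using assms by (simp add: G_index)
qed

lemma H_DERIV:
  assumes "a < d" "b < r" "l < k" "m < k"
  shows "((\<lambda>t. H (x((a, b) := t)) $$ (l, m)) has_real_derivative
    V $$ (a, l) * G (x((a, b) := s)) $$ (m, b) + G (x((a, b) := s)) $$ (l, b) * V $$ (a, m)) (at s)"
proof -
  let ?y = "\<lambda>t. x((a, b) := t)"
  have "((\<lambda>t. (\<Sum>c<r. G (?y t) $$ (l, c) * G (?y t) $$ (m, c)) + (if l = m then \<delta> else 0)) has_real_derivative
      (\<Sum>c<r. (if c = b then V $$ (a, l) else 0) * G (?y s) $$ (m, c)
        + (if c = b then V $$ (a, m) else 0) * G (?y s) $$ (l, c)) + 0) (at s)"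
    using assms by (intro DERIV_add DERIV_sum DERIV_mult DERIV_const G_DERIV) auto
  moreover have "(\<Sum>c<r. (if c = b then V $$ (a, l) else 0) * G (?y s) $$ (m, c)
        + (if c = b then V $$ (a, m) else 0) * G (?y s) $$ (l, c)) + 0
      = V $$ (a, l) * G (?y s) $$ (m, b) + G (?y s) $$ (l, b) * V $$ (a, m)"
    using assms(2) by (simp add: sum.distrib if_distrib[of "\<lambda>y. y * _"] cong: if_cong)
  ultimately show ?thesis using assms by (simp add: H_index)
qed

lemma R_DERIV:
  assumes "a < d" "b < r" "i < k" "j < k"
  shows "((\<lambda>t. R (x((a, b) := t)) $$ (i, j)) has_real_derivative
    - (\<Sum>l<k. \<Sum>m<k. R (x((a, b) := s)) $$ (i, l)
      * (V $$ (a, l) * G (x((a, b) := s)) $$ (m, b) + G (x((a, b) := s)) $$ (l, b) * V $$ (a, m))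
      * R (x((a, b) := s)) $$ (m, j))) (at s)"
  using assms bounds(1) by (intro DERIV_inverse_mat[of "\<lambda>t. H (x((a, b) := t))"] H_carrier R_carrier RH HR H_DERIV)

text \<open>The partial derivative of entry \<open>(c, i)\<close> of \<open>F\<close> with respect
  to entry \<open>(m, b)\<close> of \<open>G\<close>. Keeping \<open>V\<close> out of it leaves the
  chain rule as the plain pairing in \<open>dF\<close>.\<close>

definition K :: "nat \<Rightarrow> nat \<Rightarrow> nat \<Rightarrow> nat \<Rightarrow> (nat \<times> nat \<Rightarrow> real) \<Rightarrow> real" where
  "K c b i m x = ((if c = b then 1 else 0) - (\<Sum>l<k. F x $$ (c, l) * G x $$ (l, b))) * R x $$ (m, i)
    - F x $$ (c, m) * F x $$ (b, i)"

definition dF where "dF a b c i x = (\<Sum>m<k. V $$ (a, m) * K c b i m x)"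

lemma F_DERIV:
  assumes a: "a < d" and b: "b < r" and c: "c < r" and i: "i < k"
  shows "((\<lambda>t. F (x((a, b) := t)) $$ (c, i)) has_real_derivative dF a b c i (x((a, b) := s))) (at s)"
proof -
  let ?y = "\<lambda>t. x((a, b) := t)"
  define y where "y = ?y s"
  let ?dR = "\<lambda>l. - (\<Sum>l'<k. \<Sum>m<k. R y $$ (l, l')
      * (V $$ (a, l') * G y $$ (m, b) + G y $$ (l', b) * V $$ (a, m)) * R y $$ (m, i))"
  have D: "((\<lambda>t. \<Sum>l<k. G (?y t) $$ (l, c) * R (?y t) $$ (l, i)) has_real_derivative
      (\<Sum>l<k. (if c = b then V $$ (a, l) else 0) * R y $$ (l, i) + ?dR l * G y $$ (l, c))) (at s)"
    unfolding y_def using assms by (intro DERIV_sum DERIV_mult G_DERIV R_DERIV) auto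
  \<comment> \<open>The two summands of the derivative of \<open>H\<close> factor into separate sums
    over \<open>l'\<close> and \<open>m\<close>; in the first, the sum over \<open>m\<close>
    collapses to an entry of \<open>F\<close>.\<close>
  have dR: "?dR l = - (\<Sum>l'<k. R y $$ (l, l') * V $$ (a, l')) * F y $$ (b, i)
      - (\<Sum>l'<k. R y $$ (l, l') * G y $$ (l', b)) * (\<Sum>m<k. V $$ (a, m) * R y $$ (m, i))" if "l < k" for l
  proof -
    have "(\<Sum>l'<k. \<Sum>m<k. R y $$ (l, l')
        * (V $$ (a, l') * G y $$ (m, b) + G y $$ (l', b) * V $$ (a, m)) * R y $$ (m, i))
      = (\<Sum>l'<k. \<Sum>m<k. (R y $$ (l, l') * V $$ (a, l')) * (G y $$ (m, b) * R y $$ (m, i)))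
        + (\<Sum>l'<k. \<Sum>m<k. (R y $$ (l, l') * G y $$ (l', b)) * (V $$ (a, m) * R y $$ (m, i)))"
      unfolding sum.distrib[symmetric] by (intro sum.cong refl) (simp add: algebra_simps)
    also have "\<dots> = (\<Sum>l'<k. R y $$ (l, l') * V $$ (a, l')) * F y $$ (b, i)
        + (\<Sum>l'<k. R y $$ (l, l') * G y $$ (l', b)) * (\<Sum>m<k. V $$ (a, m) * R y $$ (m, i))"
      unfolding sum_product F_index[OF b i] ..
    finally show ?thesis by simp
  qed
  \<comment> \<open>Summation against column \<open>c\<close> of \<open>G\<close> turns the
    remaining copy of \<open>R\<close> into row \<open>c\<close> of \<open>F\<close>. The weight
    \<open>w\<close> is instantiated once with \<open>V\<close> and once with
    \<open>G\<close>.\<close>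
  have e1: "(\<Sum>l<k. (\<Sum>l'<k. R y $$ (l, l') * w l') * G y $$ (l, c)) = (\<Sum>l'<k. F y $$ (c, l') * w l')" for w
  proof -
    have "(\<Sum>l<k. (\<Sum>l'<k. R y $$ (l, l') * w l') * G y $$ (l, c))
        = (\<Sum>l<k. \<Sum>l'<k. R y $$ (l, l') * w l' * G y $$ (l, c))" by (simp add: sum_distrib_right)
    also have "\<dots> = (\<Sum>l'<k. \<Sum>l<k. R y $$ (l, l') * w l' * G y $$ (l, c))" by (rule sum.swap)
    also have "\<dots> = (\<Sum>l'<k. F y $$ (c, l') * w l')"
      using c by (intro sum.cong refl) (simp add: F_index sum_distrib_left mult_ac)
    finally show ?thesis .
  qed
  let ?v = "\<Sum>m<k. V $$ (a, m) * R y $$ (m, i)"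
  have "(\<Sum>l<k. (if c = b then V $$ (a, l) else 0) * R y $$ (l, i) + ?dR l * G y $$ (l, c))
      = (\<Sum>l<k. (if c = b then V $$ (a, l) else 0) * R y $$ (l, i)) + (\<Sum>l<k. ?dR l * G y $$ (l, c))"
    by (rule sum.distrib)
  also have "(\<Sum>l<k. (if c = b then V $$ (a, l) else 0) * R y $$ (l, i)) = (if c = b then 1 else 0) * ?v"
    by simp
  also have "(\<Sum>l<k. ?dR l * G y $$ (l, c))
      = (\<Sum>l<k. - F y $$ (b, i) * ((\<Sum>l'<k. R y $$ (l, l') * V $$ (a, l')) * G y $$ (l, c))
        - ?v * ((\<Sum>l'<k. R y $$ (l, l') * G y $$ (l', b)) * G y $$ (l, c)))"
    by (intro sum.cong refl) (simp only: lessThan_iff dR left_diff_distrib, simp)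
  also have "\<dots> = - F y $$ (b, i) * (\<Sum>l'<k. F y $$ (c, l') * V $$ (a, l'))
        - ?v * (\<Sum>l'<k. F y $$ (c, l') * G y $$ (l', b))"
    by (simp only: sum_subtractf sum_distrib_left[symmetric] e1)
  also have "(if c = b then 1 else 0) * ?v + \<dots> = dF a b c i y"
  proof -
    define q where "q = (\<Sum>l'<k. F y $$ (c, l') * G y $$ (l', b))"
    have "dF a b c i y = ((if c = b then 1 else 0) - q) * ?v
        - F y $$ (b, i) * (\<Sum>l'<k. F y $$ (c, l') * V $$ (a, l'))"
      unfolding dF_def K_def q_def[symmetric] sum_distrib_left sum_subtractf[symmetric]
      by (intro sum.cong refl) (simp add: algebra_simps)
    then show ?thesis unfolding q_def[symmetric] by (simp add: left_diff_distrib mult.commute)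
  qed
  finally show ?thesis using D unfolding F_index[OF c i] y_def by (simp only:)
qed

end

lemma integral_double_sum:
  fixes f :: "nat \<Rightarrow> nat \<Rightarrow> 'a \<Rightarrow> real"
  assumes "\<And>i j. i < m \<Longrightarrow> j < n \<Longrightarrow> integrable M (f i j)"
  shows "integrable M (\<lambda>x. \<Sum>i<m. \<Sum>j<n. f i j x)"
    and "(\<integral>x. (\<Sum>i<m. \<Sum>j<n. f i j x) \<partial>M) = (\<Sum>i<m. \<Sum>j<n. \<integral>x. f i j x \<partial>M)"
proof -
  have i: "integrable M (\<lambda>x. \<Sum>j<n. f i j x)" if "i < m" for i
    using assms that by (intro Bochner_Integration.integrable_sum) auto
  show "integrable M (\<lambda>x. \<Sum>i<m. \<Sum>j<n. f i j x)"
    by (rule Bochner_Integration.integrable_sum) (use i in simp)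
  have "(\<integral>x. (\<Sum>i<m. \<Sum>j<n. f i j x) \<partial>M) = (\<Sum>i<m. \<integral>x. (\<Sum>j<n. f i j x) \<partial>M)"
    using i by (intro Bochner_Integration.integral_sum) auto
  also have "\<dots> = (\<Sum>i<m. \<Sum>j<n. \<integral>x. f i j x \<partial>M)"
    using assms by (intro sum.cong refl Bochner_Integration.integral_sum) auto
  finally show "(\<integral>x. (\<Sum>i<m. \<Sum>j<n. f i j x) \<partial>M) = (\<Sum>i<m. \<Sum>j<n. \<integral>x. f i j x \<partial>M)" .
qed

section \<open>Measurability and growth of the regularised quantities\<close>

context ridge
begin

lemma G_measurable: "l < k \<Longrightarrow> c < r \<Longrightarrow> (\<lambda>x. G x $$ (l, c)) \<in> borel_measurable (gaussian I)"
  by (simp only: G_index)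
    (intro borel_measurable_sum borel_measurable_times borel_measurable_const coordinate_measurable; simp)

lemma H_measurable: "l < k \<Longrightarrow> m < k \<Longrightarrow> (\<lambda>x. H x $$ (l, m)) \<in> borel_measurable (gaussian I)"
  by (simp only: H_index)
    (intro borel_measurable_add borel_measurable_sum borel_measurable_times borel_measurable_const G_measurable; simp)

lemma R_measurable:
  assumes "i < k" "j < k"
  shows "(\<lambda>x. R x $$ (i, j)) \<in> borel_measurable (gaussian I)"
proof -
  have "R x $$ (i, j) = 1 / det (H x) * adj_mat (H x) $$ (i, j)" for x
    using assms adj_mat(1)[OF H_carrier, of x] by (simp add: R_def)
  then show ?thesis
    by (simp only:) (intro borel_measurable_times borel_measurable_divide borel_measurable_const
        measurable_det[OF H_carrier] measurable_adj_mat[OF H_carrier] H_measurable assms)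
qed

lemma F_measurable: "c < r \<Longrightarrow> i < k \<Longrightarrow> (\<lambda>x. F x $$ (c, i)) \<in> borel_measurable (gaussian I)"
  by (simp only: F_index) (intro borel_measurable_sum borel_measurable_times G_measurable R_measurable; simp)

lemma K_measurable:
  assumes "b < r" "c < r" "i < k" "m < k"
  shows "K c b i m \<in> borel_measurable (gaussian I)"
  unfolding K_def[abs_def]
  by (intro borel_measurable_diff borel_measurable_times borel_measurable_sum borel_measurable_const
      F_measurable G_measurable R_measurable) (use assms in auto)

lemma dF_measurable:
  assumes "b < r" "c < r" "i < k"
  shows "dF a b c i \<in> borel_measurable (gaussian I)"
  unfolding dF_def[abs_def]
  by (intro borel_measurable_times borel_measurable_sum borel_measurable_const K_measurable)
    (use assms in auto)

lemma finite_I: "finite I" by simp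

lemma G_growth: "l < k \<Longrightarrow> c < r \<Longrightarrow> growth I 1 (\<lambda>x. G x $$ (l, c))"
  by (simp only: G_index) (intro growth_sum growth_cmult growth_coordinate finite_I; simp)

lemma R_growth: "i < k \<Longrightarrow> j < k \<Longrightarrow> growth I 0 (\<lambda>x. R x $$ (i, j))"
  by (rule growth_bounded, rule bounds(1))

lemma F_growth: "c < r \<Longrightarrow> i < k \<Longrightarrow> growth I 0 (\<lambda>x. F x $$ (c, i))"
  by (rule growth_bounded, rule bounds(2))

text \<open>\<open>R\<close> and \<open>F\<close> are bounded, so the single factor \<open>G\<close>
  determines the exponent.\<close>

lemma K_growth:
  assumes "b < r" "c < r" "i < k" "m < k"
  shows "growth I 1 (K c b i m)"
proof -
  have "growth I (0 + 1) (\<lambda>x. F x $$ (c, l) * G x $$ (l, b))" if "l < k" for l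
    using assms that by (intro growth_mult F_growth G_growth)
  then have "growth I 1 (\<lambda>x. (if c = b then 1 else 0) - (\<Sum>l<k. F x $$ (c, l) * G x $$ (l, b)))"
    by (intro growth_diff growth_sum growth_mono[OF growth_const]) auto
  from growth_mult[OF this R_growth[OF assms(4,3)]]
  have 1: "growth I 1 (\<lambda>x. ((if c = b then 1 else 0) - (\<Sum>l<k. F x $$ (c, l) * G x $$ (l, b))) * R x $$ (m, i))"
    by simp
  have "growth I (0 + 0) (\<lambda>x. F x $$ (c, m) * F x $$ (b, i))"
    using assms by (intro growth_mult F_growth)
  then have "growth I 1 (\<lambda>x. F x $$ (c, m) * F x $$ (b, i))" by (rule growth_mono) simp
  from growth_diff[OF 1 this] show ?thesis unfolding K_def[abs_def] .
qed

lemma dF_growth: "b < r \<Longrightarrow> c < r \<Longrightarrow> i < k \<Longrightarrow> growth I 1 (dF a b c i)"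
  unfolding dF_def[abs_def] by (intro growth_sum growth_cmult K_growth) auto

lemma dF_isCont:
  assumes "a < d" "b < r" "c < r" "i < k"
  shows "isCont (\<lambda>t. dF a b c i (x((a, b) := t))) s"
proof -
  have "isCont (\<lambda>t. G (x((a, b) := t)) $$ (l, c)) s" if "l < k" "c < r" for l c
    by (rule DERIV_isCont[OF G_DERIV[OF assms(1) that]])
  moreover have "isCont (\<lambda>t. R (x((a, b) := t)) $$ (i, j)) s" if "i < k" "j < k" for i j
    by (rule DERIV_isCont[OF R_DERIV[OF assms(1,2) that]])
  moreover have "isCont (\<lambda>t. F (x((a, b) := t)) $$ (c, i)) s" if "c < r" "i < k" for c i
    by (rule DERIV_isCont[OF F_DERIV[OF assms(1,2) that]])
  ultimately show ?thesis
    unfolding dF_def K_def using assms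
    by (intro continuous_sum continuous_mult continuous_diff continuous_const) auto
qed

text \<open>A direction \<open>u\<close> enters only through its inner products with the columns of
  \<open>V\<close>. For \<open>u\<close> a column of \<open>V\<close> one term survives; for
  \<open>u\<close> orthogonal to all of them the derivative of \<open>F\<close> vanishes, which
  stands in for independence of the two projections of the sketch.\<close>

lemma sum_dF: "(\<Sum>a<d. u a * dF a b c i x) = (\<Sum>m<k. (\<Sum>a<d. u a * V $$ (a, m)) * K c b i m x)"
proof -
  have "(\<Sum>a<d. u a * dF a b c i x) = (\<Sum>a<d. \<Sum>m<k. u a * V $$ (a, m) * K c b i m x)"
    by (simp add: dF_def sum_distrib_left mult.assoc)
  also have "\<dots> = (\<Sum>m<k. \<Sum>a<d. u a * V $$ (a, m) * K c b i m x)" by (rule sum.swap)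
  finally show ?thesis by (simp add: sum_distrib_right)
qed

section \<open>Expectations by integration by parts\<close>

text \<open>The direction is column \<open>i\<close> of \<open>V\<close>, whose linear form is the
  entry of \<open>G\<close>.\<close>

lemma expectation_GF:
  assumes "b < r" "i < k"
  shows "(\<integral>x. G x $$ (i, b) * F x $$ (b, i) \<partial>gaussian I) = (\<integral>x. K b b i i x \<partial>gaussian I)"
proof -
  have s: "(\<Sum>a<d. V $$ (a, i) * dF a b b i x) = K b b i i x" for x
  proof -
    have "(\<Sum>a<d. V $$ (a, i) * dF a b b i x) = (\<Sum>m<k. if m = i then K b b i m x else 0)"
      unfolding sum_dF using assms(2) by (intro sum.cong refl) (simp add: V_orthonormal)
    then show ?thesis using assms(2) by simp
  qed
  have "(\<integral>x. (\<Sum>a<d. V $$ (a, i) * x (a, b)) * F x $$ (b, i) \<partial>gaussian I)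
      = (\<integral>x. (\<Sum>a<d. V $$ (a, i) * dF a b b i x) \<partial>gaussian I)"
    using assms
    by (intro stein_gaussian_direction F_measurable dF_measurable F_DERIV dF_isCont
        growth_mono[OF F_growth] growth_mono[OF dF_growth]) auto
  then show ?thesis unfolding s using assms by (simp add: G_index)
qed

text \<open>Written out, the double sum is \<open>r\<close> minus the trace of \<open>F * G\<close>,
  times \<open>tr x\<close>, minus the squared norm of \<open>F x\<close>. The trace of
  \<open>F * G\<close> is at most \<open>k\<close>, and the norm costs one further copy of
  \<open>tr x\<close>: hence \<open>r - k - 1\<close>.\<close>

lemma sum_K_ge:
  assumes "k \<le> r"
  shows "(real r - real k - 1) * tr x \<le> (\<Sum>i<k. \<Sum>b<r. K b b i i x)"
proof -
  define Q where "Q = (\<Sum>b<r. \<Sum>l<k. F x $$ (b, l) * G x $$ (l, b))"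
  have Q: "Q = real k - \<delta> * tr x"
  proof -
    have "Q = (\<Sum>l<k. \<Sum>b<r. F x $$ (b, l) * G x $$ (l, b))" unfolding Q_def by (rule sum.swap)
    then show ?thesis using sum_GF[of x] by (simp add: mult.commute)
  qed
  have "(\<Sum>i<k. \<Sum>b<r. K b b i i x)
      = (\<Sum>i<k. (\<Sum>b<r. (1 - (\<Sum>l<k. F x $$ (b, l) * G x $$ (l, b))) * R x $$ (i, i)) - (\<Sum>b<r. (F x $$ (b, i))\<^sup>2))"
    by (simp add: K_def sum_subtractf power2_eq_square)
  also have "\<dots> = (\<Sum>i<k. (real r - Q) * R x $$ (i, i)) - (\<Sum>i<k. \<Sum>b<r. (F x $$ (b, i))\<^sup>2)"
    unfolding Q_def sum_subtractf by (simp add: sum_distrib_right[symmetric] sum_subtractf)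
  also have "(\<Sum>i<k. (real r - Q) * R x $$ (i, i)) = (real r - Q) * tr x"
    by (simp add: tr_sum sum_distrib_left)
  also have "(\<Sum>i<k. \<Sum>b<r. (F x $$ (b, i))\<^sup>2) = (\<Sum>b<r. \<Sum>i<k. (F x $$ (b, i))\<^sup>2)" by (rule sum.swap)
  also have "\<dots> = fip (F x) (F x)"
    using fip_carrier[OF F_carrier, of x "F x"] by (simp add: power2_eq_square)
  finally have eq: "(\<Sum>i<k. \<Sum>b<r. K b b i i x) = (real r - Q) * tr x - fip (F x) (F x)" .
  have "(real r - real k) * tr x \<le> (real r - Q) * tr x"
    unfolding Q using tr_nonneg[of x] \<delta> by (intro mult_right_mono) auto
  then show ?thesis unfolding eq using fip_F_le[of x] by (simp add: algebra_simps)
qed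

lemma tr_integrable: "integrable (gaussian I) tr"
proof (rule growth_integrable[OF finite_I])
  show "tr \<in> borel_measurable (gaussian I)"
    unfolding tr_sum[abs_def] by (intro borel_measurable_sum R_measurable) auto
  show "growth I 0 tr"
    unfolding tr_sum[abs_def] by (intro growth_sum R_growth) auto
qed

text \<open>Summed over \<open>i\<close> and \<open>b\<close>, one side of
  \<open>expectation_GF\<close> is the expectation of \<open>k - \<delta> * tr x\<close>, the other
  is bounded below by \<open>sum_K_ge\<close>. For \<open>r > k + 1\<close> the resulting bound k /
  (r - k - 1) is the mean trace of an inverse Wishart matrix.\<close>

lemma expectation_tr:
  assumes "k \<le> r"
  shows "(real r - real k - 1) * (\<integral>x. tr x \<partial>gaussian I) \<le> real k"
proof -
  interpret P: prob_space "gaussian I" by (rule prob_space_gaussian)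
  have iK: "integrable (gaussian I) (K b b i i)" if "b < r" "i < k" for b i
    using that by (intro growth_integrable[OF finite_I K_measurable K_growth])
  have iGF: "integrable (gaussian I) (\<lambda>x. G x $$ (i, b) * F x $$ (b, i))" if "b < r" "i < k" for b i
    using that by (intro growth_integrable[OF finite_I borel_measurable_times[OF G_measurable F_measurable]
        growth_mult[OF G_growth F_growth]])
  have "(real r - real k - 1) * (\<integral>x. tr x \<partial>gaussian I)
      = (\<integral>x. (real r - real k - 1) * tr x \<partial>gaussian I)" by simp
  also have "\<dots> \<le> (\<integral>x. (\<Sum>i<k. \<Sum>b<r. K b b i i x) \<partial>gaussian I)"
    using sum_K_ge[OF assms] tr_integrable
    by (intro integral_mono integral_double_sum(1)[OF iK] integrable_mult_right) auto
  also have "\<dots> = (\<Sum>i<k. \<Sum>b<r. \<integral>x. K b b i i x \<partial>gaussian I)"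
    by (rule integral_double_sum(2)[OF iK])
  also have "\<dots> = (\<Sum>i<k. \<Sum>b<r. \<integral>x. G x $$ (i, b) * F x $$ (b, i) \<partial>gaussian I)"
    by (intro sum.cong refl expectation_GF[symmetric]) auto
  also have "\<dots> = (\<integral>x. (\<Sum>i<k. \<Sum>b<r. G x $$ (i, b) * F x $$ (b, i)) \<partial>gaussian I)"
    by (rule integral_double_sum(2)[OF iGF, symmetric])
  also have "\<dots> = (\<integral>x. real k - \<delta> * tr x \<partial>gaussian I)" unfolding sum_GF ..
  also have "\<dots> \<le> (\<integral>x. real k \<partial>gaussian I)"
    using tr_nonneg \<delta> tr_integrable
    by (intro integral_mono Bochner_Integration.integrable_diff integrable_mult_right) auto
  also have "\<dots> = real k" by (simp add: P.prob_space)
  finally show ?thesis .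
qed

text \<open>The linear form for column \<open>b'\<close> is made part of the differentiated
  function. Since \<open>e\<close> is orthogonal to \<open>V\<close>, the derivatives of
  \<open>F\<close> contribute nothing; only the derivative of that linear form remains, and it is
  nonzero for \<open>b' = b\<close> alone.\<close>

lemma expectation_row:
  assumes e: "\<And>m. m < k \<Longrightarrow> (\<Sum>a<d. e a * V $$ (a, m)) = 0" and b: "b < r" "b' < r" and i: "i < k"
  shows "(\<integral>x. (\<Sum>a<d. e a * x (a, b)) * ((\<Sum>a<d. e a * x (a, b')) * (F x $$ (b, i) * F x $$ (b', i))) \<partial>gaussian I)
    = (if b' = b then (\<Sum>a<d. (e a)\<^sup>2) * (\<integral>x. (F x $$ (b, i))\<^sup>2 \<partial>gaussian I) else 0)"
proof -
  define z where "z x = (\<Sum>a<d. e a * x (a, b'))" for x :: "nat \<times> nat \<Rightarrow> real"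
  define f' where "f' a x = (if b' = b then e a else 0) * (F x $$ (b, i) * F x $$ (b', i))
      + (dF a b b i x * F x $$ (b', i) + dF a b b' i x * F x $$ (b, i)) * z x" for a x
  have zm: "z \<in> borel_measurable (gaussian I)"
    unfolding z_def[abs_def]
    by (intro borel_measurable_sum borel_measurable_times borel_measurable_const coordinate_measurable)
      (use b in auto)
  have zg: "growth I 1 z"
    unfolding z_def[abs_def] by (intro growth_sum growth_cmult growth_coordinate finite_I) (use b in auto)
  have zd: "((\<lambda>t. z (x((a, b) := t))) has_real_derivative (if b' = b then e a else 0)) (at s)"
    if "a < d" for a x s
  proof -
    have "((\<lambda>t. \<Sum>a'<d. e a' * (x((a, b) := t)) (a', b')) has_real_derivative
        (\<Sum>a'<d. e a' * (if a' = a \<and> b' = b then 1 else 0))) (at s)"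
      by (intro DERIV_sum DERIV_cmult) auto
    moreover have "(\<Sum>a'<d. e a' * (if a' = a \<and> b' = b then 1 else 0)) = (if b' = b then e a else 0)"
      using that by (auto simp: if_distrib[of "\<lambda>y. _ * y"] cong: if_cong)
    ultimately show ?thesis by (simp add: z_def)
  qed
  have FF: "growth I 0 (\<lambda>x. F x $$ (b, i) * F x $$ (b', i))"
    using growth_mult[OF F_growth[OF b(1) i] F_growth[OF b(2) i]] by simp
  have dFF: "growth I 1 (\<lambda>x. dF a b b i x * F x $$ (b', i) + dF a b b' i x * F x $$ (b, i))" for a
    using growth_mult[OF dF_growth[OF b(1) b(1) i] F_growth[OF b(2) i]]
      growth_mult[OF dF_growth[OF b(1) b(2) i] F_growth[OF b(1) i]]
    by (intro growth_add) simp_all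
  have "(\<integral>x. (\<Sum>a<d. e a * x (a, b)) * (z x * (F x $$ (b, i) * F x $$ (b', i))) \<partial>gaussian I)
      = (\<integral>x. (\<Sum>a<d. e a * f' a x) \<partial>gaussian I)"
  proof (rule stein_gaussian_direction[OF b(1)])
    show "(\<lambda>x. z x * (F x $$ (b, i) * F x $$ (b', i))) \<in> borel_measurable (gaussian I)"
      using b i by (intro borel_measurable_times zm F_measurable)
    show "f' a \<in> borel_measurable (gaussian I)" for a
      unfolding f'_def[abs_def] using b i
      by (intro borel_measurable_add borel_measurable_times borel_measurable_const zm F_measurable dF_measurable)
    show "growth I 2 (\<lambda>x. z x * (F x $$ (b, i) * F x $$ (b', i)))"
      by (rule growth_mono[OF growth_mult[OF zg FF]]) simp
    show "growth I 2 (f' a)" for a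
      unfolding f'_def[abs_def]
      by (intro growth_add growth_mono[OF growth_cmult[OF FF]] growth_mono[OF growth_mult[OF dFF zg]]) simp_all
    fix a x t
    assume a: "a < d"
    show "((\<lambda>t. z (x((a, b) := t)) * (F (x((a, b) := t)) $$ (b, i) * F (x((a, b) := t)) $$ (b', i)))
        has_real_derivative f' a (x((a, b) := t))) (at t)"
      unfolding f'_def using b i a by (intro DERIV_mult zd F_DERIV)
    have "isCont (\<lambda>t. F (x((a, b) := t)) $$ (c, i)) t" if "c < r" for c
      by (rule DERIV_isCont[OF F_DERIV[OF a b(1) that i]])
    then show "isCont (\<lambda>t. f' a (x((a, b) := t))) t"
      unfolding f'_def using a b i DERIV_isCont[OF zd[OF a]]
      by (intro continuous_add continuous_mult continuous_const dF_isCont) auto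
  qed
  also have "(\<lambda>x. \<Sum>a<d. e a * f' a x) = (\<lambda>x. if b' = b then (\<Sum>a<d. (e a)\<^sup>2) * (F x $$ (b, i))\<^sup>2 else 0)"
  proof
    fix x
    have "e a * f' a x = e a * (if b' = b then e a else 0) * (F x $$ (b, i) * F x $$ (b', i))
        + (e a * dF a b b i x) * (F x $$ (b', i) * z x) + (e a * dF a b b' i x) * (F x $$ (b, i) * z x)" for a
      by (simp add: f'_def algebra_simps)
    then have s: "(\<Sum>a<d. e a * f' a x) = (\<Sum>a<d. e a * (if b' = b then e a else 0)) * (F x $$ (b, i) * F x $$ (b', i))
        + (\<Sum>a<d. e a * dF a b b i x) * (F x $$ (b', i) * z x)
        + (\<Sum>a<d. e a * dF a b b' i x) * (F x $$ (b, i) * z x)"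
      by (simp only: sum.distrib sum_distrib_right)
    have "(\<Sum>a<d. e a * dF a b c i x) = 0" for c unfolding sum_dF using e by simp
    with s show "(\<Sum>a<d. e a * f' a x) = (if b' = b then (\<Sum>a<d. (e a)\<^sup>2) * (F x $$ (b, i))\<^sup>2 else 0)"
      by (simp add: power2_eq_square)
  qed
  finally show ?thesis unfolding z_def by simp
qed

text \<open>The square is expanded into pairs of sketch columns, and \<open>expectation_row\<close>
  removes the mixed pairs.\<close>

lemma expectation_row_sq:
  assumes e: "\<And>m. m < k \<Longrightarrow> (\<Sum>a<d. e a * V $$ (a, m)) = 0" and i: "i < k"
  defines "y \<equiv> \<lambda>x. \<Sum>b<r. (\<Sum>a<d. e a * x (a, b)) * F x $$ (b, i)"
  shows "integrable (gaussian I) (\<lambda>x. (y x)\<^sup>2)"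
    and "(\<integral>x. (y x)\<^sup>2 \<partial>gaussian I) = (\<Sum>a<d. (e a)\<^sup>2) * (\<Sum>b<r. \<integral>x. (F x $$ (b, i))\<^sup>2 \<partial>gaussian I)"
proof -
  define z where "z b x = (\<Sum>a<d. e a * x (a, b))" for b and x :: "nat \<times> nat \<Rightarrow> real"
  have zm: "z b \<in> borel_measurable (gaussian I)" if "b < r" for b
    unfolding z_def[abs_def]
    by (intro borel_measurable_sum borel_measurable_times borel_measurable_const coordinate_measurable)
      (use that in auto)
  have zg: "growth I 1 (z b)" if "b < r" for b
    unfolding z_def[abs_def] by (intro growth_sum growth_cmult growth_coordinate finite_I) (use that in auto)
  have sq: "(y x)\<^sup>2 = (\<Sum>b<r. \<Sum>b'<r. z b x * (z b' x * (F x $$ (b, i) * F x $$ (b', i))))" for x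
    unfolding y_def power2_eq_square sum_product z_def by (intro sum.cong refl) (simp add: mult_ac)
  have int: "integrable (gaussian I) (\<lambda>x. z b x * (z b' x * (F x $$ (b, i) * F x $$ (b', i))))"
    if "b < r" "b' < r" for b b'
    using that i by (intro growth_integrable[OF finite_I borel_measurable_times[OF zm
        borel_measurable_times[OF zm borel_measurable_times[OF F_measurable F_measurable]]]
        growth_mult[OF zg growth_mult[OF zg growth_mult[OF F_growth F_growth]]]])
  show "integrable (gaussian I) (\<lambda>x. (y x)\<^sup>2)"
    unfolding sq by (rule integral_double_sum(1)[OF int])
  have "(\<integral>x. (y x)\<^sup>2 \<partial>gaussian I)
      = (\<Sum>b<r. \<Sum>b'<r. \<integral>x. z b x * (z b' x * (F x $$ (b, i) * F x $$ (b', i))) \<partial>gaussian I)"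
    unfolding sq by (rule integral_double_sum(2)[OF int])
  also have "\<dots> = (\<Sum>b<r. \<Sum>b'<r. if b' = b then (\<Sum>a<d. (e a)\<^sup>2) * (\<integral>x. (F x $$ (b, i))\<^sup>2 \<partial>gaussian I) else 0)"
    unfolding z_def using expectation_row[OF e _ _ i] by (intro sum.cong refl) auto
  finally show "(\<integral>x. (y x)\<^sup>2 \<partial>gaussian I) = (\<Sum>a<d. (e a)\<^sup>2) * (\<Sum>b<r. \<integral>x. (F x $$ (b, i))\<^sup>2 \<partial>gaussian I)"
    by (simp add: sum_distrib_left)
qed

lemma F_sq_integrable: "b < r \<Longrightarrow> i < k \<Longrightarrow> integrable (gaussian I) (\<lambda>x. (F x $$ (b, i))\<^sup>2)"
  unfolding power2_eq_square
  by (intro growth_integrable[OF finite_I borel_measurable_times[OF F_measurable F_measurable]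
      growth_mult[OF F_growth F_growth]])

text \<open>The entries of the product are the sums of \<open>expectation_row_sq\<close> with
  \<open>e\<close> a row of \<open>E\<close>. Replacing the squared norm of \<open>F x\<close> by
  the trace leaves a single expectation to control.\<close>

lemma expectation_error:
  assumes E: "E \<in> carrier_mat n d" and EV: "E * V = 0\<^sub>m n k"
  defines "Y \<equiv> \<lambda>x. fip (E * Matrix.mat d r x * F x) (E * Matrix.mat d r x * F x)"
  shows "integrable (gaussian I) Y"
    and "(\<integral>x. Y x \<partial>gaussian I) \<le> fip E E * (\<integral>x. tr x \<partial>gaussian I)"
proof -
  let ?y = "\<lambda>c i x. \<Sum>b<r. (\<Sum>a<d. E $$ (c, a) * x (a, b)) * F x $$ (b, i)"
  have e: "(\<Sum>a<d. E $$ (c, a) * V $$ (a, m)) = 0" if "c < n" "m < k" for c m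
  proof -
    have "(\<Sum>a<d. E $$ (c, a) * V $$ (a, m)) = (E * V) $$ (c, m)"
      using index_mult_sum[OF E V(1) that] by simp
    then show ?thesis unfolding EV using that by simp
  qed
  have Y: "Y x = (\<Sum>c<n. \<Sum>i<k. (?y c i x)\<^sup>2)" for x
  proof -
    have EX: "E * Matrix.mat d r x \<in> carrier_mat n r" using E by simp
    have EXF: "E * Matrix.mat d r x * F x \<in> carrier_mat n k"
      using carrier_matD[OF E] carrier_matD[OF F_carrier[of x]] by simp
    have "(E * Matrix.mat d r x * F x) $$ (c, i) = ?y c i x" if "c < n" "i < k" for c i
    proof -
      have "(E * Matrix.mat d r x * F x) $$ (c, i) = (\<Sum>b<r. (E * Matrix.mat d r x) $$ (c, b) * F x $$ (b, i))"
        by (rule index_mult_sum[OF EX F_carrier that])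
      also have "\<dots> = ?y c i x"
        using index_mult_sum[OF E _ that(1), of "Matrix.mat d r x" r] by (intro sum.cong refl) simp
      finally show ?thesis .
    qed
    then show ?thesis unfolding Y_def fip_carrier[OF EXF] by (simp add: power2_eq_square)
  qed
  have int: "integrable (gaussian I) (\<lambda>x. (?y c i x)\<^sup>2)" if "c < n" "i < k" for c i
    by (rule expectation_row_sq(1)[OF e[OF that(1)] that(2)])
  show "integrable (gaussian I) Y"
    unfolding Y[abs_def] by (rule integral_double_sum(1)[OF int])
  have iF: "integrable (gaussian I) (\<lambda>x. fip (F x) (F x))"
    unfolding fip_carrier[OF F_carrier] power2_eq_square[symmetric]
    by (rule integral_double_sum(1)[OF F_sq_integrable])
  have "(\<integral>x. Y x \<partial>gaussian I) = (\<Sum>c<n. \<Sum>i<k. \<integral>x. (?y c i x)\<^sup>2 \<partial>gaussian I)"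
    unfolding Y by (rule integral_double_sum(2)[OF int])
  also have "\<dots> = (\<Sum>c<n. \<Sum>i<k. (\<Sum>a<d. (E $$ (c, a))\<^sup>2) * (\<Sum>b<r. \<integral>x. (F x $$ (b, i))\<^sup>2 \<partial>gaussian I))"
    using e by (intro sum.cong refl expectation_row_sq(2)) auto
  also have "\<dots> = (\<Sum>c<n. \<Sum>a<d. (E $$ (c, a))\<^sup>2) * (\<Sum>i<k. \<Sum>b<r. \<integral>x. (F x $$ (b, i))\<^sup>2 \<partial>gaussian I)"
    by (simp only: sum_distrib_left[symmetric] sum_distrib_right[symmetric])
  also have "(\<Sum>c<n. \<Sum>a<d. (E $$ (c, a))\<^sup>2) = fip E E"
    using fip_carrier[OF E, of E] by (simp add: power2_eq_square)
  also have "(\<Sum>i<k. \<Sum>b<r. \<integral>x. (F x $$ (b, i))\<^sup>2 \<partial>gaussian I)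
      = (\<Sum>b<r. \<Sum>i<k. \<integral>x. (F x $$ (b, i))\<^sup>2 \<partial>gaussian I)" by (rule sum.swap)
  also have "\<dots> = (\<integral>x. fip (F x) (F x) \<partial>gaussian I)"
    unfolding fip_carrier[OF F_carrier] power2_eq_square[symmetric]
    by (rule integral_double_sum(2)[OF F_sq_integrable, symmetric])
  also have "fip E E * \<dots> \<le> fip E E * (\<integral>x. tr x \<partial>gaussian I)"
    using iF tr_integrable fip_F_le by (intro mult_left_mono integral_mono fip_nonneg) auto
  finally show "(\<integral>x. Y x \<partial>gaussian I) \<le> fip E E * (\<integral>x. tr x \<partial>gaussian I)" .
qed

end

section \<open>Invertibility of the sketch and the good event\<close>

lemma fip_mult_le:
  assumes A: "A \<in> carrier_mat n m" and B: "B \<in> carrier_mat m p"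
  shows "fip (A * B) (A * B) \<le> fip A A * fip B B"
proof -
  have "fip (A * B) (A * B) = (\<Sum>i<n. \<Sum>j<p. (\<Sum>l<m. A $$ (i, l) * B $$ (l, j))\<^sup>2)"
    using fip_carrier[OF mult_carrier_mat[OF A B], of "A * B"] index_mult_sum[OF A B]
    by (simp add: power2_eq_square)
  also have "\<dots> \<le> (\<Sum>i<n. \<Sum>j<p. (\<Sum>l<m. (A $$ (i, l))\<^sup>2) * (\<Sum>l<m. (B $$ (l, j))\<^sup>2))"
    by (intro sum_mono Cauchy_Schwarz_ineq_sum)
  also have "\<dots> = (\<Sum>i<n. \<Sum>l<m. (A $$ (i, l))\<^sup>2) * (\<Sum>j<p. \<Sum>l<m. (B $$ (l, j))\<^sup>2)"
    by (simp only: sum_product)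
  also have "(\<Sum>j<p. \<Sum>l<m. (B $$ (l, j))\<^sup>2) = (\<Sum>l<m. \<Sum>j<p. (B $$ (l, j))\<^sup>2)" by (rule sum.swap)
  finally show ?thesis
    using fip_carrier[OF A, of A] fip_carrier[OF B, of B] by (simp add: power2_eq_square)
qed

text \<open>A kernel vector satisfies \<open>u = - N * u\<close>, so its squared norm is at most
  \<open>fip N N < 1\<close> times itself; hence the determinant is nonzero.\<close>

lemma right_inverse_near_one:
  fixes N :: "real mat"
  assumes N: "N \<in> carrier_mat k k" and small: "fip N N < 1"
  obtains L where "L \<in> carrier_mat k k" "(1\<^sub>m k + N) * L = 1\<^sub>m k"
proof -
  let ?M = "1\<^sub>m k + N"
  have M: "?M \<in> carrier_mat k k" using N by simp
  have "det ?M \<noteq> 0"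
  proof
    assume "det ?M = 0"
    then obtain v where v: "v \<in> carrier_vec k" "v \<noteq> 0\<^sub>v k" "?M *\<^sub>v v = 0\<^sub>v k"
      using det_0_iff_vec_prod_zero[OF M] by auto
    define u where "u = mat_of_cols k [v]"
    have u: "u \<in> carrier_mat k 1" using mat_of_cols_carrier(1)[of k "[v]"] by (simp add: u_def)
    have colu: "col u 0 = v" using v by (simp add: u_def)
    have Mu: "?M * u = 0\<^sub>m k 1"
    proof (rule eq_matI)
      fix i j assume "i < dim_row (0\<^sub>m k 1 :: real mat)" "j < dim_col (0\<^sub>m k 1 :: real mat)"
      then have ij: "i < k" "j = 0" by auto
      have "(?M * u) $$ (i, j) = (?M *\<^sub>v v) $ i"
        using ij u carrier_matD[OF N] colu by (simp del: index_add_mat(1))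
      then show "(?M * u) $$ (i, j) = 0\<^sub>m k 1 $$ (i, j)" using v ij by simp
    qed (use u N in auto)
    have Nu: "N * u \<in> carrier_mat k 1" using N u by simp
    have "?M * u = 1\<^sub>m k * u + N * u" using N u by (intro add_mult_distrib_mat) auto
    then have z: "u + N * u = 0\<^sub>m k 1" using Mu u by simp
    have "u = (-1) \<cdot>\<^sub>m X" if "X \<in> carrier_mat k 1" "u + X = 0\<^sub>m k 1" for X
    proof (rule eq_matI)
      fix i j assume "i < dim_row ((-1) \<cdot>\<^sub>m X)" "j < dim_col ((-1) \<cdot>\<^sub>m X)"
      then have ij: "i < k" "j < 1" using that(1) by auto
      have "(u + X) $$ (i, j) = 0" unfolding that(2) using ij by simp
      then show "u $$ (i, j) = ((-1) \<cdot>\<^sub>m X) $$ (i, j)" using ij that(1) u by simp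
    qed (use u that in auto)
    from this[OF Nu z] have uN: "u = (-1) \<cdot>\<^sub>m (N * u)" .
    have "fip u u = fip ((-1) \<cdot>\<^sub>m (N * u)) ((-1) \<cdot>\<^sub>m (N * u))" using uN by simp
    also have "\<dots> = - fip (N * u) ((-1) \<cdot>\<^sub>m (N * u))" by (simp only: fip_smult_left mult_minus1 minus_minus)
    also have "\<dots> = - fip ((-1) \<cdot>\<^sub>m (N * u)) (N * u)" using fip_sym[OF Nu, of "(-1) \<cdot>\<^sub>m (N * u)"] Nu by simp
    also have "\<dots> = fip (N * u) (N * u)" by (simp only: fip_smult_left mult_minus1 minus_minus)
    also have "\<dots> \<le> fip N N * fip u u" by (rule fip_mult_le[OF N u])
    finally have "(1 - fip N N) * fip u u \<le> 0" by (simp add: algebra_simps)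
    then have "fip u u \<le> 0" using small by (simp add: mult_le_0_iff)
    then have "u = 0\<^sub>m k 1" using fip_self_eq_0[OF u] fip_nonneg[of u] by simp
    then have "v = 0\<^sub>v k" using colu by auto
    with v(2) show False ..
  qed
  moreover define L where "L = (1 / det ?M) \<cdot>\<^sub>m adj_mat ?M"
  ultimately have "?M * L = (1 / det ?M) \<cdot>\<^sub>m (?M * adj_mat ?M)"
    unfolding L_def by (intro mult_smult_distrib[OF M adj_mat(1)[OF M]])
  also have "\<dots> = 1\<^sub>m k" unfolding adj_mat(2)[OF M] using \<open>det ?M \<noteq> 0\<close> by (intro eq_matI) auto
  finally show thesis using that[of L] adj_mat(1)[OF M] by (simp add: L_def)
qed

context ridge
begin

text \<open>By \<open>GF\<close>, the product \<open>G x * F x\<close> differs from the identity by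
  a matrix of squared norm at most \<open>\<delta> * tr x\<close>. The exact inverse serves where
  the bias of \<open>F\<close> is not affordable, and for the rank of the projected matrix.\<close>

lemma G_right_inverse:
  assumes "\<delta> * tr x < 1"
  obtains L where "L \<in> carrier_mat r k" "G x * L = 1\<^sub>m k"
proof -
  let ?N = "(- \<delta>) \<cdot>\<^sub>m R x"
  have N: "?N \<in> carrier_mat k k" using R_carrier[of x] by simp
  have "fip ?N ?N = \<delta> * (\<delta> * fip (R x) (R x))"
    using fip_sym[OF R_carrier[of x] N] by (simp add: fip_smult_left)
  also have "\<dots> \<le> \<delta> * tr x" using fip_R_le[of x] \<delta> by (intro mult_left_mono) auto
  finally have "fip ?N ?N < 1" using assms by simp
  from right_inverse_near_one[OF N this] obtain L where L: "L \<in> carrier_mat k k" "(1\<^sub>m k + ?N) * L = 1\<^sub>m k" .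
  have "G x * (F x * L) = 1\<^sub>m k"
    using assoc_mult_mat[OF G_carrier F_carrier L(1), of x x] L(2) unfolding GF by simp
  then show thesis using that[of "F x * L"] carrier_matD[OF F_carrier[of x]] L(1) by simp
qed

text \<open>Both expectations are at most a tenth of their thresholds, so two failure sets of
  probability at most 1/10 are removed.\<close>

lemma good_event:
  assumes E: "E \<in> carrier_mat n d" "E * V = 0\<^sub>m n k" and \<epsilon>: "0 < \<epsilon>"
    and k: "1 \<le> k" and r: "sketch_size k \<epsilon> \<le> r"
  defines "Y \<equiv> \<lambda>x. fip (E * Matrix.mat d r x * F x) (E * Matrix.mat d r x * F x)"
  obtains S where "S \<in> sets (gaussian I)" "7 / 10 \<le> measure (gaussian I) S"
    "\<And>x. x \<in> S \<Longrightarrow> tr x \<le> \<epsilon>" "\<And>x. x \<in> S \<Longrightarrow> Y x \<le> \<epsilon> * fip E E"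
proof -
  interpret P: prob_space "gaussian I" by (rule prob_space_gaussian)
  \<comment> \<open>The \<open>+ 1\<close> under the ceiling in \<open>sketch_size\<close> pays for
    the 1 in \<open>r - k - 1\<close>.\<close>
  have "10 * real k / \<epsilon> + 1 \<le> real (nat \<lceil>10 * real k / \<epsilon> + 1\<rceil>)" by linarith
  then have rk: "10 * real k / \<epsilon> \<le> real r - real k - 1"
    using r unfolding sketch_size_def by linarith
  have pos: "0 < 10 * real k / \<epsilon>" using k \<epsilon> by simp
  have kr: "k \<le> r" using r by (simp add: sketch_size_def)
  let ?t = "\<integral>x. tr x \<partial>gaussian I"
  have t0: "0 \<le> ?t" using tr_nonneg by simp
  have "10 * real k / \<epsilon> * ?t \<le> (real r - real k - 1) * ?t" using rk t0 by (rule mult_right_mono)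
  also have "\<dots> \<le> real k" by (rule expectation_tr[OF kr])
  finally have t: "?t \<le> \<epsilon> / 10" using k \<epsilon> by (simp add: field_simps)
  define S1 where "S1 = {x \<in> space (gaussian I). \<epsilon> \<le> tr x}"
  have trm: "tr \<in> borel_measurable (gaussian I)" using tr_integrable by (rule borel_measurable_integrable)
  have S1: "S1 \<in> sets (gaussian I)" unfolding S1_def using trm by measurable
  have "P.prob S1 \<le> ?t / \<epsilon>"
    unfolding S1_def using tr_integrable tr_nonneg \<epsilon>
    by (intro integral_Markov_inequality_measure[where A = "{}"]) auto
  also have "\<dots> \<le> 1 / 10" using t \<epsilon> by (simp add: field_simps)
  finally have p1: "P.prob S1 \<le> 1 / 10" .
  note Yi = expectation_error(1)[OF E, folded Y_def] and Ye = expectation_error(2)[OF E, folded Y_def]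
  have Y0: "0 \<le> Y x" for x by (simp add: Y_def fip_nonneg)
  obtain S2 where S2: "S2 \<in> sets (gaussian I)" "P.prob S2 \<le> 1 / 10"
    "\<And>x. x \<in> space (gaussian I) \<Longrightarrow> x \<notin> S2 \<Longrightarrow> Y x \<le> \<epsilon> * fip E E"
  proof (cases "fip E E = 0")
    \<comment> \<open>With a zero residual the threshold in Markov's inequality would be 0; here
      \<open>Y\<close> vanishes identically instead.\<close>
    case True
    have "Y x \<le> 0" for x
    proof -
      have X: "Matrix.mat d r x * F x \<in> carrier_mat d k" using carrier_matD[OF F_carrier[of x]] by simp
      have "E * Matrix.mat d r x * F x = E * (Matrix.mat d r x * F x)"
        by (rule assoc_mult_mat[OF E(1) _ F_carrier]) simp
      then have "Y x \<le> fip E E * fip (Matrix.mat d r x * F x) (Matrix.mat d r x * F x)"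
        unfolding Y_def using fip_mult_le[OF E(1) X] by simp
      then show ?thesis using True by simp
    qed
    then show thesis using that[of "{}"] True by simp
  next
    case False
    then have E0: "0 < fip E E" using fip_nonneg[of E] by simp
    define S2 where "S2 = {x \<in> space (gaussian I). \<epsilon> * fip E E \<le> Y x}"
    have "P.prob S2 \<le> (\<integral>x. Y x \<partial>gaussian I) / (\<epsilon> * fip E E)"
      unfolding S2_def using Yi Y0 \<epsilon> E0
      by (intro integral_Markov_inequality_measure[where A = "{}"]) auto
    also have "\<dots> \<le> (fip E E * ?t) / (\<epsilon> * fip E E)"
      using Ye \<epsilon> E0 by (intro divide_right_mono) auto
    also have "\<dots> = ?t / \<epsilon>" using E0 by simp
    also have "\<dots> \<le> 1 / 10" using t \<epsilon> by (simp add: field_simps)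
    finally have p2: "P.prob S2 \<le> 1 / 10" .
    have s2: "S2 \<in> sets (gaussian I)"
      unfolding S2_def using borel_measurable_integrable[OF Yi] by measurable
    have "Y x \<le> \<epsilon> * fip E E" if "x \<in> space (gaussian I)" "x \<notin> S2" for x
      using that unfolding S2_def mem_Collect_eq by linarith
    with s2 p2 show thesis by (rule that)
  qed
  define S where "S = space (gaussian I) - (S1 \<union> S2)"
  have "P.prob (S1 \<union> S2) \<le> 2 / 10"
    using measure_Un_le[OF S1 S2(1)] p1 S2(2) by linarith
  then have "7 / 10 \<le> P.prob S" unfolding S_def using P.prob_compl[of "S1 \<union> S2"] S1 S2(1) by simp
  moreover have "S \<in> sets (gaussian I)" unfolding S_def using S1 S2(1) by simp
  moreover have "tr x \<le> \<epsilon>" "Y x \<le> \<epsilon> * fip E E" if "x \<in> S" for x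
    using that S2(3) by (auto simp: S_def S1_def)
  ultimately show thesis using that by blast
qed

text \<open>
  The approximation \<open>Z = A \<Pi> F V\<^sup>T\<close>. The residual \<open>A - Z\<close> splits into three pairwise orthogonal parts: the
  optimal residual \<open>E\<close>, the image of \<open>E\<close> under the sketch, and the bias of the regularised inverse.
\<close>
lemma sketch_error:
  fixes x :: "nat \<times> nat \<Rightarrow> real"
  assumes U: "U \<in> carrier_mat n k" "U\<^sup>T * U = 1\<^sub>m k" and D: "D \<in> carrier_mat k k"
    and E: "E \<in> carrier_mat n d" "E * V = 0\<^sub>m n k" "U\<^sup>T * E = 0\<^sub>m k d"
    and A: "A = U * D * V\<^sup>T + E"
  defines "X \<equiv> Matrix.mat d r x"
  defines "Z \<equiv> A * X * F x * V\<^sup>T"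
  shows "fip (A - Z) (A - Z) \<le> fip E E + fip (E * X * F x) (E * X * F x) + \<delta> * fip D D * tr x"
proof -
  have X: "X \<in> carrier_mat d r" by (simp add: X_def)
  note Fc = F_carrier[of x] and Rc = R_carrier[of x] and Gc = G_carrier[of x]
  define EXF where "EXF = E * X * F x"
  have EXF: "EXF \<in> carrier_mat n k" using E(1) carrier_matD[OF Fc] by (simp add: EXF_def)
  have UD: "U * D \<in> carrier_mat n k" using U D by simp
  have UDV: "U * D * V\<^sup>T \<in> carrier_mat n d" using U V by simp
  have DR: "D * R x \<in> carrier_mat k k" using D carrier_matD[OF Rc] by simp
  \<comment> \<open>The bias: the defect of \<open>G x * F x\<close> from the identity, carried by
    \<open>U * D\<close>.\<close>
  define N where "N = (- \<delta>) \<cdot>\<^sub>m (U * (D * R x))"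
  have URD: "U * (D * R x) \<in> carrier_mat n k" using U(1) carrier_matD[OF DR] by simp
  have N: "N \<in> carrier_mat n k" using URD by (simp add: N_def)
  have Ac: "A \<in> carrier_mat n d" using A UDV E(1) by simp
  have "A * X * F x = U * D * V\<^sup>T * X * F x + EXF"
  proof -
    have "A * X = U * D * V\<^sup>T * X + E * X" unfolding A using UDV E(1) X by (intro add_mult_distrib_mat)
    moreover have "U * D * V\<^sup>T * X \<in> carrier_mat n r" "E * X \<in> carrier_mat n r"
      using UDV E(1) X U(1) by auto
    ultimately show ?thesis unfolding EXF_def using Fc by (simp add: add_mult_distrib_mat)
  qed
  also have "U * D * V\<^sup>T * X * F x = U * D * (G x * F x)"
  proof -
    have "U * D * V\<^sup>T * X = U * D * G x"
      unfolding G_def X_def[symmetric] using assoc_mult_mat[OF UD _ X, of "V\<^sup>T"] V(1) by simp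
    then show ?thesis using assoc_mult_mat[OF UD Gc Fc] by simp
  qed
  also have "U * D * (G x * F x) = U * D + N"
  proof -
    have "U * D * (1\<^sub>m k + (- \<delta>) \<cdot>\<^sub>m R x) = U * D * 1\<^sub>m k + U * D * ((- \<delta>) \<cdot>\<^sub>m R x)"
      using UD Rc by (intro mult_add_distrib_mat) auto
    also have "U * D * ((- \<delta>) \<cdot>\<^sub>m R x) = (- \<delta>) \<cdot>\<^sub>m (U * D * R x)" by (rule mult_smult_distrib[OF UD Rc])
    also have "U * D * R x = U * (D * R x)" by (rule assoc_mult_mat[OF U(1) D Rc])
    finally show ?thesis unfolding GF N_def using UD by simp
  qed
  finally have AXF: "A * X * F x = U * D + N + EXF" .
  define Pm where "Pm = N + EXF"
  have P: "Pm \<in> carrier_mat n k" using N EXF by (simp add: Pm_def)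
  have "U * D + N + EXF = U * D + Pm" unfolding Pm_def using UD N EXF by simp
  then have Z: "Z = U * D * V\<^sup>T + Pm * V\<^sup>T"
    unfolding Z_def AXF using add_mult_distrib_mat[OF UD P, of "V\<^sup>T" d] V(1) by simp
  have PV: "Pm * V\<^sup>T \<in> carrier_mat n d" using P V(1) by simp
  have "S + E' - (S + T) = E' + (-1) \<cdot>\<^sub>m T"
    if "S \<in> carrier_mat n d" "E' \<in> carrier_mat n d" "T \<in> carrier_mat n d" for S E' T :: "real mat"
    using that by (intro eq_matI) auto
  from this[OF UDV E(1) PV] have AZ: "A - Z = E + (-1) \<cdot>\<^sub>m (Pm * V\<^sup>T)" unfolding Z A .
  have "fip (Pm * V\<^sup>T) E = fip Pm (E * V)"
    using fip_mult_right[OF P _ E(1), of "V\<^sup>T"] V(1) by simp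
  also have "\<dots> = 0" unfolding E(2) using fip_sym[OF P, of "0\<^sub>m n k"] by (simp add: fip_def)
  finally have PE: "fip (Pm * V\<^sup>T) E = 0" .
  have sm: "fip ((-1) \<cdot>\<^sub>m T) ((-1) \<cdot>\<^sub>m T) = fip T T" if "T \<in> carrier_mat n d" for T
    using fip_sym[OF that, of "(-1) \<cdot>\<^sub>m T"] that by (simp add: fip_smult_left)
  have mPV: "(-1) \<cdot>\<^sub>m (Pm * V\<^sup>T) \<in> carrier_mat n d" using PV by simp
  have "fip E ((-1) \<cdot>\<^sub>m (Pm * V\<^sup>T)) = 0"
    using fip_sym[OF E(1) mPV] PE by (simp add: fip_smult_left)
  from fip_add_self[OF E(1) mPV this] have "fip (A - Z) (A - Z) = fip E E + fip (Pm * V\<^sup>T) (Pm * V\<^sup>T)"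
    unfolding AZ sm[OF PV] .
  also have "fip (Pm * V\<^sup>T) (Pm * V\<^sup>T) = fip Pm Pm" by (rule fip_isometry_right[OF V P P])
  also have "fip Pm Pm = fip N N + fip EXF EXF"
    unfolding Pm_def
  proof (rule fip_add_self[OF N EXF])
    \<comment> \<open>The columns of \<open>N\<close> lie in the range of \<open>U\<close>, to which
      those of \<open>EXF\<close> are orthogonal.\<close>
    have UEXF: "U\<^sup>T * EXF = 0\<^sub>m k k"
    proof -
      have "EXF = E * (X * F x)" unfolding EXF_def by (rule assoc_mult_mat[OF E(1) X Fc])
      moreover have "X * F x \<in> carrier_mat d k" using X carrier_matD[OF Fc] by simp
      ultimately have "U\<^sup>T * EXF = U\<^sup>T * E * (X * F x)"
        using assoc_mult_mat[OF _ E(1), of "U\<^sup>T" k "X * F x" k] U(1) by simp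
      then show ?thesis unfolding E(3) using \<open>X * F x \<in> carrier_mat d k\<close> by simp
    qed
    have "fip (U * (D * R x)) EXF = fip (D * R x) (U\<^sup>T * EXF)" by (rule fip_mult_left[OF U(1) DR EXF])
    also have "\<dots> = 0" unfolding UEXF using fip_sym[OF DR, of "0\<^sub>m k k"] by (simp add: fip_def)
    finally show "fip N EXF = 0" by (simp add: N_def fip_smult_left)
  qed
  also have "fip N N = \<delta> * (\<delta> * fip (D * R x) (D * R x))"
  proof -
    have "fip N N = - \<delta> * fip N (U * (D * R x))"
      using fip_sym[OF URD N] by (simp add: N_def fip_smult_left)
    also have "fip N (U * (D * R x)) = - \<delta> * fip (D * R x) (D * R x)"
      using fip_isometry[OF U DR DR] by (simp add: N_def fip_smult_left)
    finally show ?thesis by simp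
  qed
  also have "\<dots> \<le> \<delta> * (\<delta> * (fip D D * fip (R x) (R x)))"
    using fip_mult_le[OF D Rc] \<delta> by (intro mult_left_mono) auto
  \<comment> \<open>One factor \<open>\<delta>\<close> is used up by \<open>fip_R_le\<close>; the
    other survives and makes the bias small.\<close>
  also have "\<dots> = \<delta> * fip D D * (\<delta> * fip (R x) (R x))" by simp
  also have "\<dots> \<le> \<delta> * fip D D * tr x"
    using fip_R_le[of x] \<delta> fip_nonneg[of D] by (intro mult_left_mono) auto
  finally show ?thesis by (simp add: EXF_def)
qed

end

section \<open>Correctness and running time\<close>

lemma steps_mult_timed: "steps (mult_timed A B) = dim_row A * (dim_col B * (2 * dim_col A + 1))"
  by (simp add: mult_timed_def)

lemma result_mult_timed:
  assumes "dim_col A = dim_row B"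
  shows "result (mult_timed A B) = A * B"
  using assms by (intro eq_matI) (auto simp: mult_timed_def scalar_prod_def atLeast0LessThan)

text \<open>The basis has as many columns as the rank of \<open>B\<close>, hence at most
  \<open>r\<close>; this lets costs be stated in terms of \<open>r\<close>.\<close>

lemma orthonormal_basis_routineD:
  assumes "orthonormal_basis_routine orth" "B \<in> carrier_mat n r" "0 < n"
  obtains q where "result (orth B) \<in> carrier_mat n q"
    "(result (orth B))\<^sup>T * result (orth B) = 1\<^sub>m q"
    "mat_col_space (result (orth B)) = mat_col_space B" "q \<le> r"
proof -
  define Q where "Q = result (orth B)"
  have Q: "dim_row Q = n" "Q\<^sup>T * Q = 1\<^sub>m (dim_col Q)" "mat_col_space Q = mat_col_space B"
    using assms unfolding orthonormal_basis_routine_def Let_def Q_def by blast+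
  have Qc: "Q \<in> carrier_mat n (dim_col Q)" using Q(1) by auto
  have "dim_col Q = mat_rank B"
    using rank_orthonormal[OF Qc Q(2)] rank_eq_of_col_space_eq[OF Q(3)] Q(1) assms(2) by simp
  also have "\<dots> \<le> r" using vec_space.rank_le_nc[of B n r] assms(2) by simp
  finally have "dim_col Q \<le> r" .
  then show thesis by (rule that[folded Q_def, OF Qc Q(2,3)])
qed

lemma left_svd_routineD:
  assumes "left_svd_routine lsv" "B \<in> carrier_mat m n"
  obtains s V where "is_svd B (result (lsv B)) s V"
  using assms unfolding left_svd_routine_def by blast

lemma frobenius_lev_result:
  fixes g :: "nat \<Rightarrow> nat \<Rightarrow> real" and k r :: nat
  assumes orth: "orthonormal_basis_routine orth" and lsv: "left_svd_routine lsv"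
    and A: "A \<in> carrier_mat n d" and n: "0 < n"
  defines "B \<equiv> A * Matrix.mat d r (\<lambda>(i, j). g i j)"
  obtains q Q U s V where "Q \<in> carrier_mat n q" "Q\<^sup>T * Q = 1\<^sub>m q" "mat_col_space Q = mat_col_space B"
    "is_svd (Q\<^sup>T * A) U s V"
    "result (frobenius_lev orth lsv A k r g)
      = Matrix.vec n (\<lambda>i. (\<Sum>j<k. ((Q * first_cols k U) $$ (i, j))\<^sup>2) / real k)"
proof -
  have B: "B \<in> carrier_mat n r" using A by (simp add: B_def)
  define Q where "Q = result (orth B)"
  obtain q where Q: "Q \<in> carrier_mat n q" "Q\<^sup>T * Q = 1\<^sub>m q" "mat_col_space Q = mat_col_space B"
    using orthonormal_basis_routineD[OF orth B n] unfolding Q_def by metis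
  define U where "U = result (lsv (Q\<^sup>T * A))"
  have C: "Q\<^sup>T * A \<in> carrier_mat q d" using Q(1) A by simp
  obtain s V where svd: "is_svd (Q\<^sup>T * A) U s V"
    using left_svd_routineD[OF lsv C] unfolding U_def by metis
  have Uc: "first_cols k U \<in> carrier_mat q k" using is_svdD(1)[OF svd C] first_cols_carrier by blast
  have r1: "result (mult_timed A (Matrix.mat d r (\<lambda>(i, j). g i j))) = B"
    using result_mult_timed[of A "Matrix.mat d r (\<lambda>(i, j). g i j)"] A by (simp add: B_def)
  have r2: "result (mult_timed (Q\<^sup>T) A) = Q\<^sup>T * A"
    using result_mult_timed[of "Q\<^sup>T" A] Q(1) A by simp
  have r3: "result (mult_timed Q (first_cols k U)) = Q * first_cols k U"
    using result_mult_timed[of Q "first_cols k U"] Q(1) Uc by simp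
  have dA: "dim_row A = n" "dim_col A = d" using A by auto
  have "result (frobenius_lev orth lsv A k r g)
      = Matrix.vec n (\<lambda>i. (\<Sum>j<k. ((Q * first_cols k U) $$ (i, j))\<^sup>2) / real k)"
    unfolding frobenius_lev_def timed_simps dA result_dot_timed r1 Q_def[symmetric] r2 U_def[symmetric] r3
    by (intro eq_vecI) (simp_all add: power2_eq_square)
  with Q svd that show thesis by blast
qed

text \<open>The argument for one fixed draw. The disjunction in \<open>small\<close> reflects that a
  bias proportional to \<open>\<delta>\<close> can be charged to the optimal error only if that
  error is nonzero.\<close>

lemma frobenius_lev_correct:
  assumes orth: "orthonormal_basis_routine orth" and lsv: "left_svd_routine lsv"
    and A: "A \<in> carrier_mat n d" and k1: "1 \<le> k" and svdA: "is_svd A UA sA VA" and rk: "k \<le> mat_rank A"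
    and \<epsilon>: "0 < \<epsilon>" and small: "0 < \<delta>" "\<delta> * \<epsilon> < 1" "\<delta> * (\<Sum>i<k. (sA $ i)\<^sup>2) \<le> (\<Sum>i=k..<min n d. (sA $ i)\<^sup>2)
      \<or> (\<Sum>i=k..<min n d. (sA $ i)\<^sup>2) = 0"
    and E: "E = A - first_cols k UA * mat_diag k (\<lambda>i. sA $ i) * (first_cols k VA)\<^sup>T"
    and x: "x = (\<lambda>(i, j). g i j)"
    and tr: "ridge.tr d r k (first_cols k VA) \<delta> x \<le> \<epsilon>"
    and Y: "fip (E * Matrix.mat d r x * ridge.F d r k (first_cols k VA) \<delta> x)
        (E * Matrix.mat d r x * ridge.F d r k (first_cols k VA) \<delta> x) \<le> \<epsilon> * fip E E"
  shows "leverage_approx 1 \<epsilon> k A (result (frobenius_lev orth lsv A k r g))"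
proof -
  let ?D = "mat_diag k (\<lambda>i. sA $ i)" and ?D' = "mat_diag k (\<lambda>i. 1 / sA $ i)"
  have kl: "k \<le> min n d" and pos: "\<And>i. i < k \<Longrightarrow> 0 < sA $ i"
    using svd_rank_ge[OF svdA A rk] by auto
  have n: "0 < n" using kl k1 by simp
  define Uk Vk where "Uk = first_cols k UA" and "Vk = first_cols k VA"
  define \<tau> where "\<tau> = (\<Sum>i=k..<min n d. (sA $ i)\<^sup>2)"
  obtain E' where E': "E' \<in> carrier_mat n d" "A = Uk * ?D * Vk\<^sup>T + E'"
      "Uk \<in> carrier_mat n k" "Uk\<^sup>T * Uk = 1\<^sub>m k" "Vk \<in> carrier_mat d k" "Vk\<^sup>T * Vk = 1\<^sub>m k"
      "E' * Vk = 0\<^sub>m n k" "Uk\<^sup>T * E' = 0\<^sub>m k d" "fip E' E' = \<tau>"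
    using svd_split[OF svdA A kl] unfolding Uk_def Vk_def \<tau>_def by metis
  have UDV: "Uk * ?D * Vk\<^sup>T \<in> carrier_mat n d" using E'(3,5) by simp
  have "S + T - S = T" if "S \<in> carrier_mat n d" "T \<in> carrier_mat n d" for S T :: "real mat"
    using that by (intro eq_matI) auto
  from this[OF UDV E'(1)] have EE: "E = E'" unfolding E Uk_def[symmetric] Vk_def[symmetric] E'(2)[symmetric] .
  interpret ridge d r k Vk \<delta> using E'(5,6) small(1) by unfold_locales
  define X where "X = Matrix.mat d r x"
  have X: "X \<in> carrier_mat d r" by (simp add: X_def)
  note tr = tr[folded Vk_def] and Y = Y[folded Vk_def X_def, unfolded EE E'(9)]
  have "\<delta> * tr x \<le> \<delta> * \<epsilon>" using tr small(1) by (intro mult_left_mono) auto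
  then have "\<delta> * tr x < 1" using small(2) by simp
  then obtain L where L: "L \<in> carrier_mat r k" "G x * L = 1\<^sub>m k" by (rule G_right_inverse)
  have VXL: "Vk\<^sup>T * (X * L) = 1\<^sub>m k"
    using L(2) assoc_mult_mat[of "Vk\<^sup>T" k d X r L k] E'(5) X L(1) by (simp add: G_def X_def)
  have XL: "X * L \<in> carrier_mat d k" using X L(1) by simp
  obtain q Q U s V where Q: "Q \<in> carrier_mat n q" "Q\<^sup>T * Q = 1\<^sub>m q" "mat_col_space Q = mat_col_space (A * X)"
    and svdC: "is_svd (Q\<^sup>T * A) U s V"
    and res: "result (frobenius_lev orth lsv A k r g)
      = Matrix.vec n (\<lambda>i. (\<Sum>j<k. ((Q * first_cols k U) $$ (i, j))\<^sup>2) / real k)"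
    using frobenius_lev_result[OF orth lsv A n] unfolding X_def x by metis
  have AX: "A * X \<in> carrier_mat n r" using A X by simp
  obtain Y' where "Y' \<in> carrier_mat q r" "A * X = Q * Y'" using col_space_factor[OF Q(1) AX] Q(3) by auto
  from orthonormal_fix_range[OF Q(1,2) this] have QB: "Q * (Q\<^sup>T * (A * X)) = A * X" .
  have QBT: "Q * (Q\<^sup>T * (A * X * T)) = A * X * T" if T: "T \<in> carrier_mat r m" for T m
  proof -
    have "Q\<^sup>T * (A * X * T) = Q\<^sup>T * (A * X) * T"
      using assoc_mult_mat[of "Q\<^sup>T" q n "A * X" r T m] Q(1) AX T by simp
    then have "Q * (Q\<^sup>T * (A * X * T)) = Q * (Q\<^sup>T * (A * X) * T)" by (rule arg_cong)
    also have "\<dots> = Q * (Q\<^sup>T * (A * X)) * T"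
      using Q(1) carrier_matD[OF AX] T by (intro assoc_mult_mat[symmetric]) auto
    finally show ?thesis unfolding QB .
  qed
  have C: "Q\<^sup>T * A \<in> carrier_mat q d" using Q(1) A by simp
  have AXL: "A * X * L = Uk * ?D + E' * (X * L)"
  proof -
    have "A * X * L = A * (X * L)" by (rule assoc_mult_mat[OF A X L(1)])
    also have "\<dots> = Uk * ?D * Vk\<^sup>T * (X * L) + E' * (X * L)"
      unfolding E'(2) using UDV E'(1) XL by (intro add_mult_distrib_mat)
    also have "Uk * ?D * Vk\<^sup>T * (X * L) = Uk * ?D * (Vk\<^sup>T * (X * L))"
      using assoc_mult_mat[of "Uk * ?D" n k "Vk\<^sup>T" d "X * L" k] E'(3,5) XL by simp
    finally show ?thesis unfolding VXL using right_mult_one_mat[of "Uk * ?D" n k] E'(3) by simp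
  qed
  have UAXL: "Uk\<^sup>T * (A * X * L) = ?D"
  proof -
    have "Uk\<^sup>T * (A * X * L) = Uk\<^sup>T * (Uk * ?D) + Uk\<^sup>T * (E' * (X * L))"
      unfolding AXL using E'(1,3) carrier_matD[OF XL] by (intro mult_add_distrib_mat[of _ k n _ k]) auto
    also have "Uk\<^sup>T * (Uk * ?D) = ?D"
      using assoc_mult_mat[of "Uk\<^sup>T" k n Uk k ?D k] E'(3,4) left_mult_one_mat[OF mat_diag_dim] by simp
    also have "Uk\<^sup>T * (E' * (X * L)) = 0\<^sub>m k k"
      using assoc_mult_mat[of "Uk\<^sup>T" k n E' d "X * L" k] E'(1,3,8) XL by simp
    finally show ?thesis using right_add_zero_mat[OF mat_diag_dim] by simp
  qed
  \<comment> \<open>Since \<open>A * X * L\<close> lies in the range of \<open>Q\<close>, projecting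
    loses nothing of it, and \<open>Uk\<^sup>T\<close> maps it to the invertible diagonal
    \<open>?D\<close>.\<close>
  have rkC: "k \<le> mat_rank (Q\<^sup>T * A)"
  proof (rule rank_ge_of_one_factor[OF _ C])
    show "Uk\<^sup>T * Q \<in> carrier_mat k q" using E'(3) Q(1) by simp
    show N: "X * L * ?D' \<in> carrier_mat d k" using carrier_matD[OF XL] by simp
    have 1: "Q\<^sup>T * A * (X * L * ?D') = Q\<^sup>T * (A * X * (L * ?D'))"
    proof -
      have "X * L * ?D' = X * (L * ?D')" by (rule assoc_mult_mat[OF X L(1) mat_diag_dim])
      moreover have "A * (X * (L * ?D')) = A * X * (L * ?D')"
        using assoc_mult_mat[OF A X, of "L * ?D'" k] L(1) by simp
      ultimately show ?thesis using assoc_mult_mat[of "Q\<^sup>T" q n A d "X * L * ?D'" k] Q(1) A N by simp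
    qed
    have 2: "Q * (Q\<^sup>T * (A * X * (L * ?D'))) = A * X * (L * ?D')" using L(1) by (intro QBT[of _ k]) simp
    have 3: "A * X * (L * ?D') = A * X * L * ?D'" using assoc_mult_mat[OF AX L(1) mat_diag_dim] by simp
    have "Uk\<^sup>T * Q * (Q\<^sup>T * A * (X * L * ?D')) = Uk\<^sup>T * (Q * (Q\<^sup>T * A * (X * L * ?D')))"
      using assoc_mult_mat[of "Uk\<^sup>T" k n Q q "Q\<^sup>T * A * (X * L * ?D')" k] E'(3) Q(1) A N by simp
    also have "\<dots> = Uk\<^sup>T * (A * X * L * ?D')" unfolding 1 2 unfolding 3 ..
    also have "\<dots> = Uk\<^sup>T * (A * X * L) * ?D'"
      using assoc_mult_mat[of "Uk\<^sup>T" k n "A * X * L" k ?D' k] E'(3) carrier_matD[OF AX] L(1) by simp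
    also have "\<dots> = 1\<^sub>m k" unfolding UAXL using pos by (intro mat_diag_inverse) (metis less_irrefl)
    finally show "Uk\<^sup>T * Q * (Q\<^sup>T * A * (X * L * ?D')) = 1\<^sub>m k" .
  qed
  \<comment> \<open>The competitor has columns in the range of the sketch: \<open>T\<close> is
    \<open>L\<close> for a vanishing residual, which reproduces \<open>A\<close> exactly, and
    \<open>F x\<close> otherwise.\<close>
  obtain T where T: "T \<in> carrier_mat r k"
    and close: "fip (A - A * X * T * Vk\<^sup>T) (A - A * X * T * Vk\<^sup>T) \<le> (1 + \<epsilon>)\<^sup>2 * \<tau>"
  proof (cases "\<tau> = 0")
    case True
    then have E0: "E' = 0\<^sub>m n d" using fip_self_eq_0[OF E'(1)] E'(9) by simp
    have "A * X * L * Vk\<^sup>T = A"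
    proof -
      have "A * X * L = Uk * ?D" unfolding AXL E0 using XL E'(3) by simp
      moreover have "A = Uk * ?D * Vk\<^sup>T" using E'(2) UDV unfolding E0 by simp
      ultimately show ?thesis by simp
    qed
    moreover have "fip (A - A) (A - A) = 0" by (simp add: fip_def)
    ultimately show thesis using that[OF L(1)] True by simp
  next
    case False
    have \<tau>0: "0 \<le> \<tau>" by (simp add: \<tau>_def sum_nonneg)
    have "fip (A - A * X * F x * Vk\<^sup>T) (A - A * X * F x * Vk\<^sup>T)
        \<le> \<tau> + fip (E' * X * F x) (E' * X * F x) + \<delta> * fip ?D ?D * tr x"
      using sketch_error[OF E'(3,4) mat_diag_dim E'(1,7,8,2), of x] unfolding X_def E'(9) .
    also have "\<delta> * fip ?D ?D * tr x \<le> \<tau> * \<epsilon>"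
      using small(3) False tr \<tau>0 tr_nonneg unfolding fip_mat_diag \<tau>_def by (intro mult_mono) auto
    finally have "fip (A - A * X * F x * Vk\<^sup>T) (A - A * X * F x * Vk\<^sup>T) \<le> \<tau> + \<epsilon> * \<tau> + \<tau> * \<epsilon>"
      using Y by linarith
    also have "\<dots> \<le> (1 + \<epsilon>)\<^sup>2 * \<tau>" using \<tau>0 by (simp add: power2_sum algebra_simps)
    finally show thesis using that[OF F_carrier] by blast
  qed
  define Z where "Z = A * X * T * Vk\<^sup>T"
  have AXT: "A * X * T \<in> carrier_mat n k" using carrier_matD[OF AX] T by simp
  have Z: "Z \<in> carrier_mat n d" using AXT E'(5) by (simp add: Z_def)
  have QZ: "Q * (Q\<^sup>T * Z) = Z"
    using QBT[of "T * Vk\<^sup>T" d] assoc_mult_mat[OF AX T, of "Vk\<^sup>T" d] T E'(5) by (simp add: Z_def)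
  have rkZ: "mat_rank Z \<le> k" unfolding Z_def using rank_mult_le[OF AXT, of "Vk\<^sup>T" d] E'(5) by simp
  \<comment> \<open>Correctness of \<open>lsv\<close> covers every matrix, so it yields
    decompositions also where the program computes none.\<close>
  have svd_ex: "\<exists>U s V. is_svd B U s V" if "B \<in> carrier_mat m n" for m n B
    using left_svd_routineD[OF lsv that] by metis
  show ?thesis
    by (rule projected_svd_leverage[OF svd_ex A k1 svdA kl \<epsilon> Q(1,2) svdC rkC Z QZ rkZ
          close[folded Z_def, unfolded \<tau>_def] res])
qed

section \<open>Transfer to the given probability space\<close>

text \<open>Independence means that the joint law is the product of the marginals. Points of a
  product measure are extensional, hence the restriction to \<open>I\<close>; the characterisation
  is for nonempty index sets, hence positive \<open>d\<close> and \<open>r\<close>.\<close>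

lemma iid_std_gaussian_distr:
  assumes M: "prob_space M" and G: "iid_std_gaussian M d r G" and dr: "0 < d" "0 < r"
  defines "I \<equiv> {..<d} \<times> {..<r}"
  defines "X \<equiv> \<lambda>\<omega>. \<lambda>p\<in>I. case p of (i, j) \<Rightarrow> G i j \<omega>"
  shows "X \<in> measurable M (gaussian I)" "distr M (gaussian I) X = gaussian I"
proof -
  interpret prob_space M by (rule M)
  have D: "distributed M lborel (G i j) (\<lambda>x. ennreal (std_normal_density x))" if "i < d" "j < r" for i j
    using G that by (auto simp: iid_std_gaussian_def)
  have m: "(\<lambda>(i, j). G i j) p \<in> borel_measurable M" if "p \<in> I" for p
    using that distributed_measurable[OF D] by (auto simp: I_def)
  have sets: "sets (gaussian I) = sets (Pi\<^sub>M I (\<lambda>_. borel))"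
    unfolding gaussian_def by (intro sets_PiM_cong) auto
  have X: "X = (\<lambda>\<omega>. \<lambda>p\<in>I. (\<lambda>(i, j). G i j) p \<omega>)"
    unfolding X_def by (intro ext) (auto simp: restrict_def split: prod.split)
  have "X \<in> measurable M (Pi\<^sub>M I (\<lambda>_. borel))" unfolding X using m by (intro measurable_restrict)
  then show "X \<in> measurable M (gaussian I)" by (simp only: measurable_cong_sets[OF refl sets])
  have "I \<noteq> {}" using dr by (auto simp: I_def)
  from indep_vars_iff_distr_eq_PiM'[where M' = "\<lambda>_. borel" and X = "\<lambda>(i, j). G i j", OF this m]
  have "distr M (Pi\<^sub>M I (\<lambda>_. borel)) X = Pi\<^sub>M I (\<lambda>p. distr M borel ((\<lambda>(i, j). G i j) p))"
    using G unfolding X iid_std_gaussian_def I_def by simp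
  also have "\<dots> = gaussian I"
    unfolding gaussian_def
  proof (rule PiM_cong[OF refl])
    fix p assume "p \<in> I"
    then obtain i j where p: "p = (i, j)" "i < d" "j < r" by (auto simp: I_def)
    have "distr M borel (G i j) = distr M lborel (G i j)" by (intro distr_cong) auto
    then show "distr M borel ((\<lambda>(i, j). G i j) p) = std_normal_distribution"
      using distributed_distr_eq_density[OF D[OF p(2,3)]] p(1) by simp
  qed
  also have "distr M (Pi\<^sub>M I (\<lambda>_. borel)) X = distr M (gaussian I) X"
    using sets by (intro distr_cong) auto
  finally show "distr M (gaussian I) X = gaussian I" .
qed

text \<open>The event is the preimage of a good set of sketches. The routines are arbitrary
  functions, so measurability of the set of all successful outcomes cannot be expected.\<close>

lemma frobenius_lev_success:
  fixes M :: "'w measure"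
  assumes orth: "orthonormal_basis_routine orth" and lsv: "left_svd_routine lsv"
    and M: "prob_space M" and A: "A \<in> carrier_mat n d" and k1: "1 \<le> k" and rk: "k \<le> mat_rank A"
    and \<epsilon>: "0 < \<epsilon>" and r: "sketch_size k \<epsilon> \<le> r" and G: "iid_std_gaussian M d r G"
  shows "\<exists>E \<in> sets M. measure M E \<ge> 7 / 10 \<and>
    (\<forall>\<omega> \<in> E. leverage_approx 1 \<epsilon> k A (result (frobenius_lev orth lsv A k r (\<lambda>i j. G i j \<omega>))))"
proof -
  obtain UA sA VA where svdA: "is_svd A UA sA VA" using left_svd_routineD[OF lsv A] by metis
  have kl: "k \<le> min n d" using svd_rank_ge(1)[OF svdA A rk] .
  have dr: "0 < d" "0 < r" using kl k1 r by (auto simp: sketch_size_def)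
  define \<tau> where "\<tau> = (\<Sum>i=k..<min n d. (sA $ i)\<^sup>2)"
  define \<sigma> where "\<sigma> = (\<Sum>i<k. (sA $ i)\<^sup>2)"
  have \<tau>0: "0 \<le> \<tau>" and \<sigma>0: "0 \<le> \<sigma>" by (simp_all add: \<tau>_def \<sigma>_def sum_nonneg)
  \<comment> \<open>The first bound makes \<open>\<delta> * \<epsilon> < 1\<close>, for
    invertibility; the second caps the bias by the optimal error, with \<open>\<sigma> + 1\<close>
    keeping the denominator positive.\<close>
  define \<delta> where "\<delta> = (if \<tau> = 0 then 1 / (2 * \<epsilon>) else min (1 / (2 * \<epsilon>)) (\<tau> / (\<sigma> + 1)))"
  have \<delta>0: "0 < \<delta>" using \<epsilon> \<tau>0 \<sigma>0 by (auto simp: \<delta>_def)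
  have "\<delta> \<le> 1 / (2 * \<epsilon>)" by (auto simp: \<delta>_def)
  then have \<delta>1: "\<delta> * \<epsilon> < 1" using \<epsilon> by (simp add: field_simps)
  have \<delta>2: "\<delta> * \<sigma> \<le> \<tau> \<or> \<tau> = 0"
  proof (cases "\<tau> = 0")
    case False
    have "\<delta> * \<sigma> \<le> \<delta> * (\<sigma> + 1)" using \<delta>0 by simp
    also have "\<dots> \<le> \<tau> / (\<sigma> + 1) * (\<sigma> + 1)"
      using False \<sigma>0 by (intro mult_right_mono) (auto simp: \<delta>_def)
    also have "\<dots> = \<tau>" using \<sigma>0 by simp
    finally show ?thesis by simp
  qed simp
  define Uk Vk where "Uk = first_cols k UA" and "Vk = first_cols k VA"
  let ?D = "mat_diag k (\<lambda>i. sA $ i)"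
  obtain E where E: "E \<in> carrier_mat n d" "A = Uk * ?D * Vk\<^sup>T + E"
      "Uk \<in> carrier_mat n k" "Vk \<in> carrier_mat d k" "Vk\<^sup>T * Vk = 1\<^sub>m k" "E * Vk = 0\<^sub>m n k"
    using svd_split[OF svdA A kl] unfolding Uk_def Vk_def by metis
  have UDV: "Uk * ?D * Vk\<^sup>T \<in> carrier_mat n d" using E(3,4) by simp
  have "S + T - S = T" if "S \<in> carrier_mat n d" "T \<in> carrier_mat n d" for S T :: "real mat"
    using that by (intro eq_matI) auto
  from this[OF UDV E(1)] have EA: "E = A - Uk * ?D * Vk\<^sup>T" unfolding E(2)[symmetric] by simp
  interpret ridge d r k Vk \<delta> using E(4,5) \<delta>0 by unfold_locales
  obtain S where S: "S \<in> sets (gaussian I)" "7 / 10 \<le> measure (gaussian I) S"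
    "\<And>x. x \<in> S \<Longrightarrow> tr x \<le> \<epsilon>"
    "\<And>x. x \<in> S \<Longrightarrow> fip (E * Matrix.mat d r x * F x) (E * Matrix.mat d r x * F x) \<le> \<epsilon> * fip E E"
    using good_event[OF E(1,6) \<epsilon> k1 r] by metis
  define X where "X \<omega> = (\<lambda>p\<in>I. case p of (i, j) \<Rightarrow> G i j \<omega>)" for \<omega>
  note X = iid_std_gaussian_distr[OF M G dr, folded X_def]
  have Xm: "Matrix.mat d r (X \<omega>) = Matrix.mat d r (\<lambda>(i, j). G i j \<omega>)" for \<omega>
    by (intro cong_mat) (auto simp: X_def)
  define Ev where "Ev = X -` S \<inter> space M"
  have "Ev \<in> sets M" unfolding Ev_def by (rule measurable_sets[OF X(1) S(1)])
  moreover have "7 / 10 \<le> measure M Ev"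
    using S(2) measure_distr[OF X(1) S(1)] unfolding X(2) Ev_def by simp
  moreover have "leverage_approx 1 \<epsilon> k A (result (frobenius_lev orth lsv A k r (\<lambda>i j. G i j \<omega>)))"
    if \<omega>: "\<omega> \<in> Ev" for \<omega>
  proof -
    define x where "x = (\<lambda>(i, j). G i j \<omega>)"
    have mx: "Matrix.mat d r (X \<omega>) = Matrix.mat d r x" unfolding x_def by (rule Xm)
    \<comment> \<open>\<open>X \<omega>\<close> and \<open>x\<close> may differ outside
      \<open>I\<close>, but all quantities see only the \<open>d \<times> r\<close> matrix.\<close>
    have eqs: "tr (X \<omega>) = tr x" "F (X \<omega>) = F x"
      by (simp_all add: tr_def F_def R_def H_def G_def mx)
    have XS: "X \<omega> \<in> S" using \<omega> by (simp add: Ev_def)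
    show ?thesis
      by (rule frobenius_lev_correct[OF orth lsv A k1 svdA rk \<epsilon> \<delta>0 \<delta>1 \<delta>2[unfolded \<tau>_def \<sigma>_def]
            EA[unfolded Uk_def Vk_def] x_def])
        (use S(3,4)[OF XS] in \<open>simp_all only: eqs mx Vk_def[symmetric]\<close>)
  qed
  ultimately show ?thesis by blast
qed

section \<open>Step counts\<close>

text \<open>The two products with \<open>A\<close> account for the term linear in \<open>r\<close>;
  the basis costs \<open>n * r\<^sup>2\<close>, and decomposing a \<open>q \<times> d\<close> matrix
  with \<open>q \<le> r\<close> costs \<open>d * r\<^sup>2\<close>, up to constants.\<close>

lemma frobenius_lev_steps:
  assumes orth: "orthonormal_basis_routine orth" and lsv: "left_svd_routine lsv"
  obtains c where "0 \<le> c" "\<And>A n d k r g. A \<in> carrier_mat n d \<Longrightarrow> 0 < n \<Longrightarrow> 0 < d \<Longrightarrow> 1 \<le> k \<Longrightarrow> k \<le> r \<Longrightarrow>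
    real (steps (frobenius_lev orth lsv A k r g)) \<le> c * (real n * real d * real r + real (n + d) * real r ^ 2)"
proof -
  obtain c1 where c1: "\<And>n r B. B \<in> carrier_mat n r \<Longrightarrow> 0 < n \<Longrightarrow>
      real (steps (orth B)) \<le> c1 * (real n * real r ^ 2 + 1)"
    using orth unfolding orthonormal_basis_routine_def by blast
  obtain c2 where c2: "\<And>m n B. B \<in> carrier_mat m n \<Longrightarrow>
      real (steps (lsv B)) \<le> c2 * (real m * real n * real (min m n) + 1)"
    using lsv unfolding left_svd_routine_def by blast
  \<comment> \<open>8 covers the coefficients of the program itself; absolute values guard against
    negative routine constants, and the factors 2 absorb the additive 1 in the routine
    costs.\<close>
  define c where "c = 8 + 2 * \<bar>c1\<bar> + 2 * \<bar>c2\<bar>"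
  have "real (steps (frobenius_lev orth lsv A k r g)) \<le> c * (real n * real d * real r + real (n + d) * real r ^ 2)"
    if A: "A \<in> carrier_mat n d" and n: "0 < n" and d: "0 < d" and k: "1 \<le> k" "k \<le> r" for A n d k r g
  proof -
    define B where "B = A * Matrix.mat d r (\<lambda>(i, j). g i j)"
    have B: "B \<in> carrier_mat n r" using A by (simp add: B_def)
    define Q where "Q = result (orth B)"
    obtain q where Q: "Q \<in> carrier_mat n q" "q \<le> r"
      using orthonormal_basis_routineD[OF orth B n] unfolding Q_def by metis
    define C where "C = Q\<^sup>T * A"
    have C: "C \<in> carrier_mat q d" using Q(1) A by (simp add: C_def)
    have r1: "result (mult_timed A (Matrix.mat d r (\<lambda>(i, j). g i j))) = B"
      using result_mult_timed[of A "Matrix.mat d r (\<lambda>(i, j). g i j)"] A by (simp add: B_def)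
    have r2: "result (mult_timed (Q\<^sup>T) A) = C"
      using result_mult_timed[of "Q\<^sup>T" A] Q(1) A by (simp add: C_def)
    have dims: "dim_row A = n" "dim_col A = d" "dim_row Q = n" "dim_col Q = q"
      "\<And>U. dim_col (first_cols k U) = k" using A Q(1) by (auto simp: first_cols_def)
    have "steps (frobenius_lev orth lsv A k r g)
        = 2 * d * r + n * (r * (2 * d + 1)) + steps (orth B) + q * (d * (2 * n + 1)) + steps (lsv C)
          + n * (k * (2 * q + 1)) + n * (2 * k + 1) + 2 * n"
      unfolding frobenius_lev_def timed_simps steps_mult_timed dims r1 Q_def[symmetric] r2
      by (simp add: dims)
    also have "\<dots> = 2 * (d * r) + 2 * (n * (d * r)) + n * r + steps (orth B) + 2 * (q * (d * n)) + q * d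
        + steps (lsv C) + 2 * (n * (k * q)) + 3 * (n * k) + 3 * n" by (simp add: algebra_simps)
    also have "\<dots> \<le> 8 * (n * (d * r)) + steps (orth B) + steps (lsv C) + 8 * (n * r\<^sup>2)"
    proof -
      \<comment> \<open>The nonlinear products are abstracted to atoms to keep the arithmetic
        linear; in \<open>a\<close> and in \<open>b\<close> the coefficients add up to 8.\<close>
      have sum: "2 * a1 + 2 * a + a2 + x + 2 * a3 + a4 + y + 2 * b1 + 3 * b2 + 3 * b3 \<le> 8 * a + x + y + 8 * b"
        if "a1 \<le> a" "a2 \<le> a" "a3 \<le> a" "a4 \<le> a" "b1 \<le> b" "b2 \<le> b" "b3 \<le> b"
        for a a1 a2 a3 a4 b b1 b2 b3 x y :: nat
        using that by linarith
      have r: "1 \<le> r" using k by simp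
      have rr: "r \<le> r\<^sup>2" "1 \<le> r\<^sup>2" using r by (auto simp: power2_eq_square)
      have qr: "q * (d * n) \<le> n * (d * r)" "q * d \<le> d * r"
        using mult_le_mono1[OF Q(2), of "d * n"] mult_le_mono1[OF Q(2), of d] by (simp_all only: mult_ac)
      have nd: "d * r \<le> n * (d * r)" "n * r \<le> n * (d * r)" using n d by simp_all
      have kr: "k * q \<le> r\<^sup>2" "k \<le> r\<^sup>2"
        using mult_le_mono[OF k(2) Q(2)] le_trans[OF k(2) rr(1)] by (simp_all only: power2_eq_square)
      have "n * (k * q) \<le> n * r\<^sup>2" "n * k \<le> n * r\<^sup>2" "n \<le> n * r\<^sup>2"
        using mult_le_mono2[OF kr(1), of n] mult_le_mono2[OF kr(2), of n] mult_le_mono2[OF rr(2), of n] by simp_all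
      then show ?thesis by (rule sum[OF nd qr(1) le_trans[OF qr(2) nd(1)]])
    qed
    finally have "real (steps (frobenius_lev orth lsv A k r g))
        \<le> real (8 * (n * (d * r)) + steps (orth B) + steps (lsv C) + 8 * (n * r\<^sup>2))"
      by (simp only: of_nat_le_iff)
    then have st: "real (steps (frobenius_lev orth lsv A k r g))
        \<le> 8 * (real n * real d * real r) + real (steps (orth B)) + real (steps (lsv C)) + 8 * (real n * (real r)\<^sup>2)"
      by simp
    have R1: "1 \<le> real n * (real r)\<^sup>2" "1 \<le> real d * (real r)\<^sup>2"
    proof -
      have "1 \<le> n * r\<^sup>2" "1 \<le> d * r\<^sup>2" using n d k by auto
      then have "real 1 \<le> real (n * r\<^sup>2)" "real 1 \<le> real (d * r\<^sup>2)" by (simp_all only: of_nat_le_iff)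
      then show "1 \<le> real n * (real r)\<^sup>2" "1 \<le> real d * (real r)\<^sup>2" by simp_all
    qed
    have "real (steps (orth B)) \<le> c1 * (real n * real r ^ 2 + 1)" by (rule c1[OF B n])
    also have "\<dots> \<le> \<bar>c1\<bar> * (real n * real r ^ 2 + 1)" by (intro mult_right_mono) auto
    also have "\<dots> \<le> \<bar>c1\<bar> * (2 * (real n * (real r)\<^sup>2))" using R1 by (intro mult_left_mono) auto
    finally have o: "real (steps (orth B)) \<le> 2 * \<bar>c1\<bar> * (real n * (real r)\<^sup>2)" by simp
    have "real (steps (lsv C)) \<le> c2 * (real q * real d * real (min q d) + 1)" by (rule c2[OF C])
    also have "\<dots> \<le> \<bar>c2\<bar> * (real q * real d * real (min q d) + 1)" by (intro mult_right_mono) auto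
    also have "\<dots> \<le> \<bar>c2\<bar> * (real r * real d * real r + 1)"
      using Q(2) by (intro mult_left_mono add_right_mono mult_mono) auto
    also have "\<dots> \<le> \<bar>c2\<bar> * (2 * (real d * (real r)\<^sup>2))"
      using R1 by (intro mult_left_mono) (auto simp: power2_eq_square mult_ac)
    finally have l: "real (steps (lsv C)) \<le> 2 * \<bar>c2\<bar> * (real d * (real r)\<^sup>2)" by simp
    define a b e where "a = real n * real d * real r" and "b = real n * (real r)\<^sup>2" and "e = real d * (real r)\<^sup>2"
    have nn: "0 \<le> a" "0 \<le> b" "0 \<le> e" by (simp_all add: a_def b_def e_def)
    have "0 \<le> \<bar>c1\<bar> * a" "0 \<le> \<bar>c2\<bar> * a" "0 \<le> \<bar>c2\<bar> * b" "0 \<le> \<bar>c1\<bar> * e" using nn by simp_all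
    then have "8 * a + 2 * \<bar>c1\<bar> * b + 2 * \<bar>c2\<bar> * e + 8 * b \<le> c * (a + (b + e))"
      using nn unfolding c_def by (simp add: algebra_simps)
    then show ?thesis using st o l unfolding a_def b_def e_def by (simp add: distrib_right)
  qed
  then show thesis using that[of c] by (simp add: c_def)
qed

text \<open>The constant of the time bound depends on the cap \<open>\<epsilon>\<^sub>0\<close>: for
  growing \<epsilon> the sketch keeps more than \<open>k\<close> columns while
  \<open>k / \<epsilon>\<close> tends to 0, so no single constant serves all \<epsilon>.\<close>

theorem theorem4:
  fixes orth lsv :: "real mat \<Rightarrow> real mat timed"
  assumes "orthonormal_basis_routine orth" and "left_svd_routine lsv"
  shows
    "(\<forall>(M :: 'w measure) (G :: nat \<Rightarrow> nat \<Rightarrow> 'w \<Rightarrow> real) (n :: nat) (d :: nat) (A :: real mat)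
        (k :: nat) (r :: nat) (\<epsilon> :: real).
        prob_space M \<and> A \<in> carrier_mat n d \<and> 1 \<le> k \<and> k \<le> mat_rank A \<and> 0 < \<epsilon> \<and>
        sketch_size k \<epsilon> \<le> r \<and> iid_std_gaussian M d r G \<longrightarrow>
        (\<exists>E \<in> sets M. measure M E \<ge> 7 / 10 \<and>
           (\<forall>\<omega> \<in> E. leverage_approx 1 \<epsilon> k A
              (result (frobenius_lev orth lsv A k r (\<lambda>i j. G i j \<omega>))))))
     \<and>
     (\<forall>\<epsilon>\<^sub>0 > 0. \<exists>C :: real.
        \<forall>(n :: nat) (d :: nat) (A :: real mat) (k :: nat) (\<epsilon> :: real) (g :: nat \<Rightarrow> nat \<Rightarrow> real).
        A \<in> carrier_mat n d \<and> 1 \<le> k \<and> k \<le> mat_rank A \<and> 0 < \<epsilon> \<and> \<epsilon> \<le> \<epsilon>\<^sub>0 \<longrightarrow>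
        real (steps (frobenius_lev orth lsv A k (sketch_size k \<epsilon>) g)) \<le>
          C * (real n * real d * real k / \<epsilon> + real (n + d) * real k ^ 2 / \<epsilon> ^ 2))"
proof (intro conjI allI impI)
  fix M :: "'w measure" and G :: "nat \<Rightarrow> nat \<Rightarrow> 'w \<Rightarrow> real" and n d :: nat and A :: "real mat"
    and k r :: nat and \<epsilon> :: real
  assume "prob_space M \<and> A \<in> carrier_mat n d \<and> 1 \<le> k \<and> k \<le> mat_rank A \<and> 0 < \<epsilon> \<and>
    sketch_size k \<epsilon> \<le> r \<and> iid_std_gaussian M d r G"
  then show "\<exists>E \<in> sets M. measure M E \<ge> 7 / 10 \<and>
      (\<forall>\<omega> \<in> E. leverage_approx 1 \<epsilon> k A (result (frobenius_lev orth lsv A k r (\<lambda>i j. G i j \<omega>))))"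
    using frobenius_lev_success[OF assms] by blast
next
  fix \<epsilon>\<^sub>0 :: real assume \<epsilon>\<^sub>0: "0 < \<epsilon>\<^sub>0"
  obtain c where c: "0 \<le> c" "\<And>A n d k r g. A \<in> carrier_mat n d \<Longrightarrow> 0 < n \<Longrightarrow> 0 < d \<Longrightarrow> 1 \<le> k \<Longrightarrow> k \<le> r \<Longrightarrow>
    real (steps (frobenius_lev orth lsv A k r g)) \<le> c * (real n * real d * real r + real (n + d) * real r ^ 2)"
    using frobenius_lev_steps[OF assms] by blast
  \<comment> \<open>From \<open>r \<le> 3 * k + 10 * k / \<epsilon>\<close>, where 3 covers
    \<open>k\<close> and the rounding, and
    \<open>k \<le> \<epsilon>\<^sub>0 * k / \<epsilon>\<close>; since \<open>b \<ge> 1\<close>, the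
    factor \<open>b\<^sup>2\<close> serves the linear and the quadratic term alike.\<close>
  define b where "b = 3 * \<epsilon>\<^sub>0 + 10"
  have "real (steps (frobenius_lev orth lsv A k (sketch_size k \<epsilon>) g)) \<le>
      c * b\<^sup>2 * (real n * real d * real k / \<epsilon> + real (n + d) * real k ^ 2 / \<epsilon> ^ 2)"
    if h: "A \<in> carrier_mat n d \<and> 1 \<le> k \<and> k \<le> mat_rank A \<and> 0 < \<epsilon> \<and> \<epsilon> \<le> \<epsilon>\<^sub>0" for n d A k \<epsilon> g
  proof -
    have A: "A \<in> carrier_mat n d" and k: "1 \<le> k" "k \<le> mat_rank A" and \<epsilon>: "0 < \<epsilon>" "\<epsilon> \<le> \<epsilon>\<^sub>0" using h by auto
    obtain U s V where svd: "is_svd A U s V" using left_svd_routineD[OF assms(2) A] by metis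
    have nd: "0 < n" "0 < d" using svd_rank_ge(1)[OF svd A k(2)] k(1) by auto
    define r where "r = sketch_size k \<epsilon>"
    have kr: "k \<le> r" by (simp add: r_def sketch_size_def)
    have "0 \<le> 10 * real k / \<epsilon>" using \<epsilon> by simp
    then have "real (nat \<lceil>10 * real k / \<epsilon> + 1\<rceil>) \<le> 10 * real k / \<epsilon> + 2" by linarith
    then have "real r \<le> 3 * real k + 10 * real k / \<epsilon>" using k by (simp add: r_def sketch_size_def)
    also have "3 * real k \<le> 3 * \<epsilon>\<^sub>0 * (real k / \<epsilon>)"
    proof -
      have "real k * \<epsilon> \<le> real k * \<epsilon>\<^sub>0" using \<epsilon> by (intro mult_left_mono) auto
      then show ?thesis using \<epsilon> by (simp add: field_simps)
    qed
    finally have rb: "real r \<le> b * (real k / \<epsilon>)" by (simp add: b_def distrib_right add_divide_distrib)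
    have b: "1 \<le> b" "b \<le> b\<^sup>2" using \<epsilon>\<^sub>0 by (auto simp: b_def power2_eq_square)
    have K: "0 \<le> real k / \<epsilon>" using \<epsilon> by simp
    have rb1: "real r \<le> b\<^sup>2 * (real k / \<epsilon>)" using rb mult_right_mono[OF b(2) K] by linarith
    have rb2: "(real r)\<^sup>2 \<le> b\<^sup>2 * (real k / \<epsilon>)\<^sup>2"
      using power_mono[OF rb of_nat_0_le_iff, of 2] unfolding power_mult_distrib .
    have "real (steps (frobenius_lev orth lsv A k r g)) \<le> c * (real n * real d * real r + real (n + d) * real r ^ 2)"
      by (rule c(2)[OF A nd k(1) kr])
    also have "\<dots> \<le> c * (real n * real d * (b\<^sup>2 * (real k / \<epsilon>)) + real (n + d) * (b\<^sup>2 * (real k / \<epsilon>)\<^sup>2))"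
      using c(1) rb1 rb2 by (intro mult_left_mono add_mono) auto
    also have "\<dots> = c * b\<^sup>2 * (real n * real d * real k / \<epsilon> + real (n + d) * real k ^ 2 / \<epsilon> ^ 2)"
      by (simp add: algebra_simps power_divide)
    finally show ?thesis by (simp add: r_def)
  qed
  then show "\<exists>C :: real. \<forall>(n :: nat) (d :: nat) (A :: real mat) (k :: nat) (\<epsilon> :: real) (g :: nat \<Rightarrow> nat \<Rightarrow> real).
      A \<in> carrier_mat n d \<and> 1 \<le> k \<and> k \<le> mat_rank A \<and> 0 < \<epsilon> \<and> \<epsilon> \<le> \<epsilon>\<^sub>0 \<longrightarrow>
      real (steps (frobenius_lev orth lsv A k (sketch_size k \<epsilon>) g)) \<le>
        C * (real n * real d * real k / \<epsilon> + real (n + d) * real k ^ 2 / \<epsilon> ^ 2)"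
    by blast
qed

end
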